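(* Let $\mathcal E\subset \mathbb{R}\mathrm{P}^8$ be the essential variety and let $L\sim\psi$ be the random linear space $L=\{E\in\mathbb{R}\mathrm{P}^8\mid \mathbf u_1^TE\mathbf v_1=\cdots=\mathbf u_5^TE\mathbf v_5=0\}$ with $\mathbf u_1,\mathbf v_1,\ldots,\mathbf u_5,\mathbf v_5\sim\mathrm{Unif}(\mathbb{R}\mathrm{P}^2)$ i.i.d. Then $$\mathop{\mathbb E}_{L\sim\psi}\#(\mathcal E\cap L)=\frac{\pi^3}{4}\cdot \mathop{\mathbb E}\left|\det\begin{bmatrix}\mathbf z_1&\mathbf z_2&\mathbf z_3&\mathbf z_4&\mathbf z_5\end{bmatrix}\right|,$$ where $\mathbf z_1,\ldots,\mathbf z_5$ are i.i.d. copies of the random vector $$\mathbf z=\begin{bmatrix} b\, r\sin\theta, & b\, r\cos\theta, & a\, s\sin\theta, & a\, s\cos\theta, & rs\end{bmatrix}^T\in\mathbb R^5,$$ with $a,b,r,s\sim N(0,1)$ and $\theta\sim\mathrm{Unif}([0,2\pi))$ all independent.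
   Context: For $\mathbf t\in\mathbb R^3$ let $[\mathbf t]_\times\in\mathbb R^{3\times 3}$ be the matrix with $[\mathbf t]_\times\mathbf x=\mathbf t\times\mathbf x$ (cross product) for all $\mathbf x\in\mathbb R^3$. For $R\in\mathrm{SO}(3)$ and $\mathbf t\in\mathbb R^3$ put $E(R,\mathbf t)=[\mathbf t]_\times R$, and let $\widehat{\mathcal E}=\{E(R,\mathbf t)\mid R\in\mathrm{SO}(3),\ \mathbf t\in\mathbb R^3\}\subset\mathbb R^{3\times 3}$. The essential variety $\mathcal E\subset \mathrm P(\mathbb R^{3\times 3})\cong\mathbb{R}\mathrm{P}^8$ is the image of $\widehat{\mathcal E}\setminus\{0\}$ under projectivization; elements of $\mathbb{R}\mathrm{P}^8$ are viewed as real $3\times 3$ matrices up to scaling. $\mathrm{Unif}(\mathbb{R}\mathrm{P}^2)$ is the law of $U\cdot\mathbf a_0$, where $\mathbf a_0\in\mathbb{R}\mathrm{P}^2$ is fixed and $U$ is distributed according to the normalized Haar measure on $\mathrm O(3)$ (it does not depend on $\mathbf a_0$). The condition $\mathbf u^TE\mathbf v=0$ is independent of the chosen representatives of $\mathbf u,\mathbf v\in\mathbb{R}\mathrm{P}^2$ and $E\in\mathbb{R}\mathrm{P}^8$. $\psi$ denotes the resulting distribution of $L$. $\#$ denotes the number of (real) points. *)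

theory Defs
  imports "HOL-Probability.Probability" "HOL-Analysis.Cross3"
begin

definition proj_rel :: "'a::euclidean_space \<Rightarrow> 'a \<Rightarrow> bool" where
  "proj_rel x y \<longleftrightarrow> x \<noteq> 0 \<and> y \<noteq> 0 \<and> (\<exists>c. c \<noteq> 0 \<and> y = c *\<^sub>R x)"

lemma proj_rel_refl: "x \<noteq> 0 \<Longrightarrow> proj_rel x x"
  unfolding proj_rel_def by (auto intro: exI[of _ 1])

lemma part_equivp_proj_rel: "part_equivp (proj_rel :: 'a::euclidean_space \<Rightarrow> 'a \<Rightarrow> bool)"
proof (rule part_equivpI)
  obtain b :: 'a where "b \<in> Basis" using nonempty_Basis by blast
  then have "b \<noteq> 0" using nonzero_Basis by blast
  then show "\<exists>x::'a. proj_rel x x"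
    unfolding proj_rel_def by (intro exI[of _ b]) (auto intro: exI[of _ 1])
  show "symp (proj_rel :: 'a \<Rightarrow> _)"
  proof (rule sympI)
    fix x y :: 'a assume "proj_rel x y"
    then obtain c where c: "x \<noteq> 0" "y \<noteq> 0" "c \<noteq> 0" "y = c *\<^sub>R x"
      unfolding proj_rel_def by blast
    then have "x = inverse c *\<^sub>R y" by simp
    with c show "proj_rel y x" unfolding proj_rel_def
      by (metis inverse_nonzero_iff_nonzero)
  qed
  show "transp (proj_rel :: 'a \<Rightarrow> _)"
  proof (rule transpI)
    fix x y z :: 'a assume "proj_rel x y" "proj_rel y z"
    then obtain c d where "x \<noteq> 0" "z \<noteq> 0" "c \<noteq> 0" "d \<noteq> 0" "z = (d * c) *\<^sub>R x"
      unfolding proj_rel_def by auto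
    then show "proj_rel x z" unfolding proj_rel_def
      by (intro conjI exI[of _ "d * c"]) auto
  qed
qed

text \<open>The real projective space of lines in a Euclidean space: \<open>(real^3) proj\<close> is the real
  projective plane and \<open>(real^3^3) proj\<close> is the 8-dimensional projective space of real
  3x3 matrices up to scaling.\<close>

quotient_type (overloaded) 'a proj = "'a::euclidean_space" / partial: proj_rel
  by (rule part_equivp_proj_rel)

text \<open>\<open>Proj 0\<close> is an unspecified point; only \<open>Proj x\<close> with \<open>x \<noteq> 0\<close> is meaningful.\<close>

definition Proj :: "'a::euclidean_space \<Rightarrow> 'a proj" where
  "Proj = abs_proj"

definition proj_rep :: "'a::euclidean_space proj \<Rightarrow> 'a" where
  "proj_rep = rep_proj"

lemma Proj_eq_iff:
  assumes "x \<noteq> 0" "y \<noteq> 0"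
  shows "Proj x = Proj y \<longleftrightarrow> (\<exists>c. c \<noteq> 0 \<and> y = c *\<^sub>R x)"
  using Quotient3_rel[OF Quotient3_proj, of x y] proj_rel_refl[of x] proj_rel_refl[of y] assms
  by (simp add: Proj_def proj_rel_def)

lemma proj_rep: "proj_rep p \<noteq> 0" "Proj (proj_rep p) = p"
  using Quotient3_rep_reflp[OF Quotient3_proj, of p] Quotient3_abs_rep[OF Quotient3_proj, of p]
  by (auto simp: Proj_def proj_rep_def proj_rel_def)

text \<open>The quotient topology; the Borel sets of a projective space are taken with respect to it.\<close>

instantiation proj :: (euclidean_space) topological_space
begin

definition open_proj :: "'a proj set \<Rightarrow> bool" where
  "open_proj S \<longleftrightarrow> open {x. x \<noteq> 0 \<and> Proj x \<in> S}"

instance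
proof
  have "{x::'a. x \<noteq> 0 \<and> Proj x \<in> UNIV} = - {0}" by auto
  then show "open (UNIV :: 'a proj set)" unfolding open_proj_def by auto
next
  fix S T :: "'a proj set"
  assume "open S" "open T"
  moreover have "{x. x \<noteq> 0 \<and> Proj x \<in> S \<inter> T} =
      {x. x \<noteq> 0 \<and> Proj x \<in> S} \<inter> {x. x \<noteq> 0 \<and> Proj x \<in> T}" by auto
  ultimately show "open (S \<inter> T)" unfolding open_proj_def by auto
next
  fix K :: "'a proj set set"
  assume "\<forall>S\<in>K. open S"
  moreover have "{x. x \<noteq> 0 \<and> Proj x \<in> \<Union>K} = (\<Union>S\<in>K. {x. x \<noteq> 0 \<and> Proj x \<in> S})" by auto
  ultimately show "open (\<Union>K)" unfolding open_proj_def by auto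
qed

end

definition skew :: "real^3 \<Rightarrow> real^3^3" where
  "skew t = matrix (cross3 t)"

lemma skew_mult: "skew t *v x = cross3 t x"
  unfolding skew_def
  by (simp add: vec_eq_iff forall_3 matrix_def matrix_vector_mult_def axis_def sum_3
      cross3_def algebra_simps)

definition essential_matrices :: "(real^3^3) set" where
  "essential_matrices = {skew t ** R | R t. rotation_matrix R}"

definition essential_variety :: "(real^3^3) proj set" where
  "essential_variety = Proj ` (essential_matrices - {0})"

lift_definition epipolar :: "(real^3) proj \<Rightarrow> (real^3^3) proj \<Rightarrow> (real^3) proj \<Rightarrow> bool"
  is "\<lambda>u E v. u \<bullet> (E *v v) = 0"
  by (auto simp: proj_rel_def scaleR_matrix_vector_assoc[symmetric] matrix_vector_mult_scaleR)

lemma epipolar_Proj: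
  assumes "u \<noteq> 0" "E \<noteq> 0" "v \<noteq> 0"
  shows "epipolar (Proj u) (Proj E) (Proj v) \<longleftrightarrow> u \<bullet> (E *v v) = 0"
  using assms by (simp add: Proj_def epipolar.abs_eq proj_rel_refl)

definition epipolar_space ::
    "(5 \<Rightarrow> (real^3) proj) \<Rightarrow> (5 \<Rightarrow> (real^3) proj) \<Rightarrow> (real^3^3) proj set" where
  "epipolar_space u v = {E. \<forall>i. epipolar (u i) E (v i)}"

text \<open>The number of elements of a set, with value \<open>\<infinity>\<close> for infinite sets.\<close>

definition num_points :: "'a set \<Rightarrow> ennreal" where
  "num_points S = emeasure (count_space UNIV) S"

definition proj_act :: "real^3^3 \<Rightarrow> (real^3) proj \<Rightarrow> (real^3) proj" where
  "proj_act Q p = Proj (Q *v proj_rep p)"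

lemma proj_act_Proj:
  assumes "orthogonal_matrix Q" "x \<noteq> 0"
  shows "proj_act Q (Proj x) = Proj (Q *v x)"
proof -
  let ?y = "proj_rep (Proj x)"
  obtain c where c: "c \<noteq> 0" "x = c *\<^sub>R ?y"
    using Proj_eq_iff[of ?y x] proj_rep[of "Proj x"] assms(2) by auto
  have "Q *v z \<noteq> 0" if "z \<noteq> 0" for z
    using assms(1) that unfolding orthogonal_matrix_def
    by (metis matrix_vector_mul_assoc matrix_vector_mul_lid matrix_vector_mult_0_right)
  then have nz: "Q *v ?y \<noteq> 0" "Q *v x \<noteq> 0" using proj_rep(1) assms(2) by auto
  have "Q *v x = c *\<^sub>R (Q *v ?y)"
    using c(2) by (metis matrix_vector_mult_scaleR)
  then show ?thesis
    unfolding proj_act_def using Proj_eq_iff[OF nz] c(1) by blast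
qed

lemma vector_5:
  "(vector [x1, x2, x3, x4, x5] :: 'a::zero^5) $ 1 = x1"
  "(vector [x1, x2, x3, x4, x5] :: 'a::zero^5) $ 2 = x2"
  "(vector [x1, x2, x3, x4, x5] :: 'a::zero^5) $ 3 = x3"
  "(vector [x1, x2, x3, x4, x5] :: 'a::zero^5) $ 4 = x4"
  "(vector [x1, x2, x3, x4, x5] :: 'a::zero^5) $ 5 = x5"
  unfolding vector_def by simp_all

text \<open>The normalized Haar measure on \<open>O(3)\<close>, characterised as the Borel probability measure
  on \<open>O(3)\<close> that is invariant under left translations.\<close>

definition normalized_haar_O3 :: "(real^3^3) measure \<Rightarrow> bool" where
  "normalized_haar_O3 H \<longleftrightarrow>
     prob_space H \<and>
     sets H = sets (restrict_space borel {Q. orthogonal_matrix Q}) \<and>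
     (\<forall>Q. orthogonal_matrix Q \<longrightarrow> distr H H (\<lambda>U. Q ** U) = H)"

definition unif_RP2 :: "(real^3^3) measure \<Rightarrow> (real^3) proj \<Rightarrow> (real^3) proj measure" where
  "unif_RP2 H a0 = distr H borel (\<lambda>U. proj_act U a0)"

end

theory Submission
  imports Defs
begin

text \<open>Solving each equation for one coordinate avoids a coarea formula: source and target get
  the same dimension and counting solutions becomes counting preimages. The price is a denominator
  \<open>\<bar>(ess x *v v)$3\<bar>\<close>. The third coordinate is the convenient one because the
  first row of a frame is horizontal: if the parts of \<open>u\<close> and \<open>v\<close>
  orthogonal to the poles have signed polar coordinates (r, t + x$5) and (s, t), the denominator is
  \<open>\<bar>sin (x$2) * s * cos (t + x$5)\<bar>\<close>. This is exactly the polar Jacobian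
  \<open>\<bar>s\<bar>\<close> of \<open>v\<close> times the Jacobian of the linear substitution of
  (r, b) for the first two coordinates of \<open>u\<close>. It cancels, and four normal densities
  and 1 / (2 pi) remain. For this the weight has to be both rotation invariant and a product, hence
  Gaussian. With signed radii the common angle runs over [0, pi), half of the circle: this is the
  1/2 per row, and the constant is 8 pi^3 / 2^5 = pi^3 / 4. Integrals take values in
  \<open>ennreal\<close> up to the end, as the number of points is not known beforehand to have
  finite mean; finiteness enters through a crude moment bound for the determinant.\<close>

text \<open>Up to scaling, every essential matrix is \<open>transpose A ** twist g ** B\<close> with frames \<open>A\<close>, \<open>B\<close>
  given by two pairs of spherical angles, and on a suitable box in \<open>\<real>\<^sup>5\<close> this parametrisation is
  injective. Uniform lines may be replaced by Gaussian vectors, and each equation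
  \<open>u \<bullet> (E *v v) = 0\<close> can be solved for the third coordinate of \<open>u\<close>. For fixed remaining data, the
  number of solutions is thus the multiplicity of a map between 5-dimensional spaces, whose
  Gaussian average is the integral of the absolute Jacobian by the area formula. At a fixed point
  of the box the rows of the Jacobian matrix are independent; polar coordinates in the planes
  orthogonal to the two epipoles show that, up to a factor \<open>1/2\<close> in each of the five rows, they are distributed like
  \<open>z\<close> times a matrix whose determinant is the volume density of the box, of total mass \<open>8 * pi ^ 3\<close>.
  The configurations for which some equation cannot be solved in this way are the image of countably many
  hyperplanes under a smooth map between spaces of dimension 30, hence negligible.\<close>

section \<open>The area formula\<close>

text \<open>\<open>has_measure_differentiable_image\<close> is an equivalence between finite measure
  of the image and existence of the integral. Hence it settles both cases: a finite volume directly,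
  and an infinite one because a finite integral would make the image measurable with finite
  measure.\<close>

lemma emeasure_injective_C1_image:
  fixes f :: "real^'n::{finite,wellorder} \<Rightarrow> real^'n::_"
    and J :: "real^'n::_ \<Rightarrow> real^'n::_^'n::_"
  assumes der: "\<And>x. x \<in> S \<Longrightarrow> (f has_derivative (*v) (J x)) (at x)"
    and J: "continuous_on S J"
    and S: "S \<in> sets borel" and inj: "inj_on f S"
  shows "f ` S \<in> sets lebesgue"
    and "emeasure lebesgue (f ` S) = (\<integral>\<^sup>+x. indicator S x * ennreal \<bar>det (J x)\<bar> \<partial>lborel)"
proof -
  have SL: "S \<in> sets lebesgue" using S by simp
  have derS: "\<And>x. x \<in> S \<Longrightarrow> (f has_derivative (*v) (J x)) (at x within S)"
    using der has_derivative_at_withinI by blast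
  show fS: "f ` S \<in> sets lebesgue"
    by (rule differentiable_image_in_sets_lebesgue[OF SL])
      (use derS in \<open>auto simp: differentiable_on_def differentiable_def\<close>)
  define g where "g x = indicator S x * \<bar>det (J x)\<bar>" for x
  have "continuous_on S (\<lambda>x. \<bar>det (J x)\<bar>)"
    unfolding det_def by (intro continuous_intros J)
  then have gm: "g \<in> borel_measurable borel"
    unfolding g_def using borel_measurable_continuous_on_indicator[OF S, of "\<lambda>x. \<bar>det (J x)\<bar>"] by simp
  have g0: "0 \<le> g x" for x by (simp add: g_def)
  have eq: "(\<integral>\<^sup>+x. indicator S x * ennreal \<bar>det (J x)\<bar> \<partial>lborel) = (\<integral>\<^sup>+x. ennreal (g x) \<partial>lborel)"
    unfolding g_def by (intro nn_integral_cong) (auto split: split_indicator)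
  have hi: "((\<lambda>x. \<bar>det (J x)\<bar>) has_integral r) S \<longleftrightarrow> (g has_integral r) UNIV" for r
  proof -
    have "g = (\<lambda>x. if x \<in> S then \<bar>det (J x)\<bar> else 0)"
      by (auto simp: g_def split: split_indicator)
    then show ?thesis by (simp only: has_integral_restrict_UNIV)
  qed
  have key: "f ` S \<in> lmeasurable \<and> measure lebesgue (f ` S) = m \<longleftrightarrow> (g has_integral m) UNIV" for m
    using has_measure_differentiable_image[OF SL derS inj, of m] hi[of m] by simp
  show "emeasure lebesgue (f ` S) = (\<integral>\<^sup>+x. indicator S x * ennreal \<bar>det (J x)\<bar> \<partial>lborel)"
  proof (cases "f ` S \<in> lmeasurable")
    case True
    then have "(g has_integral measure lebesgue (f ` S)) UNIV" using key by blast
    then have "integral\<^sup>N lborel g = measure lebesgue (f ` S)"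
      using nn_integral_has_integral_lborel[OF gm g0] by blast
    then show ?thesis using True eq by (simp add: emeasure_eq_measure2)
  next
    case False
    then have inf: "emeasure lebesgue (f ` S) = \<infinity>"
      using fS by (simp add: fmeasurable_def not_less top_unique del: emeasure_completion)
    have "integral\<^sup>N lborel g = \<infinity>"
    proof (rule ccontr)
      assume "integral\<^sup>N lborel g \<noteq> \<infinity>"
      then obtain r where r: "integral\<^sup>N lborel g = ennreal r" "r \<ge> 0"
        by (cases "integral\<^sup>N lborel g" rule: ennreal_cases) auto
      then have "(g has_integral r) UNIV"
        by (intro nn_integral_has_integral gm) (auto simp: g_def)
      then show False using key False by blast
    qed
    then show ?thesis using inf eq by simp
  qed
qed

text \<open>Two measures on the target agree: the image of the density
  \<open>\<bar>det J\<bar>\<close> on \<open>S\<close>, and Lebesgue measure restricted to the image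
  of \<open>S\<close>. On a Borel set \<open>B\<close> this is the volume formula applied to the
  part of \<open>S\<close> that is mapped into \<open>B\<close>.\<close>

lemma nn_integral_injective_C1_image:
  fixes f :: "real^'n::{finite,wellorder} \<Rightarrow> real^'n::_"
    and J :: "real^'n::_ \<Rightarrow> real^'n::_^'n::_"
  assumes der: "\<And>x. x \<in> S \<Longrightarrow> (f has_derivative (*v) (J x)) (at x)"
    and J: "continuous_on S J"
    and S: "S \<in> sets borel" and inj: "inj_on f S"
    and h: "h \<in> borel_measurable borel"
  shows "(\<integral>\<^sup>+y. indicator (f ` S) y * h y \<partial>lebesgue)
    = (\<integral>\<^sup>+x. indicator S x * ennreal \<bar>det (J x)\<bar> * h (f x) \<partial>lborel)"
proof -
  note [measurable] = S h
  \<comment> \<open>Nothing is known about \<open>f\<close> outside \<open>S\<close>; the cut-off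
    makes it Borel on the whole space.\<close>
  define ft where "ft x = (if x \<in> S then f x else 0)" for x
  define d where "d x = indicator S x * ennreal \<bar>det (J x)\<bar>" for x
  have cf: "continuous_on S f"
    using der by (meson continuous_at_imp_continuous_on has_derivative_continuous)
  have ftm[measurable]: "ft \<in> borel_measurable borel"
    using borel_measurable_continuous_on_indicator[OF S cf]
    by (rule measurable_cong[THEN iffD1, rotated]) (auto simp: ft_def)
  have "continuous_on S (\<lambda>x. \<bar>det (J x)\<bar>)"
    unfolding det_def by (intro continuous_intros J)
  then have gm: "(\<lambda>x. indicator S x * \<bar>det (J x)\<bar>) \<in> borel_measurable borel"
    using borel_measurable_continuous_on_indicator[OF S, of "\<lambda>x. \<bar>det (J x)\<bar>"] by simp
  have "d = (\<lambda>x. ennreal (indicator S x * \<bar>det (J x)\<bar>))"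
    by (auto simp: d_def split: split_indicator)
  with gm have dm[measurable]: "d \<in> borel_measurable borel" by simp
  note imS[measurable] = emeasure_injective_C1_image(1)[OF der J S inj]
  have idm[measurable]: "id \<in> lebesgue \<rightarrow>\<^sub>M borel" by (simp add: measurable_completion)
  have "distr (density lborel d) borel ft = distr (density lebesgue (indicator (f ` S))) borel id"
    (is "?A = ?B")
  proof (rule measure_eqI)
    show "sets ?A = sets ?B" by simp
    fix B assume "B \<in> sets ?A"
    then have B[measurable]: "B \<in> sets borel" by simp
    define S' where "S' = S \<inter> ft -` B"
    have S'[measurable]: "S' \<in> sets borel"
      unfolding S'_def using measurable_sets[OF ftm B] by simp
    have S'S: "S' \<subseteq> S" by (auto simp: S'_def)
    have "emeasure ?A B = (\<integral>\<^sup>+x. d x * indicator (ft -` B) x \<partial>lborel)"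
      by (subst emeasure_distr) (auto simp: emeasure_density measurable_sets_borel[OF ftm B])
    also have "\<dots> = (\<integral>\<^sup>+x. indicator S' x * ennreal \<bar>det (J x)\<bar> \<partial>lborel)"
      by (intro nn_integral_cong) (auto simp: d_def S'_def split: split_indicator)
    also have "\<dots> = emeasure lebesgue (f ` S')"
      using S'S by (intro emeasure_injective_C1_image(2)[symmetric] der)
        (auto intro: inj_on_subset[OF inj] continuous_on_subset[OF J])
    also have "f ` S' = f ` S \<inter> B"
      by (auto simp: S'_def ft_def)
    also have "emeasure lebesgue (f ` S \<inter> B) = emeasure ?B B"
    proof -
      have "emeasure ?B B = emeasure (density lebesgue (indicator (f ` S))) B"
        by (subst emeasure_distr) (use idm in \<open>auto simp: id_def\<close>)
      also have "\<dots> = (\<integral>\<^sup>+x. indicator (f ` S) x * indicator B x \<partial>lebesgue)"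
        by (rule emeasure_density) (use imS B in \<open>auto simp del: measurable_completion\<close>)
      also have "\<dots> = (\<integral>\<^sup>+x. indicator (f ` S \<inter> B) x \<partial>lebesgue)"
        by (simp add: indicator_inter_arith)
      also have "\<dots> = emeasure lebesgue (f ` S \<inter> B)"
        by (rule nn_integral_indicator) (use imS B in auto)
      finally show ?thesis by simp
    qed
    finally show "emeasure ?A B = emeasure ?B B" .
  qed
  then have "integral\<^sup>N ?A h = integral\<^sup>N ?B h" by simp
  moreover have "integral\<^sup>N ?A h = (\<integral>\<^sup>+x. d x * h (ft x) \<partial>lborel)"
    by (subst nn_integral_distr) (auto simp: nn_integral_density)
  moreover have "integral\<^sup>N ?B h = (\<integral>\<^sup>+y. indicator (f ` S) y * h y \<partial>lebesgue)"
  proof -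
    have "integral\<^sup>N ?B h = integral\<^sup>N (density lebesgue (indicator (f ` S))) h"
      by (subst nn_integral_distr) (use idm in \<open>auto simp: id_def\<close>)
    also have "\<dots> = (\<integral>\<^sup>+y. indicator (f ` S) y * h y \<partial>lebesgue)"
      by (rule nn_integral_density) (use imS measurable_compose[OF idm h] in \<open>auto simp: id_def\<close>)
    finally show ?thesis .
  qed
  moreover have "(\<integral>\<^sup>+x. d x * h (ft x) \<partial>lborel)
      = (\<integral>\<^sup>+x. indicator S x * ennreal \<bar>det (J x)\<bar> * h (f x) \<partial>lborel)"
    by (intro nn_integral_cong) (auto simp: d_def ft_def split: split_indicator)
  ultimately show ?thesis by simp
qed

lemma locally_injective_at_regular_point:
  fixes f :: "real^'n::{finite,wellorder} \<Rightarrow> real^'n::_"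
    and J :: "real^'n::_ \<Rightarrow> real^'n::_^'n::_"
  assumes "open W" and der: "\<And>x. x \<in> W \<Longrightarrow> (f has_derivative (*v) (J x)) (at x)"
    and J: "continuous_on W J" and a: "a \<in> W" "det (J a) \<noteq> 0"
  obtains e where "e > 0" "ball a e \<subseteq> W" "inj_on f (ball a e)"
proof -
  obtain B where B: "B ** J a = mat 1"
    using a(2) invertible_det_nz[of "J a"] unfolding invertible_def by blast
  show ?thesis
  proof (rule has_derivative_locally_injective[OF a(1) \<open>open W\<close>, of "(*v) B" "\<lambda>x. (*v) (J x)" f])
    show "bounded_linear ((*v) B)" by (rule matrix_vector_mul_bounded_linear)
    show "(*v) B \<circ> (*v) (J a) = id"
      using B by (auto simp: fun_eq_iff matrix_vector_mul_assoc)
    fix e :: real assume "e > 0"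
    have lin: "(\<lambda>v. J x *v v - J a *v v) = (*v) (J x - J a)" for x
      by (auto simp: matrix_vector_mult_diff_rdistrib)
    \<comment> \<open>Continuity of \<open>J\<close> is continuity in the Euclidean norm of
      matrices, whereas local injectivity asks for closeness in operator norm; the factor CARD('n)^2
      compares the two.\<close>
    have le: "onorm ((*v) (J x - J a)) \<le> real CARD('n) * real CARD('n) * norm (J x - J a)" for x
    proof (rule onorm_le_matrix_component)
      fix i j
      have "\<bar>(J x - J a) $ i $ j\<bar> \<le> norm ((J x - J a) $ i)" by (rule component_le_norm_cart)
      also have "\<dots> \<le> norm (J x - J a)" by (rule Finite_Cartesian_Product.norm_nth_le)
      finally show "\<bar>(J x - J a) $ i $ j\<bar> \<le> norm (J x - J a)" .
    qed
    let ?c = "real CARD('n) * real CARD('n)"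
    have c: "?c > 0" by simp
    from J \<open>open W\<close> a(1) have "continuous (at a) J"
      using continuous_on_eq_continuous_at by blast
    then obtain d where d: "d > 0" "\<And>x. dist x a < d \<Longrightarrow> dist (J x) (J a) < e / ?c"
      unfolding continuous_at_eps_delta using \<open>e > 0\<close> c by (meson divide_pos_pos)
    show "\<exists>d>0. \<forall>x. dist a x < d \<longrightarrow> onorm (\<lambda>v. J x *v v - J a *v v) < e"
    proof (intro exI[of _ d] conjI allI impI d(1))
      fix x assume "dist a x < d"
      then have "norm (J x - J a) < e / ?c" using d(2)[of x] by (simp add: dist_commute flip: dist_norm)
      then have "?c * norm (J x - J a) < e" using c by (simp add: field_simps)
      then show "onorm (\<lambda>v. J x *v v - J a *v v) < e" using le[of x] unfolding lin by linarith
    qed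
  qed (use der that in auto)
qed

text \<open>Each piece contains at most one preimage of \<open>y\<close>, so the multiplicity is a
  countable sum of indicators, which can be integrated term by term.\<close>

lemma emeasure_count_space_disjoint_Union_inj:
  assumes "disjoint_family T" and inj: "\<And>k::nat. inj_on f (T k)"
  shows "emeasure (count_space UNIV) ((\<Union>k. T k) \<inter> f -` {y}) = (\<Sum>k. indicator (f ` T k) y :: ennreal)"
proof -
  have "emeasure (count_space UNIV) (T k \<inter> f -` {y}) = indicator (f ` T k) y" for k
  proof (cases "y \<in> f ` T k")
    case True
    then obtain x where x: "x \<in> T k" "y = f x" by blast
    then have "T k \<inter> f -` {y} = {x}" using inj[of k] by (auto dest: inj_onD)
    then show ?thesis using True by (simp add: emeasure_count_space)
  next
    case False
    then have "T k \<inter> f -` {y} = {}" by auto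
    then show ?thesis using False by simp
  qed
  moreover have "(\<Sum>k. emeasure (count_space UNIV) (T k \<inter> f -` {y}))
      = emeasure (count_space UNIV) (\<Union>k. T k \<inter> f -` {y})"
    by (rule suminf_emeasure) (use assms(1) in \<open>auto simp: disjoint_family_on_def\<close>)
  ultimately show ?thesis by simp
qed

text \<open>By Sard the critical points have a negligible image. The regular points are covered by
  balls on which \<open>f\<close> is injective, countably many by Lindelof; made disjoint and cut
  with \<open>S\<close>, they reduce the claim to the injective case.\<close>

theorem area_formula:
  fixes f :: "real^'n::{finite,wellorder} \<Rightarrow> real^'n::_"
    and J :: "real^'n::_ \<Rightarrow> real^'n::_^'n::_"
  assumes W: "open W" and der: "\<And>x. x \<in> W \<Longrightarrow> (f has_derivative (*v) (J x)) (at x)"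
    and J: "continuous_on W J"
    and S: "S \<in> sets borel" "S \<subseteq> W" and h: "h \<in> borel_measurable borel"
  shows "(\<integral>\<^sup>+y. emeasure (count_space UNIV) (S \<inter> f -` {y}) * h y \<partial>lborel)
    = (\<integral>\<^sup>+x. indicator S x * ennreal \<bar>det (J x)\<bar> * h (f x) \<partial>lborel)"
proof -
  define W1 where "W1 = {x\<in>W. det (J x) \<noteq> 0}"
  have cdet: "continuous_on W (\<lambda>x. det (J x))"
    unfolding det_def by (intro continuous_intros J)
  have "W1 = W \<inter> (\<lambda>x. det (J x)) -` (- {0})" by (auto simp: W1_def)
  then have "open W1"
    using continuous_open_preimage[OF cdet W, of "- {0}"] by (simp add: open_Compl)
  define F where "F = {ball a e | a e. inj_on f (ball a e)}"
  have "\<And>T. T \<in> F \<Longrightarrow> open T" by (auto simp: F_def)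
  then obtain F' where F': "F' \<subseteq> F" "countable F'" "\<Union>F' = \<Union>F" by (rule Lindelof)
  have W1F: "W1 \<subseteq> \<Union>F"
  proof
    fix a assume "a \<in> W1"
    then obtain e where "e > 0" "inj_on f (ball a e)"
      using locally_injective_at_regular_point[OF W der J, of a] by (auto simp: W1_def)
    then show "a \<in> \<Union>F" unfolding F_def by (intro UnionI[of "ball a e"]) auto
  qed
  \<comment> \<open>The additional empty set guarantees a nonempty family, as required to enumerate
    it by all natural numbers.\<close>
  define B where "B = from_nat_into (insert {} F')"
  have ran: "range B = insert {} F'"
    unfolding B_def using F'(2) by (intro range_from_nat_into) auto
  have B: "open (B k)" "inj_on f (B k)" for k
  proof -
    have "B k \<in> insert {} F'" using ran by blast
    then show "open (B k)" "inj_on f (B k)" using F'(1) unfolding F_def by auto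
  qed
  define T where "T k = S \<inter> W1 \<inter> disjointed B k" for k
  have Tm: "T k \<in> sets borel" for k
  proof -
    have "range (disjointed B) \<subseteq> sets borel"
      by (intro sets.range_disjointed_sets) (use B in auto)
    then show ?thesis unfolding T_def using S \<open>open W1\<close> by auto
  qed
  have Tinj: "inj_on f (T k)" for k
    using B(2) by (rule inj_on_subset) (auto simp: T_def disjointed_def)
  have disj: "disjoint_family T"
    using disjoint_family_disjointed[of B] unfolding disjoint_family_on_def T_def by blast
  have UT: "(\<Union>k. T k) = S \<inter> W1"
  proof -
    have "(\<Union>k. T k) = S \<inter> W1 \<inter> \<Union>(range (disjointed B))" unfolding T_def by blast
    also have "\<Union>(range (disjointed B)) = \<Union>F'" by (simp only: UN_disjointed_eq ran) simp
    finally show ?thesis unfolding F'(3) using W1F by (simp add: Int_absorb2 le_infI2)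
  qed
  have TW: "T k \<subseteq> W" for k using S by (auto simp: T_def)
  define C where "C = S - W1"
  have "negligible (f ` C)"
  proof (rule baby_Sard)
    show "CARD('n) \<le> CARD('n)" by simp
    fix x assume x: "x \<in> C"
    then have "x \<in> W" "det (J x) = 0" using S by (auto simp: C_def W1_def)
    then show "(f has_derivative (*v) (J x)) (at x within C)" "rank (matrix ((*v) (J x))) < CARD('n)"
      using has_derivative_at_withinI[OF der] by (auto simp: det_eq_0_rank)
  qed
  then have AE: "AE y in lebesgue. y \<notin> f ` C"
    by (intro AE_not_in) (simp add: negligible_iff_null_sets)
  have hL[measurable]: "h \<in> borel_measurable lebesgue"
    using h by (simp add: measurable_completion)
  have [measurable]: "f ` T k \<in> sets lebesgue" for k
    by (rule emeasure_injective_C1_image(1)[where J=J])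
      (use der TW Tm Tinj continuous_on_subset[OF J TW] in auto)
  have "(\<integral>\<^sup>+y. emeasure (count_space UNIV) (S \<inter> f -` {y}) * h y \<partial>lborel)
      = (\<integral>\<^sup>+y. emeasure (count_space UNIV) (S \<inter> f -` {y}) * h y \<partial>lebesgue)"
    by (simp add: nn_integral_completion)
  also have "\<dots> = (\<integral>\<^sup>+y. (\<Sum>k. indicator (f ` T k) y * h y) \<partial>lebesgue)"
  proof (intro nn_integral_cong_AE, use AE in eventually_elim)
    fix y assume "y \<notin> f ` C"
    then have "S \<inter> f -` {y} = (\<Union>k. T k) \<inter> f -` {y}" using UT C_def by auto
    then show "emeasure (count_space UNIV) (S \<inter> f -` {y}) * h y = (\<Sum>k. indicator (f ` T k) y * h y)"
      using emeasure_count_space_disjoint_Union_inj[OF disj Tinj, of y] by simp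
  qed
  also have "\<dots> = (\<Sum>k. \<integral>\<^sup>+y. indicator (f ` T k) y * h y \<partial>lebesgue)"
    by (intro nn_integral_suminf) auto
  also have "\<dots> = (\<Sum>k. \<integral>\<^sup>+x. indicator (T k) x * ennreal \<bar>det (J x)\<bar> * h (f x) \<partial>lborel)"
    by (intro suminf_cong nn_integral_injective_C1_image)
      (use der TW Tm Tinj h continuous_on_subset[OF J TW] in auto)
  also have "\<dots> = (\<integral>\<^sup>+x. (\<Sum>k. indicator (T k) x * ennreal \<bar>det (J x)\<bar> * h (f x)) \<partial>lborel)"
  proof (rule nn_integral_suminf[symmetric])
    fix k
    have c1: "continuous_on (T k) f"
      using der TW by (meson continuous_at_imp_continuous_on has_derivative_continuous subsetD)
    have c2: "continuous_on (T k) (\<lambda>x. \<bar>det (J x)\<bar>)"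
      using continuous_on_subset[OF cdet TW] by (rule continuous_on_rabs)
    note [measurable] = borel_measurable_continuous_on_indicator[OF Tm c1]
      borel_measurable_continuous_on_indicator[OF Tm c2] Tm h
    have "(\<lambda>x. indicator (T k) x * ennreal (indicator (T k) x *\<^sub>R \<bar>det (J x)\<bar>)
            * h (indicator (T k) x *\<^sub>R f x)) \<in> borel_measurable borel"
      by measurable
    then have "(\<lambda>x. indicator (T k) x * ennreal \<bar>det (J x)\<bar> * h (f x)) \<in> borel_measurable borel"
      by (rule measurable_cong[THEN iffD1, rotated]) (auto split: split_indicator)
    then show "(\<lambda>x. indicator (T k) x * ennreal \<bar>det (J x)\<bar> * h (f x)) \<in> borel_measurable lborel"
      by simp
  qed
  also have "\<dots> = (\<integral>\<^sup>+x. indicator S x * ennreal \<bar>det (J x)\<bar> * h (f x) \<partial>lborel)"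
  proof (intro nn_integral_cong)
    fix x
    have "(\<Sum>k. indicator (T k) x :: ennreal) = indicator (S \<inter> W1) x"
      using suminf_indicator[OF disj, of x] UT by simp
    then have "(\<Sum>k. indicator (T k) x * (ennreal \<bar>det (J x)\<bar> * h (f x)))
        = indicator (S \<inter> W1) x * (ennreal \<bar>det (J x)\<bar> * h (f x))"
      by simp
    \<comment> \<open>Critical points of \<open>S\<close> may be put back: there the determinant is
      zero.\<close>
    also have "\<dots> = indicator S x * (ennreal \<bar>det (J x)\<bar> * h (f x))"
      using S by (auto simp: W1_def split: split_indicator)
    finally show "(\<Sum>k. indicator (T k) x * ennreal \<bar>det (J x)\<bar> * h (f x))
        = indicator S x * ennreal \<bar>det (J x)\<bar> * h (f x)"
      by (simp add: mult.assoc)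
  qed
  finally show ?thesis .
qed

section \<open>Lebesgue measure on vectors and finite product measures\<close>

lemma prod_Basis_vec:
  fixes v :: "'a::euclidean_space^'n"
  shows "(\<Prod>b\<in>Basis. v \<bullet> b) = (\<Prod>i\<in>UNIV. \<Prod>b\<in>Basis. v $ i \<bullet> b)"
proof -
  have "inj_on (\<lambda>(i, b). axis i b) (UNIV \<times> (Basis :: 'a set))"
    by (auto simp: inj_on_def axis_eq_axis nonzero_Basis)
  moreover have "(Basis :: ('a^'n) set) = (\<lambda>(i, b). axis i b) ` (UNIV \<times> Basis)"
    by (auto simp: Basis_vec_def)
  ultimately have "(\<Prod>b\<in>Basis. v \<bullet> b) = (\<Prod>(i, b)\<in>UNIV \<times> Basis. v \<bullet> axis i b)"
    using prod.reindex[of "\<lambda>(i, b). axis i b" "UNIV \<times> (Basis :: 'a set)" "\<lambda>b. v \<bullet> b"]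
    by (simp only:) (simp add: case_prod_beta')
  then show ?thesis by (simp add: prod.cartesian_product inner_axis)
qed

lemma prod_Basis_prod:
  fixes v :: "'a::euclidean_space \<times> 'b::euclidean_space"
  shows "(\<Prod>b\<in>Basis. v \<bullet> b) = (\<Prod>b\<in>Basis. fst v \<bullet> b) * (\<Prod>b\<in>Basis. snd v \<bullet> b)"
proof -
  have "(\<Prod>b\<in>Basis. v \<bullet> b) = (\<Prod>b\<in>(\<lambda>u. (u, 0)) ` Basis. v \<bullet> b) * (\<Prod>b\<in>(\<lambda>u. (0, u)) ` Basis. v \<bullet> b)"
    unfolding Basis_prod_def by (subst prod.union_disjoint) (auto simp: nonzero_Basis)
  then show ?thesis
    by (simp add: prod.reindex inj_on_def inner_prod_def)
qed

lemma measurable_vec_lambda[measurable (raw)]: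
  fixes f :: "'n::finite \<Rightarrow> 'b \<Rightarrow> 'a::euclidean_space"
  assumes [measurable]: "\<And>i. f i \<in> borel_measurable M"
  shows "(\<lambda>x. \<chi> i. f i x) \<in> borel_measurable M"
proof (subst borel_measurable_euclidean_space, intro ballI)
  fix b :: "'a^'n" assume "b \<in> Basis"
  then obtain i u where "b = axis i u" by (auto simp: Basis_vec_def)
  then show "(\<lambda>x. (\<chi> i. f i x) \<bullet> b) \<in> borel_measurable M"
    by (simp add: inner_axis)
qed

lemma measurable_vec_nth[measurable (raw)]:
  fixes f :: "'b \<Rightarrow> 'a::euclidean_space^'n"
  assumes [measurable]: "f \<in> borel_measurable M"
  shows "(\<lambda>x. f x $ i) \<in> borel_measurable M"
proof -
  have "(\<lambda>v::'a^'n. v $ i) \<in> borel_measurable borel"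
    by (intro borel_measurable_continuous_onI continuous_intros)
  from measurable_compose[OF assms this] show ?thesis .
qed

lemma measurable_vector_2[measurable (raw)]:
  fixes f g :: "'b \<Rightarrow> real"
  assumes [measurable]: "f \<in> borel_measurable M" "g \<in> borel_measurable M"
  shows "(\<lambda>x. vector [f x, g x] :: real^2) \<in> borel_measurable M"
proof -
  have "(\<lambda>x. vector [f x, g x] :: real^2) = (\<lambda>x. \<chi> i. if i = 1 then f x else g x)"
    by (auto simp: vec_eq_iff forall_2)
  then show ?thesis by simp
qed

lemma measurable_vector_3[measurable (raw)]:
  fixes f g h :: "'b \<Rightarrow> real"
  assumes [measurable]: "f \<in> borel_measurable M" "g \<in> borel_measurable M" "h \<in> borel_measurable M"
  shows "(\<lambda>x. vector [f x, g x, h x] :: real^3) \<in> borel_measurable M"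
proof -
  have "(\<lambda>x. vector [f x, g x, h x] :: real^3)
      = (\<lambda>x. \<chi> i. if i = 1 then f x else if i = 2 then g x else h x)"
    by (auto simp: vec_eq_iff forall_3)
  then show ?thesis by simp
qed

lemma lborel_vec_eq_PiM:
  "(lborel :: ('a::euclidean_space^'n) measure)
    = distr (\<Pi>\<^sub>M i\<in>(UNIV::'n set). (lborel :: 'a measure)) borel (\<lambda>f. \<chi> i. f i)"
proof (rule lborel_eqI)
  interpret product_sigma_finite "\<lambda>_::'n. (lborel :: 'a measure)" ..
  fix l u :: "'a^'n" assume le: "\<And>b. b \<in> Basis \<Longrightarrow> l \<bullet> b \<le> u \<bullet> b"
  have le': "l $ i \<bullet> b \<le> u $ i \<bullet> b" if "b \<in> Basis" for i b
    using le[of "axis i b"] that by (auto simp: Basis_vec_def inner_axis)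
  have "(\<lambda>f. \<chi> i. f i) -` box l u \<inter> space (\<Pi>\<^sub>M i\<in>(UNIV::'n set). (lborel :: 'a measure))
      = (\<Pi>\<^sub>E i\<in>UNIV. box (l $ i) (u $ i))"
    by (auto simp: mem_box Basis_vec_def inner_axis space_PiM PiE_iff)
  then have "emeasure (distr (\<Pi>\<^sub>M i\<in>(UNIV::'n set). (lborel :: 'a measure)) borel (\<lambda>f. \<chi> i. f i)) (box l u)
      = (\<Prod>i\<in>UNIV. emeasure lborel (box (l $ i) (u $ i)))"
    by (subst emeasure_distr) (auto simp: emeasure_PiM)
  also have "\<dots> = (\<Prod>i\<in>UNIV. ennreal (\<Prod>b\<in>Basis. (u $ i - l $ i) \<bullet> b))"
    by (intro prod.cong refl) (simp add: emeasure_lborel_box_eq le')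
  also have "\<dots> = (\<Prod>b\<in>Basis. (u - l) \<bullet> b)"
    unfolding prod_Basis_vec
    by (subst prod_ennreal) (auto intro!: prod_nonneg simp: inner_diff_left le')
  finally show "emeasure (distr (\<Pi>\<^sub>M i\<in>(UNIV::'n set). (lborel :: 'a measure)) borel (\<lambda>f. \<chi> i. f i)) (box l u)
      = (\<Prod>b\<in>Basis. (u - l) \<bullet> b)" .
qed simp

lemma nn_integral_lborel_vec:
  fixes F :: "'a::euclidean_space^'n \<Rightarrow> ennreal"
  assumes [measurable]: "F \<in> borel_measurable borel"
  shows "(\<integral>\<^sup>+x. F x \<partial>lborel) = (\<integral>\<^sup>+f. F (\<chi> i. f i) \<partial>(\<Pi>\<^sub>M i\<in>(UNIV::'n set). lborel))"
  unfolding lborel_vec_eq_PiM[where 'n='n] by (subst nn_integral_distr) auto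

text \<open>A \<open>datum\<close> is a real number, the coordinate to be solved for, paired with a
  \<open>partial_datum\<close>. This lemma separates five such reals from the five remainders and
  puts the reals second, as the inner variables of integration.\<close>

lemma lborel_transpose:
  "(lborel :: (('b::euclidean_space^'n) \<times> ('a::euclidean_space^'n)) measure)
    = distr lborel borel (\<lambda>x :: ('a \<times> 'b)^'n. (\<chi> i. snd (x $ i), \<chi> i. fst (x $ i)))" (is "_ = distr _ _ ?T")
proof (rule lborel_eqI)
  fix l u :: "('b^'n) \<times> ('a^'n)" assume le: "\<And>b. b \<in> Basis \<Longrightarrow> l \<bullet> b \<le> u \<bullet> b"
  have le1: "fst l \<bullet> b \<le> fst u \<bullet> b" if "b \<in> Basis" for b
    using le[of "(b, 0)"] that by (auto simp: Basis_prod_def inner_prod_def)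
  have le2: "snd l \<bullet> b \<le> snd u \<bullet> b" if "b \<in> Basis" for b
    using le[of "(0, b)"] that by (auto simp: Basis_prod_def inner_prod_def)
  define l' u' where "l' = (\<chi> i. (snd l $ i, fst l $ i))" and "u' = (\<chi> i. (snd u $ i, fst u $ i))"
  have T: "?T \<in> borel_measurable borel"
    by (intro borel_measurable_continuous_onI continuous_intros)
  have le3: "l' \<bullet> b \<le> u' \<bullet> b" if "b \<in> Basis" for b
    using that le1 le2
    by (force simp: Basis_vec_def Basis_prod_def inner_prod_def inner_axis l'_def u'_def)
  have "?T -` box l u = box l' u'"
    by (auto simp: mem_box Basis_vec_def Basis_prod_def inner_axis inner_prod_def l'_def u'_def
        ball_Un ball_UN all_conj_distrib)
  then have "emeasure (distr lborel borel ?T) (box l u) = emeasure lborel (box l' u')"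
    by (subst emeasure_distr) (use T in auto)
  also have "\<dots> = (\<Prod>b\<in>Basis. (u' - l') \<bullet> b)"
    using le3 by (simp add: emeasure_lborel_box_eq)
  also have "(\<Prod>b\<in>Basis. (u' - l') \<bullet> b) = (\<Prod>b\<in>Basis. (u - l) \<bullet> b)"
    by (simp add: prod_Basis_vec prod_Basis_prod u'_def l'_def prod.distrib mult.commute)
  finally show "emeasure (distr lborel borel ?T) (box l u) = ennreal (\<Prod>b\<in>Basis. (u - l) \<bullet> b)"  .
qed simp

lemma lborel_vector_3:
  "(lborel :: (real^3) measure) = distr lborel borel (\<lambda>((x, y), z). vector [x, y, z])" (is "_ = distr _ _ ?T")
proof (rule lborel_eqI)
  fix l u :: "real^3" assume le: "\<And>b. b \<in> Basis \<Longrightarrow> l \<bullet> b \<le> u \<bullet> b"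
  have le': "l $ i \<le> u $ i" for i using le[of "axis i 1"] by (simp add: inner_axis)
  have T: "?T \<in> borel_measurable borel"
    unfolding case_prod_beta'
    by (intro measurable_vector_3 borel_measurable_continuous_onI continuous_intros)
  have "?T -` box l u = box ((l $ 1, l $ 2), l $ 3) ((u $ 1, u $ 2), u $ 3)"
    by (auto simp: mem_box_cart forall_3 box_prod box_real)
  then have "emeasure (distr lborel borel ?T) (box l u)
      = emeasure lborel (box ((l $ 1, l $ 2), l $ 3) ((u $ 1, u $ 2), u $ 3))"
    by (subst emeasure_distr) (use T in auto)
  also have "\<dots> = (\<Prod>b\<in>Basis. (((u $ 1, u $ 2), u $ 3) - ((l $ 1, l $ 2), l $ 3)) \<bullet> b)"
    using le' by (subst emeasure_lborel_box_eq) (auto simp: Basis_prod_def inner_prod_def)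
  also have "\<dots> = (\<Prod>b\<in>Basis. (u - l) \<bullet> b)"
    unfolding prod_Basis_vec prod_Basis_prod UNIV_3 by (simp add: mult.assoc)
  finally show "emeasure (distr lborel borel ?T) (box l u) = ennreal (\<Prod>b\<in>Basis. (u - l) \<bullet> b)"  .
qed simp

lemma lborel_vector_2:
  "(lborel :: (real^2) measure) = distr lborel borel (\<lambda>(x, y). vector [x, y])" (is "_ = distr _ _ ?T")
proof (rule lborel_eqI)
  fix l u :: "real^2" assume le: "\<And>b. b \<in> Basis \<Longrightarrow> l \<bullet> b \<le> u \<bullet> b"
  have le': "l $ i \<le> u $ i" for i using le[of "axis i 1"] by (simp add: inner_axis)
  have T: "?T \<in> borel_measurable borel"
    unfolding case_prod_beta'
    by (intro measurable_vector_2 borel_measurable_continuous_onI continuous_intros)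
  have "?T -` box l u = box (l $ 1, l $ 2) (u $ 1, u $ 2)"
    by (auto simp: mem_box_cart forall_2 box_prod box_real)
  then have "emeasure (distr lborel borel ?T) (box l u)
      = emeasure lborel (box (l $ 1, l $ 2) (u $ 1, u $ 2))"
    by (subst emeasure_distr) (use T in auto)
  also have "\<dots> = (\<Prod>b\<in>Basis. ((u $ 1, u $ 2) - (l $ 1, l $ 2)) \<bullet> b)"
    using le' by (subst emeasure_lborel_box_eq) (auto simp: Basis_prod_def inner_prod_def)
  also have "\<dots> = (\<Prod>b\<in>Basis. (u - l) \<bullet> b)"
    by (simp add: prod_Basis_vec prod_Basis_prod UNIV_2)
  finally show "emeasure (distr lborel borel ?T) (box l u) = ennreal (\<Prod>b\<in>Basis. (u - l) \<bullet> b)"  .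
qed simp

lemma distr_PiM_component:
  assumes "sigma_finite_measure A" "sigma_finite_measure (distr A B g)"
    and g[measurable]: "g \<in> A \<rightarrow>\<^sub>M B"
  shows "distr (\<Pi>\<^sub>M i\<in>(UNIV::'i::finite set). A) (\<Pi>\<^sub>M i\<in>UNIV. B) (\<lambda>f i. g (f i))
    = (\<Pi>\<^sub>M i\<in>UNIV. distr A B g)"
proof -
  interpret A: product_sigma_finite "\<lambda>_::'i. A" using assms by (simp add: product_sigma_finite_def)
  interpret B: product_sigma_finite "\<lambda>_::'i. distr A B g" using assms by (simp add: product_sigma_finite_def)
  have m: "(\<lambda>f i. g (f i)) \<in> (\<Pi>\<^sub>M i\<in>(UNIV::'i set). A) \<rightarrow>\<^sub>M (\<Pi>\<^sub>M i\<in>(UNIV::'i set). B)"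
    by (rule measurable_PiM_single') (auto simp: space_PiM PiE_iff measurable_space[OF g])
  show ?thesis
  proof (rule B.PiM_eqI)
    show "sets (distr (\<Pi>\<^sub>M i\<in>(UNIV::'i set). A) (\<Pi>\<^sub>M i\<in>UNIV. B) (\<lambda>f i. g (f i)))
        = sets (\<Pi>\<^sub>M i\<in>UNIV. distr A B g)"
      by (simp cong: sets_PiM_cong)
    fix X :: "'i \<Rightarrow> _" assume X: "\<And>i. i \<in> UNIV \<Longrightarrow> X i \<in> sets (distr A B g)"
    have "(\<lambda>f i. g (f i)) -` (\<Pi>\<^sub>E i\<in>UNIV. X i) \<inter> space (\<Pi>\<^sub>M i\<in>(UNIV::'i set). A)
        = (\<Pi>\<^sub>E i\<in>UNIV. g -` X i \<inter> space A)"
      by (auto simp: space_PiM PiE_iff)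
    then show "emeasure (distr (\<Pi>\<^sub>M i\<in>(UNIV::'i set). A) (\<Pi>\<^sub>M i\<in>UNIV. B) (\<lambda>f i. g (f i))) (Pi\<^sub>E UNIV X)
        = (\<Prod>i\<in>UNIV. emeasure (distr A B g) (X i))"
      using X by (subst emeasure_distr[OF m])
        (auto simp: A.emeasure_PiM emeasure_distr intro!: sets_PiM_I_finite)
  qed simp
qed

lemma density_PiM_component:
  assumes "sigma_finite_measure A" "sigma_finite_measure (density A d)"
    and d[measurable]: "d \<in> borel_measurable A"
  shows "density (\<Pi>\<^sub>M i\<in>(UNIV::'i::finite set). A) (\<lambda>f. \<Prod>i\<in>UNIV. d (f i))
    = (\<Pi>\<^sub>M i\<in>UNIV. density A d)"
proof -
  interpret A: product_sigma_finite "\<lambda>_::'i. A" using assms by (simp add: product_sigma_finite_def)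
  interpret B: product_sigma_finite "\<lambda>_::'i. density A d" using assms by (simp add: product_sigma_finite_def)
  show ?thesis
  proof (rule B.PiM_eqI)
    show "sets (density (\<Pi>\<^sub>M i\<in>(UNIV::'i set). A) (\<lambda>f. \<Prod>i\<in>UNIV. d (f i)))
        = sets (\<Pi>\<^sub>M i\<in>UNIV. density A d)"
      by (simp cong: sets_PiM_cong)
    fix X :: "'i \<Rightarrow> _" assume "\<And>i. i \<in> UNIV \<Longrightarrow> X i \<in> sets (density A d)"
    then have X[measurable]: "\<And>i. X i \<in> sets A" by simp
    have "emeasure (density (\<Pi>\<^sub>M i\<in>(UNIV::'i set). A) (\<lambda>f. \<Prod>i\<in>UNIV. d (f i))) (Pi\<^sub>E UNIV X)
        = (\<integral>\<^sup>+f. (\<Prod>i\<in>UNIV. d (f i)) * indicator (Pi\<^sub>E UNIV X) f \<partial>(\<Pi>\<^sub>M i\<in>(UNIV::'i set). A))"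
      by (rule emeasure_density) (auto intro!: sets_PiM_I_finite)
    also have "\<dots> = (\<integral>\<^sup>+f. (\<Prod>i\<in>UNIV. d (f i) * indicator (X i) (f i)) \<partial>(\<Pi>\<^sub>M i\<in>(UNIV::'i set). A))"
    proof (intro nn_integral_cong)
      fix f :: "'i \<Rightarrow> _"
      have "indicator (Pi\<^sub>E UNIV X) f = (\<Prod>i\<in>UNIV. indicator (X i) (f i) :: ennreal)"
        by (auto simp: indicator_def PiE_iff)
      then show "(\<Prod>i\<in>UNIV. d (f i)) * indicator (Pi\<^sub>E UNIV X) f
          = (\<Prod>i\<in>UNIV. d (f i) * indicator (X i) (f i))" by (simp add: prod.distrib)
    qed
    also have "\<dots> = (\<Prod>i\<in>UNIV. \<integral>\<^sup>+x. d x * indicator (X i) x \<partial>A)"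
      by (rule A.product_nn_integral_prod) auto
    also have "\<dots> = (\<Prod>i\<in>UNIV. emeasure (density A d) (X i))"
      by (simp add: emeasure_density)
    finally show "emeasure (density (\<Pi>\<^sub>M i\<in>(UNIV::'i set). A) (\<lambda>f. \<Prod>i\<in>UNIV. d (f i))) (Pi\<^sub>E UNIV X)
        = (\<Prod>i\<in>UNIV. emeasure (density A d) (X i))" .
  qed simp
qed

section \<open>A parametrisation of the essential matrices\<close>

declare transpose_matrix_vector[simp del]

text \<open>A rotation in Euler angles. Its third row is the unit vector with polar angle
  \<open>b\<close> and azimuth a - pi/2, and its first row is horizontal.\<close>

definition frame :: "real \<Rightarrow> real \<Rightarrow> real^3^3" where
  "frame a b = vector [vector [cos a, sin a, 0],
     vector [- sin a * cos b, cos a * cos b, sin b],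
     vector [sin a * sin b, - cos a * sin b, cos b]]"

text \<open>The essential matrix of a rotation by \<open>g\<close> about the third axis with
  translation along that axis: on the horizontal plane it is the rotation by g + pi/2.\<close>

definition twist :: "real \<Rightarrow> real^3^3" where
  "twist g = vector [vector [- sin g, - cos g, 0], vector [cos g, - sin g, 0], 0]"

text \<open>The product \<open>ess x\<close> is the matrix \<open>[t]\<^sub>\<times> R\<close> with \<open>t\<close> the third row of the first frame and
  \<open>R\<close> mapping the third row of the second frame to \<open>t\<close>; these two rows span its left and right kernels.\<close>

definition ess :: "real^5 \<Rightarrow> real^3^3" where
  "ess x = transpose (frame (x$1) (x$2)) ** twist (x$5) ** frame (x$3) (x$4)"

definition pole :: "real \<Rightarrow> real \<Rightarrow> real^3" where
  "pole a b = vector [sin a * sin b, - cos a * sin b, cos b]"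

lemma frame_mult:
  "(frame a b *v u) $ 1 = u$1 * cos a + u$2 * sin a"
  "(frame a b *v u) $ 2 = (u$2 * cos a - u$1 * sin a) * cos b + u$3 * sin b"
  "(frame a b *v u) $ 3 = (u$1 * sin a - u$2 * cos a) * sin b + u$3 * cos b"
  by (simp_all add: frame_def matrix_vector_mult_def sum_3 algebra_simps)

lemma transpose_frame_mult:
  "(transpose (frame a b) *v u) $ 1 = u$1 * cos a - u$2 * sin a * cos b + u$3 * sin a * sin b"
  "(transpose (frame a b) *v u) $ 2 = u$1 * sin a + u$2 * cos a * cos b - u$3 * cos a * sin b"
  "(transpose (frame a b) *v u) $ 3 = u$2 * sin b + u$3 * cos b"
  by (simp_all add: frame_def matrix_vector_mult_def transpose_def sum_3 algebra_simps)

lemma twist_mult: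
  "(twist g *v v) $ 1 = - sin g * v$1 - cos g * v$2"
  "(twist g *v v) $ 2 = cos g * v$1 - sin g * v$2"
  "(twist g *v v) $ 3 = 0"
  by (simp_all add: twist_def matrix_vector_mult_def sum_3)

lemma frame_mult_transpose: "frame a b *v (transpose (frame a b) *v u) = u"
proof -
  have "cos a * cos a + sin a * sin a = 1" "cos b * cos b + sin b * sin b = 1"
    using sin_cos_squared_add3[of a] sin_cos_squared_add3[of b] by auto
  then show ?thesis
    unfolding vec_eq_iff forall_3 frame_mult transpose_frame_mult by algebra
qed

lemma orthogonal_frame: "orthogonal_matrix (frame a b)"
  unfolding orthogonal_matrix_def using frame_mult_transpose[of a b]
  by (metis matrix_eq matrix_left_right_inverse matrix_vector_mul_assoc matrix_vector_mul_lid)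

lemma transpose_mult_frame: "transpose (frame a b) *v (frame a b *v u) = u"
  using orthogonal_frame[of a b] by (simp add: orthogonal_matrix_def matrix_vector_mul_assoc)

lemma det_frame: "det (frame a b) = 1"
proof -
  have "cos a * cos a + sin a * sin a = 1" "cos b * cos b + sin b * sin b = 1"
    using sin_cos_squared_add3[of a] sin_cos_squared_add3[of b] by auto
  then show ?thesis
    unfolding det_3 frame_def vector_3 by algebra
qed

lemma rotation_frame: "rotation_matrix (frame a b)"
  by (simp add: rotation_matrix_def orthogonal_frame det_frame)

lemma rotation_transpose_frame: "rotation_matrix (transpose (frame a b))"
  using orthogonal_frame[of a b] by (simp add: rotation_matrix_def orthogonal_matrix_transpose det_transpose det_frame)

lemma inner_transpose_mult: "u \<bullet> (transpose A *v w) = (A *v u) \<bullet> (w :: real^'n)"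
  by (metis dot_lmul_matrix inner_commute transpose_matrix_vector transpose_transpose)

lemma inner_transpose_frame: "(transpose (frame a b) *v u) \<bullet> (transpose (frame a b) *v v) = u \<bullet> v"
  using inner_transpose_mult[of "transpose (frame a b) *v u" "frame a b" v] by (simp add: frame_mult_transpose)

lemma ess_mult:
  "ess x *v v = transpose (frame (x$1) (x$2)) *v (twist (x$5) *v (frame (x$3) (x$4) *v v))"
  by (simp add: ess_def matrix_vector_mul_assoc matrix_mul_assoc)

lemma inner_ess: "u \<bullet> (ess x *v v)
    = (frame (x$1) (x$2) *v u) \<bullet> (twist (x$5) *v (frame (x$3) (x$4) *v v))"
  by (simp add: ess_mult inner_transpose_mult)

lemma pole_eq: "pole a b = transpose (frame a b) *v axis 3 1"
  unfolding vec_eq_iff forall_3 transpose_frame_mult by (simp add: pole_def axis_def)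

lemma inner_pole: "pole a b \<bullet> u = (frame a b *v u) $ 3"
  by (simp add: pole_def inner_vec_def sum_3 frame_mult algebra_simps)

lemma pole_unit: "pole a b \<bullet> pole a b = 1"
  unfolding pole_eq inner_transpose_frame by (simp add: inner_axis)

text \<open>The cofactor matrix of \<open>ess x\<close> has rank one: it is the product of the two kernel vectors.
  Hence \<open>ess x\<close> determines the two poles up to a simultaneous change of sign.\<close>

lemma cross_ess:
  "cross3 (ess x *v p) (ess x *v q) = (pole (x$3) (x$4) \<bullet> cross3 p q) *\<^sub>R pole (x$1) (x$2)"
proof -
  let ?A = "transpose (frame (x$1) (x$2))" and ?B = "frame (x$3) (x$4)"
  have tw: "cross3 (twist g *v p) (twist g *v q) = (cross3 p q $ 3) *\<^sub>R axis 3 1" for g p q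
  proof -
    have "(- (sin g * p$1) - cos g * p$2) * (cos g * q$1 - sin g * q$2)
        - (cos g * p$1 - sin g * p$2) * (- (sin g * q$1) - cos g * q$2)
      = (cos g * cos g + sin g * sin g) * (p$1 * q$2 - p$2 * q$1)"
      by (simp add: algebra_simps del: sin_cos_squared_add sin_cos_squared_add2 sin_cos_squared_add3)
    also have "\<dots> = p$1 * q$2 - p$2 * q$1"
      by (simp only: sin_cos_squared_add3 mult_1)
    finally show ?thesis
      unfolding vec_eq_iff forall_3
      by (simp add: cross3_def twist_mult axis_def)
  qed
  have "cross3 (ess x *v p) (ess x *v q)
      = ?A *v cross3 (twist (x$5) *v (?B *v p)) (twist (x$5) *v (?B *v q))"
    unfolding ess_mult using rotation_transpose_frame by (simp add: cross_rotation_matrix)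
  also have "\<dots> = (cross3 (?B *v p) (?B *v q) $ 3) *\<^sub>R pole (x$1) (x$2)"
    by (simp add: tw pole_eq matrix_vector_mult_scaleR)
  also have "cross3 (?B *v p) (?B *v q) $ 3 = pole (x$3) (x$4) \<bullet> cross3 p q"
    using rotation_frame by (simp add: cross_rotation_matrix inner_pole)
  finally show ?thesis .
qed

text \<open>Passing to cofactors multiplies by \<open>c\<^sup>2\<close> and turns the hypothesis
  into an identity of two rank one matrices built from unit vectors. Such an identity determines the
  factors up to a common sign.\<close>

lemma ess_eq_scaleR:
  assumes "ess x = c *\<^sub>R ess y"
  obtains k where "k = 1 \<or> k = -1" "c\<^sup>2 = 1"
    "pole (x$3) (x$4) = k *\<^sub>R pole (y$3) (y$4)" "pole (x$1) (x$2) = k *\<^sub>R pole (y$1) (y$2)"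
proof -
  define t w t' w' where "t = pole (x$1) (x$2)" and "w = pole (x$3) (x$4)"
    and "t' = pole (y$1) (y$2)" and "w' = pole (y$3) (y$4)"
  note defs = t_def w_def t'_def w'_def
  have unit: "t \<bullet> t = 1" "w \<bullet> w = 1" "t' \<bullet> t' = 1" "w' \<bullet> w' = 1"
    by (simp_all add: defs pole_unit)
  have cr: "(w \<bullet> cross3 p q) *\<^sub>R t = (c\<^sup>2 * (w' \<bullet> cross3 p q)) *\<^sub>R t'" for p q
  proof -
    have "(w \<bullet> cross3 p q) *\<^sub>R t = cross3 (ess x *v p) (ess x *v q)"
      by (simp add: cross_ess defs)
    also have "\<dots> = c\<^sup>2 *\<^sub>R cross3 (ess y *v p) (ess y *v q)"
      by (simp add: assms cross_mult_left cross_mult_right power2_eq_square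
          scaleR_matrix_vector_assoc[symmetric])
    also have "\<dots> = (c\<^sup>2 * (w' \<bullet> cross3 p q)) *\<^sub>R t'"
      by (simp add: cross_ess defs)
    finally show ?thesis .
  qed
  \<comment> \<open>Each coordinate vector is a cross product, so \<open>cr\<close> yields the rank
    one identity entry by entry.\<close>
  have comp: "(w $ i) *\<^sub>R t = (c\<^sup>2 * w' $ i) *\<^sub>R t'" for i
  proof -
    have "\<exists>p q. axis i 1 = cross3 p q" 
      by (metis cross_basis exhaust_3)
    then obtain p q where "axis i 1 = cross3 p q" by blast
    then show ?thesis using cr[of p q] by (metis cart_eq_inner_axis inner_commute)
  qed
  have all: "(w \<bullet> z) *\<^sub>R t = (c\<^sup>2 * (w' \<bullet> z)) *\<^sub>R t'" for z
  proof -
    have "(w \<bullet> z) *\<^sub>R t = (\<Sum>i\<in>UNIV. z $ i *\<^sub>R ((w $ i) *\<^sub>R t))"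
      by (simp add: inner_vec_def scaleR_sum_left mult.commute)
    also have "\<dots> = (c\<^sup>2 * (w' \<bullet> z)) *\<^sub>R t'"
      unfolding comp by (simp add: inner_vec_def scaleR_sum_left sum_distrib_left mult_ac)
    finally show ?thesis .
  qed
  \<comment> \<open>Contraction with \<open>w\<close> isolates \<open>t\<close>; as \<open>t\<close>
    and \<open>t'\<close> have length one, \<open>k\<close> is a sign.\<close>
  define k where "k = c\<^sup>2 * (w' \<bullet> w)"
  have t: "t = k *\<^sub>R t'" using all[of w] unit by (simp add: k_def)
  have k2: "k\<^sup>2 = 1"
    using unit(1) unfolding t by (simp add: unit power2_eq_square)
  have "w $ i * k = c\<^sup>2 * w' $ i" for i
  proof -
    have "(w $ i * k) *\<^sub>R t' = (c\<^sup>2 * w' $ i) *\<^sub>R t'" using comp[of i] by (simp add: t)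
    moreover have "t' \<noteq> 0" using unit(3) by auto
    ultimately show ?thesis by simp
  qed
  then have "w $ i = (c\<^sup>2 * k) * w' $ i" for i
    using k2 by (metis mult.assoc mult.commute mult.left_neutral power2_eq_square)
  then have w: "w = (c\<^sup>2 * k) *\<^sub>R w'" by (simp add: vec_eq_iff)
  \<comment> \<open>Equal lengths of \<open>w\<close> and \<open>w'\<close> leave only the fourth
    power of \<open>c\<close>, and nonnegativity of \<open>c\<^sup>2\<close> finishes.\<close>
  have "(c\<^sup>2 * k)\<^sup>2 = 1"
    using unit(2) unfolding w by (simp add: unit power2_eq_square)
  then have "(c\<^sup>2)\<^sup>2 = 1" using k2 by (simp add: power_mult_distrib)
  then have c: "c\<^sup>2 = 1" by (metis abs_square_eq_1 abs_power2)
  show thesis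
    using that[of k] k2 c w t unfolding defs by (simp add: power2_eq_1_iff)
qed

lemma continuous_on_frame:
  fixes S :: "'a::t2_space set"
  assumes "continuous_on S a" "continuous_on S b"
  shows "continuous_on S (\<lambda>x. frame (a x) (b x))"
proof -
  have "continuous_on S (\<lambda>x. frame (a x) (b x) $ i $ j)" for i j
    using exhaust_3[of i] exhaust_3[of j]
    by (elim disjE; simp add: frame_def) (intro continuous_intros assms)+
  then have "continuous_on S (\<lambda>x. \<chi> i j. frame (a x) (b x) $ i $ j)"
    by (intro continuous_on_vec_lambda)
  then show ?thesis by simp
qed

lemma continuous_on_twist:
  fixes S :: "'a::t2_space set"
  assumes "continuous_on S g"
  shows "continuous_on S (\<lambda>x. twist (g x))"
proof -
  have "continuous_on S (\<lambda>x. twist (g x) $ i $ j)" for i j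
    using exhaust_3[of i] exhaust_3[of j]
    by (elim disjE; simp add: twist_def) (intro continuous_intros assms)+
  then have "continuous_on S (\<lambda>x. \<chi> i j. twist (g x) $ i $ j)"
    by (intro continuous_on_vec_lambda)
  then show ?thesis by simp
qed

lemma continuous_on_matrix_mult:
  fixes A :: "'a::topological_space \<Rightarrow> real^'n^'m" and B :: "'a \<Rightarrow> real^'k^'n"
  assumes "continuous_on S A" "continuous_on S B"
  shows "continuous_on S (\<lambda>x. A x ** B x)"
  unfolding matrix_matrix_mult_def by (intro continuous_intros assms)

lemma continuous_on_matrix_vector_mult:
  fixes A :: "'a::topological_space \<Rightarrow> real^'n^'m" and v :: "'a \<Rightarrow> real^'n"
  assumes "continuous_on S A" "continuous_on S v"
  shows "continuous_on S (\<lambda>x. A x *v v x)"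
  unfolding matrix_vector_mult_def by (intro continuous_intros assms)

lemma continuous_on_ess: "continuous_on S ess"
proof -
  have "continuous_on S (\<lambda>x. transpose (frame (x$1) (x$2)) ** twist (x$5) ** frame (x$3) (x$4))"
    unfolding transpose_def
    by (intro continuous_on_matrix_mult continuous_on_vec_lambda continuous_on_component
        continuous_on_frame continuous_on_twist continuous_on_id)
  then show ?thesis by (simp add: ess_def[abs_def])
qed

lemma exhaust_5:
  fixes x :: 5
  shows "x = 1 \<or> x = 2 \<or> x = 3 \<or> x = 4 \<or> x = 5"
proof (induct x)
  case (of_int z)
  then have "z = 0 \<or> z = 1 \<or> z = 2 \<or> z = 3 \<or> z = 4" by simp arith
  then show ?case by auto
qed

lemma forall_5: "(\<forall>i::5. P i) \<longleftrightarrow> P 1 \<and> P 2 \<and> P 3 \<and> P 4 \<and> P 5"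
  by (metis exhaust_5)

lemma UNIV_5: "UNIV = {1::5, 2, 3, 4, 5}"
  using exhaust_5 by auto

lemma sum_5: "sum f (UNIV::5 set) = f 1 + f 2 + f 3 + f 4 + f 5"
  unfolding UNIV_5 by (simp add: ac_simps)

lemma prod_5: "prod f (UNIV::5 set) = f 1 * f 2 * f 3 * f 4 * f 5"
  unfolding UNIV_5 by (simp add: ac_simps)

text \<open>Since only the simultaneous sign of the two poles is ambiguous, the first pole ranges over the
  whole sphere and the second over a half sphere; the angle \<open>x$5\<close> matters modulo \<open>pi\<close>.\<close>

definition chart_closed :: "(real^5) set" where
  "chart_closed = {x. 0 \<le> x$1 \<and> x$1 < 2 * pi \<and> 0 \<le> x$2 \<and> x$2 \<le> pi \<and>
     0 \<le> x$3 \<and> x$3 < pi \<and> 0 \<le> x$4 \<and> x$4 \<le> pi \<and> 0 \<le> x$5 \<and> x$5 < pi}"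

definition chart :: "(real^5) set" where
  "chart = {x \<in> chart_closed. sin (x$2) \<noteq> 0 \<and> sin (x$4) \<noteq> 0}"

lemma pole_surj:
  assumes "w \<bullet> w = 1"
  obtains a b where "0 \<le> a" "a < 2 * pi" "0 \<le> b" "b \<le> pi" "w = pole a b"
proof -
  have w: "(w$1)\<^sup>2 + (w$2)\<^sup>2 + (w$3)\<^sup>2 = 1"
    using assms by (simp add: inner_vec_def sum_3 power2_eq_square)
  then have le: "(w$3)\<^sup>2 \<le> 1" using zero_le_power2[of "w$1"] zero_le_power2[of "w$2"] by linarith
  then have "(w$3)\<^sup>2 + (sqrt (1 - (w$3)\<^sup>2))\<^sup>2 = 1" by simp
  then obtain b where b: "0 \<le> b" "b \<le> pi" "w$3 = cos b" "sqrt (1 - (w$3)\<^sup>2) = sin b"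
    using sincos_total_pi[of "sqrt (1 - (w$3)\<^sup>2)" "w$3"] le by auto
  have s: "(w$1)\<^sup>2 + (w$2)\<^sup>2 = (sin b)\<^sup>2"
    using w le by (simp flip: b(4))
  show thesis
  proof (cases "sin b = 0")
    case True
    then have "w$1 = 0" "w$2 = 0" using s by (auto simp: sum_power2_eq_zero_iff)
    then have "w = pole 0 b" using True b by (simp add: vec_eq_iff forall_3 pole_def)
    then show thesis using that[of 0 b] b by simp
  next
    case False
    then have "(- w$2 / sin b)\<^sup>2 + (w$1 / sin b)\<^sup>2 = 1"
      using s by (simp add: power_divide add.commute flip: add_divide_distrib)
    then obtain a where a: "0 \<le> a" "a < 2 * pi" "- w$2 / sin b = cos a" "w$1 / sin b = sin a"
      using sincos_total_2pi by metis
    from a(3,4) False have "w$1 = sin a * sin b" "w$2 = - cos a * sin b"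
      by (auto simp: field_simps)
    then have "w = pole a b" using b(3) by (simp add: vec_eq_iff forall_3 pole_def)
    then show thesis using that[of a b] a b by simp
  qed
qed

lemma pole_surj_half:
  assumes "w \<bullet> w = 1"
  obtains k a b where "k = 1 \<or> k = -1" "0 \<le> a" "a < pi" "0 \<le> b" "b \<le> pi" "k *\<^sub>R w = pole a b"
proof -
  obtain a b where ab: "0 \<le> a" "a < 2 * pi" "0 \<le> b" "b \<le> pi" "w = pole a b"
    using pole_surj[OF assms] .
  show thesis
  proof (cases "a < pi")
    case True
    then show thesis using that[of 1 a b] ab by simp
  next
    case False
    \<comment> \<open>The antipode: turn the azimuth by pi and reflect the polar angle.\<close>
    have "(-1) *\<^sub>R w = pole (a - pi) (pi - b)"
      by (simp add: ab vec_eq_iff forall_3 pole_def sin_diff cos_diff)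
    then show thesis using that[of "-1" "a - pi" "pi - b"] ab False by simp
  qed
qed

text \<open>Where the sine of the polar angle vanishes the azimuth is undetermined; this is why
  \<open>chart\<close> leaves those angles out.\<close>

lemma pole_inj:
  assumes "pole a b = pole a' b'" "0 \<le> a" "a < 2 * pi" "0 \<le> a'" "a' < 2 * pi"
    "0 \<le> b" "b \<le> pi" "0 \<le> b'" "b' \<le> pi" "sin b \<noteq> 0"
  shows "a = a'" "b = b'"
proof -
  have eq: "sin a * sin b = sin a' * sin b'" "cos a * sin b = cos a' * sin b'" "cos b = cos b'"
    using assms(1) by (auto simp: vec_eq_iff forall_3 pole_def)
  show "b = b'" using cos_inj_pi assms eq(3) by blast
  then have "sin a = sin a'" "cos a = cos a'" using eq assms by auto
  then obtain n :: int where n: "a = a' + 2 * pi * n" using sin_cos_eq_iff by blast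
  have "\<bar>2 * pi * n\<bar> < 2 * pi" using n assms by linarith
  then have "\<bar>real_of_int n\<bar> < 1" by (simp add: abs_mult)
  then have "n = 0" by linarith
  then show "a = a'" using n by simp
qed

text \<open>On the half sphere both azimuths have nonnegative sine, so antipodes would force both
  azimuths to be 0, and then two positive sines of polar angles would be opposite.\<close>

lemma pole_ne_minus_pole:
  assumes "0 \<le> a" "a < pi" "0 \<le> a'" "a' < pi" "0 \<le> b" "b \<le> pi" "0 \<le> b'" "b' \<le> pi"
    "sin b \<noteq> 0" "sin b' \<noteq> 0"
  shows "pole a b \<noteq> - pole a' b'"
proof
  assume "pole a b = - pole a' b'"
  then have eq: "sin a * sin b = - (sin a' * sin b')" "cos a * sin b = - (cos a' * sin b')"
    by (auto simp: vec_eq_iff forall_3 pole_def)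
  have pos: "sin b > 0" "sin b' > 0"
    using sin_ge_zero[of b] sin_ge_zero[of b'] assms by auto
  have ge: "sin a \<ge> 0" "sin a' \<ge> 0" using assms sin_ge_zero by auto
  have "sin a * sin b \<ge> 0" "sin a' * sin b' \<ge> 0" using pos ge by auto
  then have "sin a * sin b = 0" "sin a' * sin b' = 0" using eq by auto
  then have "sin a = 0" "sin a' = 0" using pos by auto
  then have "a = 0" "a' = 0"
    using sin_gt_zero[of a] sin_gt_zero[of a'] assms by (auto simp: order_less_le)
  then show False using eq pos by simp
qed

lemma twist_diff_pi: "twist (g - pi) = - twist g"
  by (simp add: twist_def vec_eq_iff forall_3)

lemma ess_mem_essential: "ess x \<in> essential_matrices"
proof -
  define A B where "A = frame (x$1) (x$2)" and "B = frame (x$3) (x$4)"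
  \<comment> \<open>The rotation by x$5 about the third axis. Then \<open>twist\<close> is the cross
    product with that axis after \<open>Q\<close>, and rotating by the transposed first frame moves
    the axis to the pole.\<close>
  define Q :: "real^3^3" where "Q = vector [vector [cos (x$5), - sin (x$5), 0], vector [sin (x$5), cos (x$5), 0],
      vector [0, 0, 1]]"
  have "rotation_matrix Q"
    by (simp add: rotation_matrix_def orthogonal_matrix vec_eq_iff forall_3 Q_def transpose_def
        matrix_matrix_mult_def mat_def sum_3 det_3 mult.commute)
  then have R: "rotation_matrix (transpose A ** Q ** B)"
    using rotation_frame[of "x$3" "x$4"] rotation_transpose_frame[of "x$1" "x$2"]
    by (auto simp: rotation_matrix_def A_def B_def det_mul intro!: orthogonal_matrix_mul)
  have "ess x *v v = (skew (pole (x$1) (x$2)) ** (transpose A ** Q ** B)) *v v" for v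
  proof -
    have "twist (x$5) *v y = cross3 (axis 3 1) (Q *v y)" for y
      by (simp add: vec_eq_iff forall_3 twist_def Q_def matrix_vector_mult_def sum_3 cross3_def axis_def)
    then show ?thesis
      using rotation_transpose_frame[of "x$1" "x$2"]
      by (simp add: ess_mult skew_mult pole_eq cross_rotation_matrix A_def B_def flip: matrix_vector_mul_assoc)
  qed
  then have "ess x = skew (pole (x$1) (x$2)) ** (transpose A ** Q ** B)"
    using matrix_eq by blast
  then show ?thesis using R unfolding essential_matrices_def by blast
qed

text \<open>If \<open>ess x\<close> were 0 it would be 0 times itself, while a proportionality
  factor between two such matrices has square 1.\<close>

lemma ess_nonzero: "ess x \<noteq> 0"
proof
  assume "ess x = 0"
  then have "ess x = 0 *\<^sub>R ess x" by simp
  then show False by (rule ess_eq_scaleR) simp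
qed

lemma rotation_fixing_axis_3:
  fixes Q :: "real^3^3"
  assumes Q: "rotation_matrix Q" and fix3: "Q *v axis 3 1 = axis 3 1"
  obtains g where "0 \<le> g" "g < 2 * pi" "\<And>y. cross3 (axis 3 1) (Q *v y) = twist g *v y"
proof -
  have o: "transpose Q ** Q = mat 1" "det Q = 1" using Q by (auto simp: rotation_matrix_def orthogonal_matrix)
  have "transpose Q *v axis 3 1 = transpose Q *v (Q *v axis 3 1)" using fix3 by simp
  then have fix3': "transpose Q *v axis 3 1 = axis 3 1" using o by (simp add: matrix_vector_mul_assoc)
  have e: "Q$1$3 = 0" "Q$2$3 = 0" "Q$3$3 = 1" "Q$3$1 = 0" "Q$3$2 = 0"
    using fix3 fix3' by (simp_all add: vec_eq_iff forall_3 matrix_vector_mult_def transpose_def sum_3 axis_def)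
  have q: "Q$1$1 * Q$1$1 + Q$2$1 * Q$2$1 = 1" "Q$1$2 * Q$1$2 + Q$2$2 * Q$2$2 = 1"
    using o(1) e by (simp_all add: vec_eq_iff forall_3 matrix_matrix_mult_def transpose_def sum_3 mat_def)
  have d: "Q$1$1 * Q$2$2 - Q$1$2 * Q$2$1 = 1" using o(2) e by (simp add: det_3)
  \<comment> \<open>Expanded, the left side is the sum of the squared lengths of the two planar
    columns minus twice the planar determinant: 1 + 1 - 2.\<close>
  have "(Q$2$2 - Q$1$1)\<^sup>2 + (Q$1$2 + Q$2$1)\<^sup>2 = 0"
    using q d by (simp add: power2_eq_square algebra_simps)
  then have e2: "Q$2$2 = Q$1$1" "Q$1$2 = - Q$2$1"
    by (auto simp: sum_power2_eq_zero_iff)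
  have "(Q$1$1)\<^sup>2 + (Q$2$1)\<^sup>2 = 1" using q by (simp add: power2_eq_square)
  then obtain g where g: "0 \<le> g" "g < 2 * pi" "Q$1$1 = cos g" "Q$2$1 = sin g"
    using sincos_total_2pi by metis
  have "cross3 (axis 3 1) (Q *v y) = twist g *v y" for y
    by (simp add: vec_eq_iff forall_3 twist_def matrix_vector_mult_def sum_3 cross3_def axis_def e e2 g)
  then show thesis using that g by blast
qed

text \<open>The kernel directions of \<open>[t]\<^sub>\<times> R\<close> are \<open>t\<close> on the
  left and \<open>transpose R *v t\<close> on the right. A sign \<open>k\<close> brings the right
  one into the half sphere and acts on both. In frames adapted to these directions \<open>R\<close>
  fixes the third axis, so it is a rotation by some angle \<open>g\<close>.\<close>

lemma essential_matrix_eq_ess: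
  assumes "E \<in> essential_matrices" "E \<noteq> 0"
  obtains x c where "x \<in> chart_closed" "c \<noteq> 0" "E = c *\<^sub>R ess x"
proof -
  obtain R t where R: "rotation_matrix R" and E: "E = skew t ** R"
    using assms(1) unfolding essential_matrices_def by blast
  have oR: "orthogonal_matrix R" "transpose R ** R = mat 1" "R ** transpose R = mat 1"
    using R by (auto simp: rotation_matrix_def orthogonal_matrix_def)
  have t0: "t \<noteq> 0"
  proof
    assume "t = 0"
    then have "E *v v = 0 *v v" for v
      by (simp add: E skew_mult flip: matrix_vector_mul_assoc)
    then show False using assms(2) matrix_eq by blast
  qed
  define \<tau> where "\<tau> = inverse (norm t) *\<^sub>R t"
  have t\<tau>: "t = norm t *\<^sub>R \<tau>" using t0 by (simp add: \<tau>_def)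
  have \<tau>1: "\<tau> \<bullet> \<tau> = 1" using t0 by (simp add: \<tau>_def dot_square_norm power2_eq_square)
  have "(transpose R *v \<tau>) \<bullet> (transpose R *v \<tau>) = 1"
    by (simp add: inner_transpose_mult matrix_vector_mul_assoc oR \<tau>1)
  then obtain k a2 b2 where k: "k = 1 \<or> k = -1" and ab2: "0 \<le> a2" "a2 < pi" "0 \<le> b2" "b2 \<le> pi"
    and w: "k *\<^sub>R (transpose R *v \<tau>) = pole a2 b2" by (rule pole_surj_half)
  have kk: "k * k = 1" using k by auto
  have "(k *\<^sub>R \<tau>) \<bullet> (k *\<^sub>R \<tau>) = 1" using k \<tau>1 by auto
  then obtain a1 b1 where ab1: "0 \<le> a1" "a1 < 2 * pi" "0 \<le> b1" "b1 \<le> pi"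
    and \<tau>: "k *\<^sub>R \<tau> = pole a1 b1" by (rule pole_surj)
  define A B where "A = frame a1 b1" and "B = frame a2 b2"
  have Rp: "R *v pole a2 b2 = pole a1 b1"
    by (simp flip: w \<tau> add: matrix_vector_mult_scaleR matrix_vector_mul_assoc oR)
  define Q where "Q = A ** R ** transpose B"
  have Q: "rotation_matrix Q"
    using R rotation_frame[of a1 b1] rotation_transpose_frame[of a2 b2]
    by (auto simp: rotation_matrix_def A_def B_def Q_def det_mul intro!: orthogonal_matrix_mul)
  have "Q *v axis 3 1 = A *v (R *v pole a2 b2)"
    by (simp add: Q_def pole_eq B_def matrix_vector_mul_assoc matrix_mul_assoc)
  also have "\<dots> = axis 3 1" unfolding Rp by (simp add: pole_eq A_def frame_mult_transpose)
  finally obtain g where g: "0 \<le> g" "g < 2 * pi" "\<And>y. cross3 (axis 3 1) (Q *v y) = twist g *v y"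
    using rotation_fixing_axis_3[OF Q] by metis
  have R': "R *v v = transpose A *v (Q *v (B *v v))" for v
  proof -
    have "transpose A *v (Q *v (B *v v)) = transpose A *v (A *v (R *v (transpose B *v (B *v v))))"
      by (simp add: Q_def flip: matrix_vector_mul_assoc)
    then show ?thesis by (simp add: A_def B_def transpose_mult_frame)
  qed
  have Ev: "E *v v = (norm t * k) *\<^sub>R (transpose A *v (twist g *v (B *v v)))" for v
  proof -
    have "E *v v = cross3 t (R *v v)" by (simp add: E skew_mult flip: matrix_vector_mul_assoc)
    also have "t = (norm t * k) *\<^sub>R (transpose A *v axis 3 1)"
    proof -
      have "t = (norm t * (k * k)) *\<^sub>R \<tau>" using t\<tau> kk by simp
      also have "\<dots> = (norm t * k) *\<^sub>R (k *\<^sub>R \<tau>)" by simp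
      finally show ?thesis by (simp only: \<tau> pole_eq A_def)
    qed
    also have "cross3 \<dots> (R *v v) = (norm t * k) *\<^sub>R (transpose A *v (twist g *v (B *v v)))"
      unfolding R' cross_mult_left using rotation_transpose_frame[of a1 b1]
      by (simp add: A_def cross_rotation_matrix g)
    finally show ?thesis .
  qed
  \<comment> \<open>Reducing \<open>g\<close> modulo pi changes the sign of \<open>twist\<close>;
    \<open>h\<close> records it.\<close>
  define h :: real where "h = (if g < pi then 1 else -1)"
  define x :: "real^5" where "x = vector [a1, b1, a2, b2, if g < pi then g else g - pi]"
  have x: "x$1 = a1" "x$2 = b1" "x$3 = a2" "x$4 = b2" "x$5 = (if g < pi then g else g - pi)"
    unfolding x_def by (rule vector_5)+
  have "twist g = h *\<^sub>R twist (x$5)" by (simp add: x h_def twist_diff_pi)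
  then have tw: "twist g *v y = h *\<^sub>R (twist (x$5) *v y)" for y
    by (simp only: scaleR_matrix_vector_assoc)
  have "E *v v = ((norm t * k * h) *\<^sub>R ess x) *v v" for v
    unfolding Ev tw
    by (simp add: ess_mult x A_def B_def matrix_vector_mult_scaleR flip: scaleR_matrix_vector_assoc)
  then have "E = (norm t * k * h) *\<^sub>R ess x" using matrix_eq by blast
  moreover have "x \<in> chart_closed" using ab1 ab2 g by (auto simp: chart_closed_def x)
  moreover have "norm t * k * h \<noteq> 0" using t0 k by (auto simp: h_def)
  ultimately show thesis using that by blast
qed

lemma twist_eq_of_ess_eq:
  assumes "ess x = c *\<^sub>R ess y" "x$1 = y$1" "x$2 = y$2" "x$3 = y$3" "x$4 = y$4"
  shows "twist (x$5) = c *\<^sub>R twist (y$5)"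
proof -
  let ?A = "frame (x$1) (x$2)" and ?B = "frame (x$3) (x$4)"
  have "twist (x$5) *v v = (c *\<^sub>R twist (y$5)) *v v" for v
  proof -
    have "?A *v (ess x *v (transpose ?B *v v)) = c *\<^sub>R (?A *v (ess y *v (transpose ?B *v v)))"
      by (simp add: assms(1) matrix_vector_mult_scaleR flip: scaleR_matrix_vector_assoc)
    then show ?thesis
      using assms(2-) by (simp add: ess_mult frame_mult_transpose flip: scaleR_matrix_vector_assoc)
  qed
  then show ?thesis using matrix_eq by blast
qed

text \<open>The half sphere for the second pole excludes the common sign -1, after which all four
  pole angles agree. The two twists then agree up to sign, and an angle in [0, pi) is determined by
  its cosine and sine up to a common sign.\<close>

lemma ess_inj:
  assumes x: "x \<in> chart" and y: "y \<in> chart" and eq: "ess x = c *\<^sub>R ess y"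
  shows "x = y"
proof -
  obtain k where k: "k = 1 \<or> k = -1" and c: "c\<^sup>2 = 1"
    and w: "pole (x$3) (x$4) = k *\<^sub>R pole (y$3) (y$4)" and t: "pole (x$1) (x$2) = k *\<^sub>R pole (y$1) (y$2)"
    using ess_eq_scaleR[OF eq] by metis
  note ranges = x[unfolded chart_def chart_closed_def, simplified] y[unfolded chart_def chart_closed_def, simplified]
  have "k = 1"
    using k pole_ne_minus_pole[of "x$3" "y$3" "x$4" "y$4"] w ranges by auto
  then have w: "x$3 = y$3" "x$4 = y$4" and t: "x$1 = y$1" "x$2 = y$2"
    using pole_inj[of "x$3" "x$4" "y$3" "y$4"] pole_inj[of "x$1" "x$2" "y$1" "y$2"] w t ranges by auto
  have "twist (x$5) = c *\<^sub>R twist (y$5)" by (rule twist_eq_of_ess_eq) (use eq w t in auto)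
  then have sc: "sin (x$5) = c * sin (y$5)" "cos (x$5) = c * cos (y$5)"
    by (auto simp: twist_def vec_eq_iff forall_3)
  have c': "c = 1 \<or> c = -1" using c by (simp add: power2_eq_1_iff)
  have r5: "0 \<le> x$5" "x$5 < pi" "0 \<le> y$5" "y$5 < pi" using ranges by blast+
  have "x$5 = y$5"
  proof (cases "c = 1")
    case True
    then have "cos (x$5) = cos (y$5)" using sc by simp
    then show ?thesis using cos_inj_pi[of "x$5" "y$5"] r5 by linarith
  next
    case False
    then have neg: "sin (x$5) = - sin (y$5)" "cos (x$5) = - cos (y$5)" using sc c' by auto
    moreover have "sin (x$5) \<ge> 0" "sin (y$5) \<ge> 0" using r5 by (auto intro!: sin_ge_zero)
    ultimately have "sin (x$5) = 0" "sin (y$5) = 0" by linarith+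
    then have "x$5 = 0" "y$5 = 0"
      using sin_gt_zero[of "x$5"] sin_gt_zero[of "y$5"] r5 by linarith+
    then show ?thesis by simp
  qed
  with w t show ?thesis unfolding vec_eq_iff forall_5 by blast
qed

section \<open>Counting the points of the essential variety\<close>

lemma num_points_image: "inj_on f S \<Longrightarrow> num_points (f ` S) = num_points S"
  by (simp add: num_points_def emeasure_count_space card_image finite_image_iff)

text \<open>The number of points depends on \<open>S\<close> only through which sets of a fine
  family \<open>B\<close> meet \<open>S\<close>. For countable \<open>B\<close> this is a supremum
  over countably many families, which preserves measurability.\<close>

lemma num_points_le_SUP:
  fixes S :: "'a::metric_space set" and B :: "'a set set"
  assumes B: "\<And>x e. e > 0 \<Longrightarrow> \<exists>K\<in>B. x \<in> K \<and> K \<subseteq> ball x e"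
  shows "num_points S = (SUP F\<in>{F. finite F \<and> F \<subseteq> B \<and> disjoint F}. \<Sum>K\<in>F. if K \<inter> S = {} then 0 else 1)"
    (is "_ = ?R")
proof (rule antisym)
  show "?R \<le> num_points S"
  proof (rule SUP_least)
    fix F assume F: "F \<in> {F. finite F \<and> F \<subseteq> B \<and> disjoint F}"
    have "(\<Sum>K\<in>F. if K \<inter> S = {} then 0 else 1 :: ennreal) \<le> (\<Sum>K\<in>F. emeasure (count_space UNIV) (K \<inter> S))"
    proof (rule sum_mono)
      fix K
      show "(if K \<inter> S = {} then 0 else 1 :: ennreal) \<le> emeasure (count_space UNIV) (K \<inter> S)"
      proof (cases "K \<inter> S = {}")
        case False
        then obtain x where "x \<in> K \<inter> S" by blast
        then have "emeasure (count_space UNIV) {x} \<le> emeasure (count_space UNIV) (K \<inter> S)"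
          by (intro emeasure_mono) auto
        moreover have "emeasure (count_space UNIV) {x} = 1" by (simp add: emeasure_count_space)
        ultimately show ?thesis using False by (simp only: if_False)
      qed simp
    qed
    also have "\<dots> = emeasure (count_space UNIV) (\<Union>K\<in>F. K \<inter> S)"
      using F by (intro sum_emeasure) (auto simp: disjoint_family_on_def disjoint_def)
    also have "\<dots> \<le> num_points S" unfolding num_points_def by (intro emeasure_mono) auto
    finally show "(\<Sum>K\<in>F. if K \<inter> S = {} then 0 else 1) \<le> num_points S" .
  qed
  have fin: "of_nat (card T) \<le> ?R" if T: "finite T" "T \<subseteq> S" for T
  proof -
    obtain e where e: "e > 0" "\<And>x y. x \<in> T \<Longrightarrow> y \<in> T \<Longrightarrow> x \<noteq> y \<Longrightarrow> 2 * e \<le> dist x y"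
    proof -
      \<comment> \<open>The extra element 1 keeps the set nonempty when \<open>T\<close> has fewer
        than two points.\<close>
      let ?D = "(\<lambda>(x, y). dist x y) ` ({(x, y) \<in> T \<times> T. x \<noteq> y}) \<union> {1}"
      have D: "finite ?D" "?D \<noteq> {}" using T(1) by (auto intro: finite_subset[of _ "T \<times> T"])
      then have "Min ?D > 0" by (subst Min_gr_iff) auto
      moreover have "Min ?D \<le> dist x y" if "x \<in> T" "y \<in> T" "x \<noteq> y" for x y
        by (rule Min_le) (use D that in auto)
      ultimately show thesis using that[of "Min ?D / 2"] by auto
    qed
    obtain K where K: "\<And>x. K x \<in> B \<and> x \<in> K x \<and> K x \<subseteq> ball x e"
      using B[OF e(1)] by metis
    have disj: "K x \<inter> K y = {}" if "x \<in> T" "y \<in> T" "x \<noteq> y" for x y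
    proof (rule ccontr)
      assume "K x \<inter> K y \<noteq> {}"
      then obtain z where "dist x z < e" "dist y z < e" using K by (meson disjoint_iff mem_ball subsetD)
      then have "dist x y < 2 * e" using dist_triangle2[of x y z] by linarith
      then show False using e(2)[OF that] by linarith
    qed
    then have inj: "inj_on K T" using K by (metis disjoint_iff inj_onI)
    have "of_nat (card T) = (\<Sum>x\<in>T. if K x \<inter> S = {} then 0 else 1 :: ennreal)"
      using K T by (subst sum.cong[where h="\<lambda>_. 1", OF refl]) auto
    also have "\<dots> = (\<Sum>K\<in>K ` T. if K \<inter> S = {} then 0 else 1)"
      using inj by (simp add: sum.reindex)
    also have "\<dots> \<le> ?R"
    proof (rule SUP_upper)
      have "disjoint (K ` T)" unfolding disjoint_def using disj by blast
      then show "K ` T \<in> {F. finite F \<and> F \<subseteq> B \<and> disjoint F}" using T K by blast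
    qed
    finally show ?thesis .
  qed
  show "num_points S \<le> ?R"
  proof (cases "finite S")
    case True
    then show ?thesis using fin[of S] by (simp add: num_points_def emeasure_count_space)
  next
    case False
    have "?R = \<infinity>"
    proof (rule ccontr)
      assume "?R \<noteq> \<infinity>"
      then have "?R < top" by (simp only: less_top infinity_ennreal_def not_False_eq_True)
      then obtain n where n: "?R < of_nat n" using ennreal_Ex_less_of_nat by blast
      obtain T where "T \<subseteq> S" "finite T" "card T = n" using infinite_arbitrarily_large[OF False, of n] by blast
      then show False using fin[of T] n by auto
    qed
    then show ?thesis by (simp only: infinity_ennreal_def top_greatest)
  qed
qed

text \<open>Closures of basic open sets serve as test sets \<open>K\<close>. Then
  \<open>K \<inter> C\<close> is compact, and the parameters \<open>y\<close> having a zero in it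
  form the projection of a closed set along a compact factor, which is closed.\<close>

lemma measurable_num_points_zeros:
  fixes g :: "'a::euclidean_space \<times> 'b::euclidean_space \<Rightarrow> real"
  assumes C: "compact C" and g: "continuous_on UNIV g"
  shows "(\<lambda>y. num_points {x\<in>C. g (x, y) = 0}) \<in> borel_measurable borel"
proof -
  obtain B0 :: "'a set set" where B0: "countable B0" "topological_basis B0"
    using ex_countable_basis by blast
  define B where "B = closure ` B0"
  have cB: "countable B" using B0 by (simp add: B_def)
  have B: "\<exists>K\<in>B. x \<in> K \<and> K \<subseteq> ball x e" if "e > 0" for x e
  proof -
    have "x \<in> ball x (e/2)" using that by simp
    then obtain U where U: "U \<in> B0" "x \<in> U" "U \<subseteq> ball x (e/2)"
      by (rule topological_basisE[OF B0(2) open_ball])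
    have "closure U \<subseteq> cball x (e/2)" using U(3) by (meson ball_subset_cball closed_cball closure_minimal order_trans)
    also have "\<dots> \<subseteq> ball x e" using that by auto
    finally show ?thesis using U(1,2) closure_subset[of U] unfolding B_def
      by (intro bexI[of _ "closure U"]) auto
  qed
  let ?FF = "{F. finite F \<and> F \<subseteq> B \<and> disjoint F}"
  have cF: "countable ?FF"
    by (rule countable_subset[OF _ countable_Collect_finite_subset[OF cB]]) auto
  have eq: "num_points {x\<in>C. g (x, y) = 0}
      = (SUP F\<in>?FF. \<Sum>K\<in>F. if K \<inter> {x\<in>C. g (x, y) = 0} = {} then 0 else 1)" for y
    using num_points_le_SUP[OF B] .
  have m: "(\<lambda>y. if K \<inter> {x\<in>C. g (x, y) = 0} = {} then 0 else 1 :: ennreal) \<in> borel_measurable borel"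
    if "K \<in> B" for K
  proof -
    have "closed K" using that by (auto simp: B_def)
    then have KC: "compact (K \<inter> C)" using C by (simp add: closed_Int_compact)
    have "closed {p. g p = 0}"
      using g by (intro closed_Collect_eq) (auto intro: continuous_intros)
    from closed_compact_projection[OF KC this]
    have cl: "closed {y. \<exists>x. x \<in> K \<inter> C \<and> g (x, y) = 0}" by simp
    have "(\<lambda>y. if K \<inter> {x\<in>C. g (x, y) = 0} = {} then 0 else 1 :: ennreal)
        = indicator {y. \<exists>x. x \<in> K \<inter> C \<and> g (x, y) = 0}"
      by (auto simp: fun_eq_iff indicator_def)
    then show ?thesis using cl by (simp add: borel_closed)
  qed
  show ?thesis unfolding eq
    by (intro borel_measurable_SUP[OF cF] borel_measurable_sum) (use m in auto)
qed

text \<open>The essential matrices of Euclidean norm sqrt 2, a double cover of the essential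
  variety. It is presented as a compact set to make \<open>measurable_num_points_zeros\<close>
  applicable.\<close>

definition ess_sphere :: "(real^3^3) set" where
  "ess_sphere = ess ` cbox 0 (\<chi> i. 2 * pi) \<union> uminus ` ess ` cbox 0 (\<chi> i. 2 * pi)"

lemma compact_ess_sphere: "compact ess_sphere"
  unfolding ess_sphere_def
  by (intro compact_Un compact_continuous_image continuous_on_ess continuous_on_minus continuous_on_id compact_cbox)

lemma uminus_ess_sphere: "E \<in> ess_sphere \<Longrightarrow> - E \<in> ess_sphere"
  unfolding ess_sphere_def by auto

lemma ess_mem_ess_sphere: "x \<in> chart_closed \<Longrightarrow> ess x \<in> ess_sphere"
proof -
  assume "x \<in> chart_closed"
  then have "x \<in> cbox 0 (\<chi> i. 2 * pi)" by (auto simp: chart_closed_def mem_box_cart forall_5)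
  then show ?thesis unfolding ess_sphere_def by blast
qed

lemma ess_sphereE:
  assumes "E \<in> ess_sphere"
  obtains x k where "k = 1 \<or> k = -1" "E = k *\<^sub>R ess x"
proof -
  obtain x where "E = ess x \<or> E = - ess x" using assms unfolding ess_sphere_def by blast
  then have "E = 1 *\<^sub>R ess x \<or> E = (-1) *\<^sub>R ess x" by simp
  then show thesis using that by blast
qed

lemma ess_sphere_nonzero: "E \<in> ess_sphere \<Longrightarrow> E \<noteq> 0"
  by (elim ess_sphereE) (auto simp: ess_nonzero)

lemma ess_sphere_scaleR:
  assumes "E \<in> ess_sphere" "E' \<in> ess_sphere" "E = c *\<^sub>R E'"
  shows "c = 1 \<or> c = -1"
proof -
  obtain x k where x: "k = 1 \<or> k = -1" "E = k *\<^sub>R ess x" using assms by (elim ess_sphereE)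
  obtain y l where y: "l = 1 \<or> l = -1" "E' = l *\<^sub>R ess y" using assms by (elim ess_sphereE)
  have "ess x = (k * k) *\<^sub>R ess x" using x by auto
  also have "\<dots> = (k * c * l) *\<^sub>R ess y" using assms(3) x y by (metis scaleR_scaleR mult.assoc)
  finally have "(k * c * l)\<^sup>2 = 1" by (rule ess_eq_scaleR) simp
  then show ?thesis using x y by (auto simp: power2_eq_1_iff)
qed

lemma Proj_scaleR: "E \<noteq> 0 \<Longrightarrow> c \<noteq> 0 \<Longrightarrow> Proj (c *\<^sub>R E) = Proj E"
  using Proj_eq_iff[of E "c *\<^sub>R E"] by auto

lemma num_points_Proj_ess_sphere:
  assumes "S \<subseteq> ess_sphere" and sym: "\<And>E. E \<in> S \<Longrightarrow> - E \<in> S"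
  shows "num_points S = 2 * num_points (Proj ` S)"
proof -
  \<comment> \<open>Half of \<open>S\<close>, one matrix out of each pair of opposite ones: those
    that are positive multiples of the chosen representative of their line.\<close>
  define T where "T = {E\<in>S. \<exists>c>0. E = c *\<^sub>R proj_rep (Proj E)}"
  have rep: "\<exists>c. c \<noteq> 0 \<and> E = c *\<^sub>R proj_rep (Proj E)" if "E \<in> S" for E
    using Proj_eq_iff[of "proj_rep (Proj E)" E] proj_rep[of "Proj E"] ess_sphere_nonzero[of E] assms that by auto
  have PE: "Proj (- E) = Proj E" if "E \<in> S" for E
    using Proj_scaleR[of E "-1"] ess_sphere_nonzero[of E] assms that by auto
  have ST: "S = T \<union> uminus ` T"
  proof
    show "S \<subseteq> T \<union> uminus ` T"
    proof
      fix E assume E: "E \<in> S"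
      then obtain c where c: "c \<noteq> 0" "E = c *\<^sub>R proj_rep (Proj E)" using rep by blast
      show "E \<in> T \<union> uminus ` T"
      proof (cases "c > 0")
        case True then show ?thesis using E c by (auto simp: T_def)
      next
        case False
        have "- E = (- c) *\<^sub>R proj_rep (Proj (- E))" using c(2) PE[OF E] by (metis scaleR_minus_left)
        then have "- E \<in> T" using sym[OF E] False c(1) unfolding T_def by (auto intro!: exI[of _ "- c"])
        then show ?thesis by (metis UnI2 imageI minus_minus)
      qed
    qed
    show "T \<union> uminus ` T \<subseteq> S" using sym by (auto simp: T_def)
  qed
  have disj: "T \<inter> uminus ` T = {}"
  proof (rule ccontr)
    assume "T \<inter> uminus ` T \<noteq> {}"
    then obtain E where E: "E \<in> T" "- E \<in> T" by auto
    then obtain c d where cd: "c > 0" "E = c *\<^sub>R proj_rep (Proj E)" "d > 0" "- E = d *\<^sub>R proj_rep (Proj (- E))"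
      unfolding T_def by blast
    have "(c + d) *\<^sub>R proj_rep (Proj E) = 0"
      using cd(2,4) PE[of E] E(1) by (metis (no_types, lifting) T_def mem_Collect_eq add.right_inverse scaleR_add_left)
    then show False using cd proj_rep(1)[of "Proj E"] by auto
  qed
  have inj: "inj_on Proj T"
  proof (rule inj_onI)
    fix E E' assume E: "E \<in> T" "E' \<in> T" "Proj E = Proj E'"
    define q where "q = proj_rep (Proj E)"
    obtain c where c: "c > 0" "E = c *\<^sub>R q" using E(1) unfolding T_def q_def by blast
    obtain d where d: "d > 0" "E' = d *\<^sub>R q" using E(2) unfolding T_def q_def E(3) by blast
    have eq: "E = (c / d) *\<^sub>R E'" using c d by simp
    then have "c / d = 1 \<or> c / d = -1"
      using E assms(1) by (intro ess_sphere_scaleR[of E E']) (auto simp: T_def)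
    moreover have "c / d > 0" using c d by simp
    ultimately have "c / d = 1" by auto
    then show "E = E'" using eq by simp
  qed
  have im: "Proj ` S = Proj ` T"
  proof -
    have "Proj ` uminus ` T = Proj ` T"
      unfolding image_image by (intro image_cong refl PE) (auto simp: T_def)
    then show ?thesis unfolding ST by (simp add: image_Un)
  qed
  have "num_points S = num_points T + num_points (uminus ` T)"
    unfolding num_points_def using disj by (subst ST, subst plus_emeasure) auto
  also have "num_points (uminus ` T) = num_points T" by (rule num_points_image) simp
  also have "num_points T = num_points (Proj ` S)" unfolding im by (rule num_points_image[OF inj, symmetric])
  finally show ?thesis by (simp add: mult_2)
qed

lemma essential_Int_epipolar:
  assumes "\<And>i. u i \<noteq> 0" "\<And>i. v i \<noteq> 0"
  shows "essential_variety \<inter> epipolar_space (\<lambda>i. Proj (u i)) (\<lambda>i. Proj (v i))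
    = Proj ` {E\<in>ess_sphere. \<forall>i. u i \<bullet> (E *v v i) = 0}"
    and "E \<in> ess_sphere \<Longrightarrow> \<forall>i. u i \<bullet> (E *v v i) = 0 \<Longrightarrow> \<forall>i. u i \<bullet> (- E *v v i) = 0"
proof -
  let ?S = "{E\<in>ess_sphere. \<forall>i. u i \<bullet> (E *v v i) = 0}"
  have neg: "- E *v w = - (E *v w)" for E :: "real^3^3" and w
    using scaleR_matrix_vector_assoc[of "-1" E w] by simp
  show "E \<in> ess_sphere \<Longrightarrow> \<forall>i. u i \<bullet> (E *v v i) = 0 \<Longrightarrow> \<forall>i. u i \<bullet> (- E *v v i) = 0"
    by (simp add: neg)
  show "essential_variety \<inter> epipolar_space (\<lambda>i. Proj (u i)) (\<lambda>i. Proj (v i)) = Proj ` ?S"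
  proof
    show "Proj ` ?S \<subseteq> essential_variety \<inter> epipolar_space (\<lambda>i. Proj (u i)) (\<lambda>i. Proj (v i))"
    proof
      fix p assume "p \<in> Proj ` ?S"
      then obtain E where E: "E \<in> ?S" "p = Proj E" by blast
      then have "E \<in> ess_sphere" by simp
      then obtain x k where x: "k = 1 \<or> k = -1" "E = k *\<^sub>R ess x" by (rule ess_sphereE)
      then have "p = Proj (ess x)" using E(2) Proj_scaleR[OF ess_nonzero[of x], of k] by auto
      then have "p \<in> essential_variety"
        unfolding essential_variety_def using ess_mem_essential[of x] ess_nonzero[of x] by blast
      moreover have "E \<noteq> 0" using E(1) ess_sphere_nonzero by blast
      ultimately show "p \<in> essential_variety \<inter> epipolar_space (\<lambda>i. Proj (u i)) (\<lambda>i. Proj (v i))"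
        using E by (auto simp: epipolar_space_def epipolar_Proj assms)
    qed
    show "essential_variety \<inter> epipolar_space (\<lambda>i. Proj (u i)) (\<lambda>i. Proj (v i)) \<subseteq> Proj ` ?S"
    proof
      fix p assume p: "p \<in> essential_variety \<inter> epipolar_space (\<lambda>i. Proj (u i)) (\<lambda>i. Proj (v i))"
      then have "p \<in> essential_variety" by simp
      then obtain E where E: "E \<in> essential_matrices" "E \<noteq> 0" "p = Proj E"
        unfolding essential_variety_def by auto
      obtain x c where x: "x \<in> chart_closed" "c \<noteq> 0" "E = c *\<^sub>R ess x"
        using E(1,2) by (rule essential_matrix_eq_ess)
      have p2: "p = Proj (ess x)" using E x Proj_scaleR[OF ess_nonzero] by simp
      then have "ess x \<in> ?S"
        using p ess_mem_ess_sphere[OF x(1)] by (auto simp: epipolar_space_def epipolar_Proj assms ess_nonzero)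
      then show "p \<in> Proj ` ?S" using p2 by blast
    qed
  qed
qed

lemma num_points_essential:
  assumes "\<And>i. u i \<noteq> 0" "\<And>i. v i \<noteq> 0"
  shows "2 * num_points (essential_variety \<inter> epipolar_space (\<lambda>i. Proj (u i)) (\<lambda>i. Proj (v i)))
    = num_points {E\<in>ess_sphere. \<forall>i. u i \<bullet> (E *v v i) = 0}"
  unfolding essential_Int_epipolar(1)[OF assms]
  by (rule num_points_Proj_ess_sphere[symmetric])
    (use essential_Int_epipolar(2)[of u v, OF assms] uminus_ess_sphere in auto)

text \<open>Every point of the variety is reached from \<open>chart_closed\<close>, but injectivity
  holds on \<open>chart\<close> only. The set \<open>T\<close> mediates: it lies in
  \<open>chart\<close> and contains all solutions that occur in \<open>chart_closed\<close>.\<close>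

lemma num_points_essential_chart:
  assumes nz: "\<And>i. u i \<noteq> 0" "\<And>i. v i \<noteq> 0"
    and T: "T \<subseteq> chart" "\<And>x. x \<in> chart_closed \<Longrightarrow> (\<And>i. u i \<bullet> (ess x *v v i) = 0) \<Longrightarrow> x \<in> T"
  shows "num_points (essential_variety \<inter> epipolar_space (\<lambda>i. Proj (u i)) (\<lambda>i. Proj (v i)))
    = num_points {x\<in>T. \<forall>i. u i \<bullet> (ess x *v v i) = 0}"
proof -
  let ?S = "{x\<in>T. \<forall>i. u i \<bullet> (ess x *v v i) = 0}"
  have eq: "essential_variety \<inter> epipolar_space (\<lambda>i. Proj (u i)) (\<lambda>i. Proj (v i)) = (\<lambda>x. Proj (ess x)) ` ?S"
  proof
    show "(\<lambda>x. Proj (ess x)) ` ?S \<subseteq> essential_variety \<inter> epipolar_space (\<lambda>i. Proj (u i)) (\<lambda>i. Proj (v i))"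
    proof clarify
      fix x assume x: "x \<in> T" "\<forall>i. u i \<bullet> (ess x *v v i) = 0"
      then have "ess x \<in> ess_sphere" using T(1) by (intro ess_mem_ess_sphere) (auto simp: chart_def)
      then show "Proj (ess x) \<in> essential_variety \<inter> epipolar_space (\<lambda>i. Proj (u i)) (\<lambda>i. Proj (v i))"
        unfolding essential_Int_epipolar(1)[of u v, OF nz] using x by blast
    qed
    show "essential_variety \<inter> epipolar_space (\<lambda>i. Proj (u i)) (\<lambda>i. Proj (v i)) \<subseteq> (\<lambda>x. Proj (ess x)) ` ?S"
    proof
      fix p assume p: "p \<in> essential_variety \<inter> epipolar_space (\<lambda>i. Proj (u i)) (\<lambda>i. Proj (v i))"
      then have "p \<in> essential_variety" by simp
      then obtain E where E: "E \<in> essential_matrices" "E \<noteq> 0" "p = Proj E"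
        unfolding essential_variety_def by auto
      obtain x c where x: "x \<in> chart_closed" "c \<noteq> 0" "E = c *\<^sub>R ess x"
        using E(1,2) by (rule essential_matrix_eq_ess)
      have p2: "p = Proj (ess x)" using E x Proj_scaleR[OF ess_nonzero] by simp
      then have "\<And>i. u i \<bullet> (ess x *v v i) = 0"
        using p by (auto simp: epipolar_space_def epipolar_Proj nz ess_nonzero)
      then show "p \<in> (\<lambda>x. Proj (ess x)) ` ?S" using p2 T(2)[OF x(1)] by blast
    qed
  qed
  have "inj_on (\<lambda>x. Proj (ess x)) ?S"
  proof (rule inj_onI)
    fix x y assume xy: "x \<in> ?S" "y \<in> ?S" "Proj (ess x) = Proj (ess y)"
    then obtain c where "ess y = c *\<^sub>R ess x" using Proj_eq_iff[OF ess_nonzero ess_nonzero] by blast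
    then show "x = y" using ess_inj[of y x] xy T(1) by blast
  qed
  then show ?thesis unfolding eq by (rule num_points_image)
qed

section \<open>A Borel choice of representatives for lines\<close>

definition gram :: "real^3 \<Rightarrow> real^3^3" where
  "gram x = (\<chi> i j. x$i * x$j / (x \<bullet> x))"

lemma gram_scaleR: "c \<noteq> 0 \<Longrightarrow> gram (c *\<^sub>R x) = gram x"
  by (simp add: gram_def vec_eq_iff)

lemma gram_nth: "gram x $ i = (x$i / (x \<bullet> x)) *\<^sub>R x"
  by (simp add: gram_def vec_eq_iff)

text \<open>The orthogonal projector onto the line. It does not depend on the representative and is
  continuous on the projective plane, whereas \<open>proj_rep\<close> is an arbitrary
  choice.\<close>

definition proj_gram :: "(real^3) proj \<Rightarrow> real^3^3" where
  "proj_gram p = gram (proj_rep p)"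

lemma proj_gram_Proj: "x \<noteq> 0 \<Longrightarrow> proj_gram (Proj x) = gram x"
proof -
  assume x: "x \<noteq> 0"
  then obtain c where "c \<noteq> 0" "x = c *\<^sub>R proj_rep (Proj x)"
    using Proj_eq_iff[of "proj_rep (Proj x)" x] proj_rep[of "Proj x"] by auto
  then show ?thesis unfolding proj_gram_def by (metis gram_scaleR)
qed

lemma borel_measurable_proj_gram[measurable]: "proj_gram \<in> borel_measurable borel"
proof (rule borel_measurable_continuous_onI)
  have c: "continuous_on (- {0}) gram"
    unfolding gram_def by (intro continuous_intros) auto
  show "continuous_on UNIV proj_gram"
    unfolding continuous_on_open_vimage[OF open_UNIV]
  proof (intro allI impI)
    fix T :: "(real^3^3) set" assume "open T"
    then have "open (- {0} \<inter> gram -` T)"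
      by (intro continuous_open_preimage[OF c]) auto
    moreover have "- {0} \<inter> gram -` T = {x. x \<noteq> 0 \<and> Proj x \<in> proj_gram -` T}"
      by (auto simp: proj_gram_Proj)
    ultimately have "open (proj_gram -` T)" unfolding open_proj_def by simp
    then show "open (proj_gram -` T \<inter> UNIV)" by simp
  qed
qed

text \<open>Row \<open>i\<close> of the projector is a multiple of the line's direction, and it is
  nonzero exactly if its diagonal entry is; the first such row is taken.\<close>

definition proj_section :: "(real^3) proj \<Rightarrow> real^3" where
  "proj_section p = (let m = proj_gram p in
     if m$1$1 \<noteq> 0 then m$1 else if m$2$2 \<noteq> 0 then m$2 else m$3)"

lemma borel_measurable_proj_section[measurable]: "proj_section \<in> borel_measurable borel"
  unfolding proj_section_def Let_def by measurable

lemma proj_section: "proj_section p \<noteq> 0" "Proj (proj_section p) = p"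
proof -
  define x where "x = proj_rep p"
  have x: "x \<noteq> 0" "Proj x = p" using proj_rep[of p] by (auto simp: x_def)
  have d: "proj_gram p $ i $ i \<noteq> 0 \<longleftrightarrow> x$i \<noteq> 0" for i
    using x by (simp add: proj_gram_def gram_def flip: x_def)
  have "x$1 \<noteq> 0 \<or> x$2 \<noteq> 0 \<or> x$3 \<noteq> 0" using x(1) by (simp add: vec_eq_iff forall_3)
  then obtain i where "x$i \<noteq> 0" "proj_section p = proj_gram p $ i"
    unfolding proj_section_def Let_def d by (metis (full_types))
  then have "x$i / (x \<bullet> x) \<noteq> 0" "proj_section p = (x$i / (x \<bullet> x)) *\<^sub>R x"
    using x by (simp_all add: proj_gram_def gram_nth flip: x_def)
  then obtain c where c: "c \<noteq> 0" "proj_section p = c *\<^sub>R x" by blast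
  then show "proj_section p \<noteq> 0" "Proj (proj_section p) = p"
    using x Proj_eq_iff[of x "c *\<^sub>R x"] by auto
qed

lemma borel_measurable_Proj: "{x. x \<noteq> 0 \<and> Proj x \<in> S} \<in> sets borel" if "S \<in> sets borel" for S :: "'a::euclidean_space proj set"
proof -
  have "S \<in> sigma_sets UNIV {S. open S}" using that by (simp add: borel_def)
  then show ?thesis
  proof induct
    case (Basic S)
    then show ?case by (simp add: open_proj_def borel_open)
  next
    case (Compl S)
    have "{x. x \<noteq> 0 \<and> Proj x \<in> UNIV - S} = (- {0}) - {x. x \<noteq> 0 \<and> Proj x \<in> S}" by auto
    moreover have "(- {0::'a}) \<in> sets borel" by (intro borel_open) auto
    ultimately show ?case using Compl by (simp add: sets.Diff)
  next
    case (Union A)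
    have "{x. x \<noteq> 0 \<and> Proj x \<in> (\<Union>i. A i)} = (\<Union>i. {x. x \<noteq> 0 \<and> Proj x \<in> A i})" by auto
    then show ?case using Union by (simp add: sets.countable_UN)
  qed simp
qed

lemma measurable_Proj[measurable]: "Proj \<in> borel_measurable (borel :: 'a::euclidean_space measure)"
proof (rule measurableI)
  fix S :: "'a proj set" assume S: "S \<in> sets borel"
  \<comment> \<open>The unspecified point \<open>Proj 0\<close> may lie in \<open>S\<close>; it
    affects the preimage only by the origin.\<close>
  have "Proj -` S \<inter> space borel = {x. x \<noteq> 0 \<and> Proj x \<in> S} \<union> (if Proj 0 \<in> S then {0} else {})"
    by auto
  then show "Proj -` S \<inter> space borel \<in> sets (borel :: 'a measure)"
    using borel_measurable_Proj[OF S] by simp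
qed simp

text \<open>The factor \<open>1/2\<close> accounts for the two representatives \<open>E\<close> and \<open>- E\<close> of a point in \<open>ess_sphere\<close>.\<close>

definition num_solutions :: "(real^3)^5 \<Rightarrow> (real^3)^5 \<Rightarrow> ennreal" where
  "num_solutions u v = num_points {E\<in>ess_sphere. \<forall>i. u$i \<bullet> (E *v v$i) = 0} / 2"

lemma borel_measurable_num_solutions:
  "(\<lambda>y. num_solutions (fst y) (snd y)) \<in> borel_measurable borel"
proof -
  \<comment> \<open>The sum of squares merges the five equations into a single one, as
    \<open>measurable_num_points_zeros\<close> expects.\<close>
  define g :: "(real^3^3) \<times> (((real^3)^5) \<times> ((real^3)^5)) \<Rightarrow> real"
    where "g p = (\<Sum>i\<in>UNIV. (fst (snd p) $ i \<bullet> (fst p *v snd (snd p) $ i))\<^sup>2)" for p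
  have "continuous_on UNIV g"
    unfolding g_def matrix_vector_mult_def by (intro continuous_intros)
  from measurable_num_points_zeros[OF compact_ess_sphere this]
  have "(\<lambda>y. num_points {E\<in>ess_sphere. g (E, y) = 0} / 2) \<in> borel_measurable borel"
    by measurable
  moreover have "num_points {E\<in>ess_sphere. g (E, y) = 0} / 2 = num_solutions (fst y) (snd y)" for y
    unfolding num_solutions_def g_def by (simp add: sum_nonneg_eq_0_iff)
  ultimately show ?thesis by simp
qed

lemma measurable_num_solutions[measurable (raw)]:
  assumes [measurable]: "f \<in> borel_measurable M" "g \<in> borel_measurable M"
  shows "(\<lambda>x. num_solutions (f x) (g x)) \<in> borel_measurable M"
proof -
  have "(\<lambda>x. (f x, g x)) \<in> borel_measurable M" by simp
  from measurable_compose[OF this borel_measurable_num_solutions] show ?thesis by simp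
qed

lemma num_points_eq_num_solutions:
  assumes "\<And>i. u$i \<noteq> 0" "\<And>i. v$i \<noteq> 0"
  shows "num_points (essential_variety \<inter> epipolar_space (\<lambda>i. Proj (u$i)) (\<lambda>i. Proj (v$i)))
    = num_solutions u v"
proof -
  have "2 * num_points (essential_variety \<inter> epipolar_space (\<lambda>i. Proj (u$i)) (\<lambda>i. Proj (v$i))) / 2
    = num_solutions u v"
    unfolding num_solutions_def num_points_essential[of "\<lambda>i. u$i" "\<lambda>i. v$i", OF assms] ..
  then show ?thesis by (subst (asm) mult.commute) (simp add: ennreal_mult_divide_eq)
qed

text \<open>With the nonzero Borel representatives \<open>proj_section\<close> the count equals
  \<open>num_solutions\<close> at every \<open>w\<close>, without exceptional sets.\<close>

lemma measurable_num_points_essential: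
  "(\<lambda>w. num_points (essential_variety \<inter> epipolar_space (\<lambda>i. w (Inl i)) (\<lambda>i. w (Inr i))))
    \<in> borel_measurable (\<Pi>\<^sub>M i\<in>(UNIV::(5+5) set). (borel :: (real^3) proj measure))"
proof -
  have "num_points (essential_variety \<inter> epipolar_space (\<lambda>i. w (Inl i)) (\<lambda>i. w (Inr i)))
    = num_solutions (\<chi> i. proj_section (w (Inl i))) (\<chi> i. proj_section (w (Inr i)))"
    for w :: "5 + 5 \<Rightarrow> (real^3) proj"
    using num_points_eq_num_solutions[of "\<chi> i. proj_section (w (Inl i))" "\<chi> i. proj_section (w (Inr i))"]
    by (simp add: proj_section)
  moreover have "(\<lambda>w. num_solutions (\<chi> i. proj_section (w (Inl i))) (\<chi> i. proj_section (w (Inr i))))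
      \<in> borel_measurable (\<Pi>\<^sub>M i\<in>(UNIV::(5+5) set). (borel :: (real^3) proj measure))"
  proof -
    have [measurable]: "(\<lambda>w. w i) \<in> (\<Pi>\<^sub>M i\<in>(UNIV::(5+5) set). (borel :: (real^3) proj measure)) \<rightarrow>\<^sub>M borel" for i
      by (rule measurable_component_singleton) simp
    show ?thesis by measurable
  qed
  ultimately show ?thesis by simp
qed

section \<open>The epipolar equations on the chart\<close>

text \<open>The gradient in \<open>x\<close> of the form \<open>u \<bullet> (ess x *v v)\<close>.
  Here (p, q) are the planar coordinates of the twist applied to \<open>V\<close>, and (l, m) those
  of the transposed twist applied to \<open>U\<close>.\<close>

definition ess_grad :: "real^5 \<Rightarrow> real^3 \<Rightarrow> real^3 \<Rightarrow> real^5" where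
  "ess_grad x u v =
    (let U = frame (x$1) (x$2) *v u; V = frame (x$3) (x$4) *v v; g = x$5;
         p = - sin g * V$1 - cos g * V$2; q = cos g * V$1 - sin g * V$2;
         l = - sin g * U$1 + cos g * U$2; m = - cos g * U$1 - sin g * U$2
     in vector [p * (cos (x$2) * U$2 - sin (x$2) * U$3) - q * U$1 * cos (x$2), q * U$3,
          l * (cos (x$4) * V$2 - sin (x$4) * V$3) - m * V$1 * cos (x$4), m * V$3,
          - cos g * (U$1 * V$1 + U$2 * V$2) - sin g * (U$2 * V$1 - U$1 * V$2)])"

lemma has_derivative_vec_nth: "((\<lambda>x::real^'n. x$i) has_derivative (\<lambda>h. h$i)) (at x)"
  by (rule bounded_linear.has_derivative[OF bounded_linear_vec_nth has_derivative_ident])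

lemma inner_3: "(u::real^3) \<bullet> w = u$1 * w$1 + u$2 * w$2 + u$3 * w$3"
  by (simp add: inner_vec_def sum_3)

lemma inner_5: "(u::real^5) \<bullet> w = u$1 * w$1 + u$2 * w$2 + u$3 * w$3 + u$4 * w$4 + u$5 * w$5"
  by (simp add: inner_vec_def sum_5)

text \<open>Differentiating a moving frame gives again coordinates in that frame, so the gradient
  can be written in \<open>U\<close> and \<open>V\<close> alone.\<close>

lemma has_derivative_frame_mult:
  fixes i j :: 5
  shows "((\<lambda>x::real^5. (frame (x$i) (x$j) *v u) $ 1) has_derivative
      (\<lambda>h. h$i * (cos (x$j) * (frame (x$i) (x$j) *v u) $ 2 - sin (x$j) * (frame (x$i) (x$j) *v u) $ 3))) (at x)"
    and "((\<lambda>x::real^5. (frame (x$i) (x$j) *v u) $ 2) has_derivative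
      (\<lambda>h. h$j * (frame (x$i) (x$j) *v u) $ 3 - h$i * cos (x$j) * (frame (x$i) (x$j) *v u) $ 1)) (at x)"
proof -
  note [derivative_intros] = has_derivative_vec_nth
  have id: "cos (x$j) * ((u$2 * cos (x$i) - u$1 * sin (x$i)) * cos (x$j) + u$3 * sin (x$j))
      - sin (x$j) * ((u$1 * sin (x$i) - u$2 * cos (x$i)) * sin (x$j) + u$3 * cos (x$j))
        = (u$2 * cos (x$i) - u$1 * sin (x$i)) * (cos (x$j) * cos (x$j) + sin (x$j) * sin (x$j))"
    by (simp add: algebra_simps del: sin_cos_squared_add sin_cos_squared_add2 sin_cos_squared_add3)
  show "((\<lambda>x::real^5. (frame (x$i) (x$j) *v u) $ 1) has_derivative
      (\<lambda>h. h$i * (cos (x$j) * (frame (x$i) (x$j) *v u) $ 2 - sin (x$j) * (frame (x$i) (x$j) *v u) $ 3))) (at x)"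
    unfolding frame_mult id by (auto intro!: derivative_eq_intros simp: algebra_simps)
  show "((\<lambda>x::real^5. (frame (x$i) (x$j) *v u) $ 2) has_derivative
      (\<lambda>h. h$j * (frame (x$i) (x$j) *v u) $ 3 - h$i * cos (x$j) * (frame (x$i) (x$j) *v u) $ 1)) (at x)"
    unfolding frame_mult by (auto intro!: derivative_eq_intros simp: algebra_simps)
qed

lemma has_derivative_inner_ess:
  "((\<lambda>x. u \<bullet> (ess x *v v)) has_derivative (\<lambda>h. ess_grad x u v \<bullet> h)) (at x)"
proof -
  note [derivative_intros] = has_derivative_vec_nth has_derivative_frame_mult
  have eq: "(\<lambda>x. u \<bullet> (ess x *v v)) = (\<lambda>x.
      (frame (x$1) (x$2) *v u) $ 1 * (- sin (x$5) * (frame (x$3) (x$4) *v v) $ 1 - cos (x$5) * (frame (x$3) (x$4) *v v) $ 2)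
      + (frame (x$1) (x$2) *v u) $ 2 * (cos (x$5) * (frame (x$3) (x$4) *v v) $ 1 - sin (x$5) * (frame (x$3) (x$4) *v v) $ 2))"
    unfolding inner_ess unfolding inner_3 twist_mult by simp
  show ?thesis unfolding eq
    by (auto intro!: derivative_eq_intros simp: inner_5 ess_grad_def Let_def vector_5)
      (simp add: algebra_simps)
qed

lemma ess_grad_add_scaleR: "ess_grad x (u + c *\<^sub>R w) v = ess_grad x u v + c *\<^sub>R ess_grad x w v"
  unfolding vec_eq_iff forall_5
  by (simp add: ess_grad_def Let_def vector_5 matrix_vector_right_distrib matrix_vector_mult_scaleR algebra_simps)

lemma continuous_on_ess_grad:
  fixes S :: "'a::t2_space set"
  assumes [continuous_intros]: "continuous_on S x" "continuous_on S u" "continuous_on S v"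
  shows "continuous_on S (\<lambda>t. ess_grad (x t) (u t) (v t))"
proof -
  have "continuous_on S (\<lambda>t. ess_grad (x t) (u t) (v t) $ i)" for i
    using exhaust_5[of i]
    by (elim disjE; simp add: ess_grad_def Let_def vector_5 frame_mult) (intro continuous_intros)+
  then have "continuous_on S (\<lambda>t. \<chi> i. ess_grad (x t) (u t) (v t) $ i)"
    by (intro continuous_on_vec_lambda)
  then show ?thesis by simp
qed

lemma chart_closed_borel[measurable]: "chart_closed \<in> sets borel"
  unfolding chart_closed_def by measurable

lemma chart_borel[measurable]: "chart \<in> sets borel"
proof -
  have "{x::real^5. sin (x$2) \<noteq> 0 \<and> sin (x$4) \<noteq> 0} \<in> sets borel" by measurable
  then have "chart_closed \<inter> {x::real^5. sin (x$2) \<noteq> 0 \<and> sin (x$4) \<noteq> 0} \<in> sets borel" by simp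
  also have "chart_closed \<inter> {x::real^5. sin (x$2) \<noteq> 0 \<and> sin (x$4) \<noteq> 0} = chart"
    by (auto simp: chart_def)
  finally show ?thesis .
qed

lemma has_derivative_vecI:
  fixes f :: "'a::real_normed_vector \<Rightarrow> real^'n"
  assumes "\<And>i. ((\<lambda>x. f x $ i) has_derivative (\<lambda>h. f' h $ i)) (at x within S)"
  shows "(f has_derivative f') (at x within S)"
  using assms by (subst has_derivative_componentwise_within) (auto simp: Basis_vec_def inner_axis)

lemma inner_vector_3: "vector [a, b, c] \<bullet> (w::real^3) = a * w$1 + b * w$2 + c * w$3"
  by (simp add: inner_3)

definition epipolar_solve :: "real^5 \<Rightarrow> real \<Rightarrow> real \<Rightarrow> real^3 \<Rightarrow> real" where
  "epipolar_solve x a b v = - (a * (ess x *v v)$1 + b * (ess x *v v)$2) / (ess x *v v)$3"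

lemma epipolar_solve_iff:
  "(ess x *v v)$3 \<noteq> 0 \<Longrightarrow> vector [a, b, c] \<bullet> (ess x *v v) = 0 \<longleftrightarrow> epipolar_solve x a b v = c"
  by (auto simp: epipolar_solve_def inner_vector_3 field_simps)

lemma continuous_on_ess_mult:
  fixes S :: "'a::t2_space set"
  assumes "continuous_on S x" "continuous_on S v"
  shows "continuous_on S (\<lambda>t. ess (x t) *v v t)"
  by (intro continuous_on_matrix_vector_mult assms continuous_on_compose2[OF continuous_on_ess assms(1)]) auto

text \<open>Implicit differentiation of the equation: the derivative is minus the gradient in
  \<open>x\<close>, taken at the solved vector, divided by the coefficient of the unknown. Linearity
  of \<open>ess_grad\<close> in \<open>u\<close> brings the quotient rule into this form.\<close>

lemma has_derivative_epipolar_solve: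
  assumes nz: "(ess x *v v)$3 \<noteq> 0"
  shows "((\<lambda>x. epipolar_solve x a b v) has_derivative
    (\<lambda>h. (- 1 / (ess x *v v)$3) * (ess_grad x (vector [a, b, epipolar_solve x a b v]) v \<bullet> h))) (at x)"
proof -
  let ?u0 = "vector [a, b, 0] :: real^3" and ?e = "vector [0, 0, 1] :: real^3"
  have eq: "(\<lambda>x. epipolar_solve x a b v) = (\<lambda>x. - (?u0 \<bullet> (ess x *v v)) / (?e \<bullet> (ess x *v v)))"
    by (simp add: fun_eq_iff epipolar_solve_def inner_vector_3)
  have eu: "vector [a, b, c] = ?u0 + c *\<^sub>R ?e" for c
    by (simp add: vec_eq_iff forall_3)
  have "((\<lambda>x. - (?u0 \<bullet> (ess x *v v)) / (?e \<bullet> (ess x *v v))) has_derivative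
     (\<lambda>h. (- (ess_grad x ?u0 v \<bullet> h) * (?e \<bullet> (ess x *v v)) - - (?u0 \<bullet> (ess x *v v)) * (ess_grad x ?e v \<bullet> h))
        / ((?e \<bullet> (ess x *v v)) * (?e \<bullet> (ess x *v v))))) (at x)"
    by (intro has_derivative_divide' has_derivative_minus has_derivative_inner_ess)
      (use nz in \<open>simp add: inner_vector_3\<close>)
  then show ?thesis
    unfolding eq
  proof (rule has_derivative_eq_rhs, intro ext)
    fix h
    let ?n = "(ess x *v v)$3" and ?q = "?u0 \<bullet> (ess x *v v)"
    have e: "?e \<bullet> (ess x *v v) = ?n" by (simp add: inner_vector_3)
    have sol: "epipolar_solve x a b v = - ?q / ?n"
      by (simp add: epipolar_solve_def inner_vector_3)
    have g: "ess_grad x (vector [a, b, - ?q / ?n]) v = ess_grad x ?u0 v + (- ?q / ?n) *\<^sub>R ess_grad x ?e v"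
      by (subst eu) (rule ess_grad_add_scaleR)
    show "(- (ess_grad x ?u0 v \<bullet> h) * (?e \<bullet> (ess x *v v)) - - ?q * (ess_grad x ?e v \<bullet> h))
        / ((?e \<bullet> (ess x *v v)) * (?e \<bullet> (ess x *v v)))
      = - 1 / ?n * (ess_grad x (vector [a, b, epipolar_solve x a b v]) v \<bullet> h)"
      unfolding e sol g inner_add_left inner_scaleR_left using nz by (simp add: field_simps)
  qed
qed

text \<open>The area formula for \<open>F\<close>, the map from \<open>x\<close> to the five solved
  coordinates. Where the equations are solvable the fibre of \<open>F\<close> over \<open>c\<close>
  is the solution set for \<open>c\<close>, and the denominators come out of the Jacobian row by
  row.\<close>

lemma area_ess:
  fixes a b :: "real^5" and v :: "(real^3)^5"
  assumes h: "h \<in> borel_measurable borel"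
  defines "F \<equiv> \<lambda>x. \<chi> i. epipolar_solve x (a$i) (b$i) (v$i)"
  shows "(\<integral>\<^sup>+c. num_points {x\<in>{x\<in>chart. \<forall>i. (ess x *v v$i)$3 \<noteq> 0}.
            \<forall>i. vector [a$i, b$i, c$i] \<bullet> (ess x *v v$i) = 0} * h c \<partial>lborel)
    = (\<integral>\<^sup>+x. indicator {x\<in>chart. \<forall>i. (ess x *v v$i)$3 \<noteq> 0} x
         * ennreal (\<bar>det (\<chi> i. ess_grad x (vector [a$i, b$i, F x $ i]) (v$i))\<bar> / (\<Prod>i\<in>UNIV. \<bar>(ess x *v v$i)$3\<bar>))
         * h (F x) \<partial>lborel)"
proof -
  define W where "W = {x. \<forall>i. (ess x *v v$i)$3 \<noteq> 0}"
  define J where "J x = (\<chi> i. (- 1 / (ess x *v v$i)$3) *s ess_grad x (vector [a$i, b$i, F x $ i]) (v$i))" for x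
  have "open {x. (ess x *v v$i)$3 \<noteq> 0}" for i
    by (intro open_Collect_neq continuous_on_component continuous_on_ess_mult continuous_intros)
  then have "open (\<Inter>i. {x. (ess x *v v$i)$3 \<noteq> 0})" by (intro open_INT) auto
  then have W: "open W" unfolding W_def by (simp add: Collect_all_eq)
  have der: "(F has_derivative (*v) (J x)) (at x)" if "x \<in> W" for x
  proof (rule has_derivative_vecI)
    fix i
    have "((\<lambda>x. F x $ i) has_derivative
      (\<lambda>h. (- 1 / (ess x *v v$i)$3) * (ess_grad x (vector [a$i, b$i, F x $ i]) (v$i) \<bullet> h))) (at x)"
      unfolding F_def vec_lambda_beta by (rule has_derivative_epipolar_solve) (use that in \<open>simp add: W_def\<close>)
    also have "(\<lambda>h. (- 1 / (ess x *v v$i)$3) * (ess_grad x (vector [a$i, b$i, F x $ i]) (v$i) \<bullet> h))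
      = (\<lambda>h. (J x *v h) $ i)"
      by (simp add: J_def matrix_vector_mult_def inner_vec_def sum_distrib_left mult.assoc fun_eq_iff)
    finally show "((\<lambda>x. F x $ i) has_derivative (\<lambda>h. (J x *v h) $ i)) (at x)" .
  qed
  have cF: "continuous_on W F"
    using der by (meson continuous_at_imp_continuous_on has_derivative_continuous)
  have cv: "continuous_on W (\<lambda>x. vector [a$i, b$i, F x $ i] :: real^3)" for i
  proof -
    have "(\<lambda>x. vector [a$i, b$i, F x $ i] :: real^3)
        = (\<lambda>x. \<chi> j. if j = 1 then a$i else if j = 2 then b$i else F x $ i)"
      by (simp add: fun_eq_iff vec_eq_iff forall_3)
    moreover have "continuous_on W (\<lambda>x. if j = 1 then a$i else if j = 2 then b$i else F x $ i)" for j :: 3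
      by (cases "j = 1"; cases "j = 2") (simp_all add: continuous_on_component cF)
    then have "continuous_on W (\<lambda>x. \<chi> j::3. if j = 1 then a$i else if j = 2 then b$i else F x $ i)"
      by (rule continuous_on_vec_lambda)
    ultimately show ?thesis by (simp only:)
  qed
  have cJ: "continuous_on W J"
    unfolding J_def vector_scalar_mult_def
    by (intro continuous_intros continuous_on_ess_grad continuous_on_ess_mult cv) (auto simp: W_def)
  have S: "chart \<inter> W \<in> sets borel" using W by auto
  have "(\<integral>\<^sup>+c. emeasure (count_space UNIV) ((chart \<inter> W) \<inter> F -` {c}) * h c \<partial>lborel)
    = (\<integral>\<^sup>+x. indicator (chart \<inter> W) x * ennreal \<bar>det (J x)\<bar> * h (F x) \<partial>lborel)"
    by (rule area_formula[OF W der cJ S _ h]) auto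
  also have "(\<lambda>c. emeasure (count_space UNIV) ((chart \<inter> W) \<inter> F -` {c}))
    = (\<lambda>c. num_points {x\<in>{x\<in>chart. \<forall>i. (ess x *v v$i)$3 \<noteq> 0}.
            \<forall>i. vector [a$i, b$i, c$i] \<bullet> (ess x *v v$i) = 0})"
    unfolding num_points_def
    by (intro ext arg_cong[where f="emeasure (count_space UNIV)"])
      (auto simp: W_def F_def vec_eq_iff epipolar_solve_iff)
  also have "(\<integral>\<^sup>+x. indicator (chart \<inter> W) x * ennreal \<bar>det (J x)\<bar> * h (F x) \<partial>lborel)
    = (\<integral>\<^sup>+x. indicator {x\<in>chart. \<forall>i. (ess x *v v$i)$3 \<noteq> 0} x
         * ennreal (\<bar>det (\<chi> i. ess_grad x (vector [a$i, b$i, F x $ i]) (v$i))\<bar> / (\<Prod>i\<in>UNIV. \<bar>(ess x *v v$i)$3\<bar>))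
         * h (F x) \<partial>lborel)"
  proof (intro nn_integral_cong)
    fix x
    have "det (J x) = (\<Prod>i\<in>UNIV. - 1 / (ess x *v v$i)$3)
        * det (\<chi> i. ess_grad x (vector [a$i, b$i, F x $ i]) (v$i))"
      unfolding J_def by (rule det_rows_mul)
    then have "\<bar>det (J x)\<bar> = \<bar>det (\<chi> i. ess_grad x (vector [a$i, b$i, F x $ i]) (v$i))\<bar> / (\<Prod>i\<in>UNIV. \<bar>(ess x *v v$i)$3\<bar>)"
      by (simp add: abs_mult abs_prod prod_dividef)
    moreover have "chart \<inter> W = {x\<in>chart. \<forall>i. (ess x *v v$i)$3 \<noteq> 0}" by (auto simp: W_def)
    ultimately show "indicator (chart \<inter> W) x * ennreal \<bar>det (J x)\<bar> * h (F x)
      = indicator {x\<in>chart. \<forall>i. (ess x *v v$i)$3 \<noteq> 0} x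
         * ennreal (\<bar>det (\<chi> i. ess_grad x (vector [a$i, b$i, F x $ i]) (v$i))\<bar> / (\<Prod>i\<in>UNIV. \<bar>(ess x *v v$i)$3\<bar>))
         * h (F x)" by simp
  qed
  finally show ?thesis .
qed

section \<open>Degenerate configurations\<close>

type_synonym datum = "real \<times> (real \<times> real) \<times> (real^3)"

type_synonym partial_datum = "(real \<times> real) \<times> (real^3)"

text \<open>The twist turns the plane by x$5 + pi/2, so the equation makes the planar part of
  \<open>U\<close> parallel to that of \<open>V\<close> turned by x$5. With signed radii one angle
  \<theta> describes both parts.\<close>

lemma epipolar_polar:
  assumes "u \<bullet> (ess x *v v) = 0"
  obtains r s \<theta> where
    "frame (x$1) (x$2) *v u = vector [r * cos (\<theta> + x$5), r * sin (\<theta> + x$5), (frame (x$1) (x$2) *v u) $ 3]"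
    "frame (x$3) (x$4) *v v = vector [s * cos \<theta>, s * sin \<theta>, (frame (x$3) (x$4) *v v) $ 3]"
proof -
  define U V g where "U = frame (x$1) (x$2) *v u" and "V = frame (x$3) (x$4) *v v" and "g = x$5"
  have epi: "U$1 * (- sin g * V$1 - cos g * V$2) + U$2 * (cos g * V$1 - sin g * V$2) = 0"
    using assms unfolding inner_ess U_def V_def g_def by (simp add: inner_3 twist_mult)
  have polar: "\<exists>r t. p = r * cos t \<and> q = r * sin t \<and> (r = 0 \<longrightarrow> p = 0 \<and> q = 0)" for p q :: real
  proof -
    obtain r t where "p = r * cos t" "q = r * sin t" using polar_Ex by blast
    then show ?thesis by auto
  qed
  show thesis
  proof (cases "V$1 = 0 \<and> V$2 = 0")
    \<comment> \<open>If \<open>V\<close> has no planar part, the angle is dictated by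
      \<open>U\<close> and the radius \<open>s\<close> is 0.\<close>
    case True
    obtain r t where "U$1 = r * cos t" "U$2 = r * sin t" using polar by blast
    then show thesis using True
      by (intro that[of r "t - g" 0]) (auto simp: vec_eq_iff forall_3 g_def simp flip: U_def V_def)
  next
    case False
    obtain s t where st: "V$1 = s * cos t" "V$2 = s * sin t" "s \<noteq> 0" using polar[of "V$1" "V$2"] False by blast
    have "s * (U$2 * cos (t + g) - U$1 * sin (t + g)) = 0"
      using epi unfolding st by (simp add: cos_add sin_add algebra_simps)
    then have z: "U$2 * cos (t + g) - U$1 * sin (t + g) = 0" using st by simp
    define C S where "C = cos (t + g)" and "S = sin (t + g)"
    have cs: "C * C + S * S = 1" by (simp add: C_def S_def)
    have z: "U$2 * C = U$1 * S" using z by (simp add: C_def S_def)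
    \<comment> \<open>The radius of \<open>U\<close> is its component along the direction (C, S), to
      which \<open>z\<close> says it is parallel.\<close>
    have "(U$1 * C + U$2 * S) * C = U$1" "(U$1 * C + U$2 * S) * S = U$2" using cs z by algebra+
    then show thesis using st
      by (intro that[of "U$1 * C + U$2 * S" t s])
        (auto simp: vec_eq_iff forall_3 simp flip: U_def V_def g_def C_def S_def)
  qed
qed

text \<open>The coefficient of the unknown in polar form. It identifies the unsolvable
  configurations and is the denominator that cancels in
  \<open>nn_integral_solved_density\<close>.\<close>

lemma ess_mult_polar_3:
  assumes "frame (x$3) (x$4) *v v = vector [s * cos \<theta>, s * sin \<theta>, c]"
  shows "(ess x *v v) $ 3 = sin (x$2) * s * cos (\<theta> + x$5)"
  unfolding ess_mult transpose_frame_mult twist_mult assms by (simp add: cos_add algebra_simps)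

text \<open>The five coordinates of \<open>snd p $ i\<close> are the numbers \<open>a\<close>, \<open>b\<close>, \<open>r\<close>, \<open>s\<close>, \<open>\<theta>\<close> of the theorem,
  up to exchanging \<open>r\<close> and \<open>s\<close>. A datum lists the third coordinate of \<open>u\<close>, its first two coordinates,
  and \<open>v\<close>. Source and target both have dimension 30.\<close>

definition epipolar_data :: "(real^5) \<times> ((real^5)^5) \<Rightarrow> datum^5" where
  "epipolar_data p = (\<chi> i. let x = fst p; w = snd p $ i;
      u = transpose (frame (x$1) (x$2)) *v vector [w$3 * cos (w$5 + x$5), w$3 * sin (w$5 + x$5), w$2];
      v = transpose (frame (x$3) (x$4)) *v vector [w$4 * cos (w$5), w$4 * sin (w$5), w$1]
    in (u$3, (u$1, u$2), v))"

lemma differentiable_epipolar_data: "epipolar_data differentiable (at p within S)"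
proof -
  note vn = bounded_linear.has_derivative[OF bounded_linear_vec_nth]
  have D: "(\<lambda>p. f p) differentiable (at p within S)" if "\<exists>D. (f has_derivative D) (at p within S)" for f :: "_ \<Rightarrow> real"
    using that by (simp add: differentiable_def)
  have u: "(\<lambda>p. (transpose (frame (fst p $ 1) (fst p $ 2)) *v vector [snd p $ i $ 3 * cos (snd p $ i $ 5 + fst p $ 5),
      snd p $ i $ 3 * sin (snd p $ i $ 5 + fst p $ 5), snd p $ i $ 2]) $ k) differentiable (at p within S)" for i k
    using exhaust_3[of k]
    by (elim disjE; simp only: transpose_frame_mult vector_3) (rule D, intro exI, (rule derivative_intros vn)+)+
  have v: "(\<lambda>p. (transpose (frame (fst p $ 3) (fst p $ 4)) *v vector [snd p $ i $ 4 * cos (snd p $ i $ 5),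
      snd p $ i $ 4 * sin (snd p $ i $ 5), snd p $ i $ 1]) $ k) differentiable (at p within S)" for i k
    using exhaust_3[of k]
    by (elim disjE; simp only: transpose_frame_mult vector_3) (rule D, intro exI, (rule derivative_intros vn)+)+
  have "(\<lambda>p. epipolar_data p $ i \<bullet> b) differentiable (at p within S)" if "b \<in> Basis" for i b
    using that by (auto simp: epipolar_data_def Let_def Basis_prod_def Basis_vec_def inner_axis u v)
  then show ?thesis
    by (subst differentiable_componentwise_within) (auto simp: Basis_vec_def inner_axis)
qed

text \<open>Each condition confines a linear form in the parameters to a countable set of values.
  Together they cover the case that \<open>x\<close> is outside \<open>chart\<close> and, by
  \<open>ess_mult_polar_3\<close>, the case that some coefficient of an unknown vanishes.\<close>

definition degenerate_params :: "((real^5) \<times> ((real^5)^5)) set" where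
  "degenerate_params = {p. sin (fst p $ 2) = 0 \<or> sin (fst p $ 4) = 0 \<or>
     (\<exists>i. snd p $ i $ 4 = 0 \<or> cos (snd p $ i $ 5 + fst p $ 5) = 0)}"

lemma negligible_hyperplanes:
  assumes "a \<noteq> 0" "countable C"
  shows "negligible {p::'a::euclidean_space. a \<bullet> p \<in> C}"
proof -
  have "{p. a \<bullet> p \<in> C} = (\<Union>c\<in>C. {p. a \<bullet> p = c})" by auto
  moreover have "negligible \<dots>"
    using assms by (intro negligible_countable_Union) (auto intro: negligible_hyperplane)
  ultimately show ?thesis by simp
qed

lemma negligible_degenerate_params: "negligible degenerate_params"
proof -
  have s: "{t. sin t = 0} = range (\<lambda>n::int. n * pi)" by (auto simp: sin_zero_iff_int2)
  have c: "{t. cos t = 0} = range (\<lambda>n::int. n * pi + pi/2)" by (auto simp: cos_zero_iff_int2)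
  have cs: "countable {t::real. sin t = 0}" "countable {t::real. cos t = 0}" unfolding s c by auto
  have "degenerate_params = {p. (axis 2 1, 0) \<bullet> p \<in> {t. sin t = 0}} \<union> {p. (axis 4 1, 0) \<bullet> p \<in> {t. sin t = 0}}
     \<union> (\<Union>i. {p. (0, axis i (axis 4 1)) \<bullet> p \<in> {0}})
     \<union> (\<Union>i. {p. (axis 5 1, axis i (axis 5 1)) \<bullet> p \<in> {t. cos t = 0}})"
    by (auto simp: degenerate_params_def inner_prod_def inner_axis' add.commute)
  moreover have "negligible \<dots>"
    by (intro negligible_Un negligible_Union negligible_hyperplanes cs)
      (auto simp: zero_prod_def axis_eq_0_iff intro!: negligible_hyperplane negligible_hyperplanes cs simp del: mem_Collect_eq)
  ultimately show ?thesis by simp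
qed

definition data_u :: "datum \<Rightarrow> real^3" where
  "data_u q = vector [fst (fst (snd q)), snd (fst (snd q)), fst q]"

definition data_v :: "datum \<Rightarrow> real^3" where
  "data_v q = snd (snd q)"

text \<open>One bad solution \<open>x\<close> suffices. This is a union over a continuum of
  \<open>x\<close>, so null sets for fixed \<open>x\<close> would prove nothing; the solution is
  made part of the parameters instead.\<close>

definition degenerate_data :: "(datum^5) set" where
  "degenerate_data = {y. \<exists>x\<in>chart_closed. (\<forall>i. data_u (y$i) \<bullet> (ess x *v data_v (y$i)) = 0) \<and>
     \<not> (x \<in> chart \<and> (\<forall>i. (ess x *v data_v (y$i)) $ 3 \<noteq> 0))}"

lemma degenerate_data_subset: "degenerate_data \<subseteq> epipolar_data ` degenerate_params"
proof
  fix y assume "y \<in> degenerate_data"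
  then obtain x where x: "x \<in> chart_closed" "\<And>i. data_u (y$i) \<bullet> (ess x *v data_v (y$i)) = 0"
    "\<not> (x \<in> chart \<and> (\<forall>i. (ess x *v data_v (y$i)) $ 3 \<noteq> 0))"
    unfolding degenerate_data_def by blast
  define U V where "U i = frame (x$1) (x$2) *v data_u (y$i)" and "V i = frame (x$3) (x$4) *v data_v (y$i)" for i
  have "\<exists>r s \<theta>. U i = vector [r * cos (\<theta> + x$5), r * sin (\<theta> + x$5), U i $ 3] \<and>
      V i = vector [s * cos \<theta>, s * sin \<theta>, V i $ 3]" for i
    unfolding U_def V_def by (rule epipolar_polar[OF x(2)[of i]]) blast
  then obtain r s \<theta> where rs: "\<And>i. U i = vector [r i * cos (\<theta> i + x$5), r i * sin (\<theta> i + x$5), U i $ 3]"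
      "\<And>i. V i = vector [s i * cos (\<theta> i), s i * sin (\<theta> i), V i $ 3]" by metis
  define w :: "(real^5)^5" where "w = (\<chi> i. vector [V i $ 3, U i $ 3, r i, s i, \<theta> i])"
  have w: "w$i$1 = V i $ 3" "w$i$2 = U i $ 3" "w$i$3 = r i" "w$i$4 = s i" "w$i$5 = \<theta> i" for i
    unfolding w_def by (simp_all add: vector_5)
  have "epipolar_data (x, w) $ i = y $ i" for i
  proof -
    have "transpose (frame (x$1) (x$2)) *v U i = data_u (y$i)" "transpose (frame (x$3) (x$4)) *v V i = data_v (y$i)"
      by (simp_all add: U_def V_def transpose_mult_frame)
    then show ?thesis
      by (simp add: epipolar_data_def Let_def w flip: rs) (simp add: data_u_def data_v_def)
  qed
  then have y: "y = epipolar_data (x, w)" by (simp add: vec_eq_iff)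
  have n: "(ess x *v data_v (y$i)) $ 3 = sin (x$2) * s i * cos (\<theta> i + x$5)" for i
    by (rule ess_mult_polar_3[of x "data_v (y$i)" _ _ "V i $ 3"]) (use rs(2)[of i] in \<open>simp add: V_def\<close>)
  have "(x, w) \<in> degenerate_params"
    using x(1,3) unfolding n by (auto simp: degenerate_params_def chart_def w)
  then show "y \<in> epipolar_data ` degenerate_params" using y by blast
qed

lemma negligible_degenerate_data: "negligible degenerate_data"
proof -
  have "negligible (epipolar_data ` degenerate_params)"
    by (rule negligible_differentiable_image_negligible[OF _ negligible_degenerate_params])
      (auto simp: differentiable_on_def differentiable_epipolar_data)
  then show ?thesis using degenerate_data_subset negligible_subset by blast
qed

section \<open>The solutions of one epipolar equation\<close>

lemma nn_integral_lborel_prod: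
  fixes f :: "'a::euclidean_space \<times> 'b::euclidean_space \<Rightarrow> ennreal"
  assumes "f \<in> borel_measurable borel"
  shows "(\<integral>\<^sup>+p. f p \<partial>lborel) = (\<integral>\<^sup>+x. \<integral>\<^sup>+y. f (x, y) \<partial>lborel \<partial>lborel)"
    and "(\<integral>\<^sup>+p. f p \<partial>lborel) = (\<integral>\<^sup>+y. \<integral>\<^sup>+x. f (x, y) \<partial>lborel \<partial>lborel)"
proof -
  have m: "f \<in> borel_measurable (lborel \<Otimes>\<^sub>M lborel)"
    using assms by (simp add: lborel_prod)
  show "(\<integral>\<^sup>+p. f p \<partial>lborel) = (\<integral>\<^sup>+x. \<integral>\<^sup>+y. f (x, y) \<partial>lborel \<partial>lborel)"
    using lborel.nn_integral_fst[OF m] by (simp add: lborel_prod)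
  show "(\<integral>\<^sup>+p. f p \<partial>lborel) = (\<integral>\<^sup>+y. \<integral>\<^sup>+x. f (x, y) \<partial>lborel \<partial>lborel)"
    using lborel_pair.nn_integral_snd[OF m] by (simp add: lborel_prod)
qed

lemma nn_integral_lborel_linear:
  fixes A :: "real^'n::{finite,wellorder}^'n::_" and h :: "real^'n::_ \<Rightarrow> ennreal"
  assumes d: "det A \<noteq> 0" and h: "h \<in> borel_measurable borel"
  shows "(\<integral>\<^sup>+y. h y \<partial>lborel) = (\<integral>\<^sup>+x. ennreal \<bar>det A\<bar> * h (A *v x) \<partial>lborel)"
proof -
  obtain B where B: "A ** B = mat 1" "B ** A = mat 1"
    using d invertible_det_nz[of A] unfolding invertible_def by blast
  have "UNIV \<inter> (*v) A -` {y} = {B *v y}" for y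
  proof -
    have "A *v x = y \<longleftrightarrow> x = B *v y" for x
      using B by (metis matrix_vector_mul_assoc matrix_vector_mul_lid)
    then show ?thesis by auto
  qed
  moreover have "(\<integral>\<^sup>+y. emeasure (count_space UNIV) (UNIV \<inter> (*v) A -` {y}) * h y \<partial>lborel)
    = (\<integral>\<^sup>+x. indicator UNIV x * ennreal \<bar>det A\<bar> * h (A *v x) \<partial>lborel)"
    by (rule area_formula[where W=UNIV and J="\<lambda>_. A"])
      (auto intro!: bounded_linear.has_derivative[OF matrix_vector_mul_bounded_linear, OF has_derivative_ident] h)
  ultimately show ?thesis by (simp add: emeasure_count_space)
qed

lemma nn_integral_lborel_orthogonal:
  fixes Q :: "real^'n::{finite,wellorder}^'n::_" and h :: "real^'n::_ \<Rightarrow> ennreal"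
  assumes "orthogonal_matrix Q" "h \<in> borel_measurable borel"
  shows "(\<integral>\<^sup>+x. h (Q *v x) \<partial>lborel) = (\<integral>\<^sup>+x. h x \<partial>lborel)"
proof -
  have d: "\<bar>det Q\<bar> = 1" using det_orthogonal_matrix[OF assms(1)] by auto
  then have "det Q \<noteq> 0" by auto
  from nn_integral_lborel_linear[OF this assms(2)] show ?thesis by (simp add: d)
qed

lemma nn_integral_lborel_vector_3:
  fixes h :: "real^3 \<Rightarrow> ennreal"
  assumes h: "h \<in> borel_measurable borel"
  shows "(\<integral>\<^sup>+v. h v \<partial>lborel) = (\<integral>\<^sup>+p. \<integral>\<^sup>+z. h (vector [fst p, snd p, z]) \<partial>lborel \<partial>lborel)"
proof -
  define T where "T q = (vector [fst (fst q), snd (fst q), snd q] :: real^3)" for q :: "(real \<times> real) \<times> real"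
  have T: "T = (\<lambda>((x, y), z). vector [x, y, z])" by (simp add: fun_eq_iff T_def)
  have m: "T \<in> borel_measurable borel"
    unfolding T_def by (intro measurable_vector_3 borel_measurable_continuous_onI continuous_intros)
  have "(\<integral>\<^sup>+v. h v \<partial>lborel) = (\<integral>\<^sup>+q. h (T q) \<partial>lborel)"
    by (subst lborel_vector_3[folded T], subst nn_integral_distr) (use m h in simp_all)
  also have "\<dots> = (\<integral>\<^sup>+p. \<integral>\<^sup>+z. h (T (p, z)) \<partial>lborel \<partial>lborel)"
    by (rule nn_integral_lborel_prod(1)) (rule measurable_compose[OF m h])
  finally show ?thesis by (simp add: T_def)
qed

lemma nn_integral_lborel_vector_2:
  fixes h :: "real^2 \<Rightarrow> ennreal"
  assumes h: "h \<in> borel_measurable borel"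
  shows "(\<integral>\<^sup>+v. h v \<partial>lborel) = (\<integral>\<^sup>+x. \<integral>\<^sup>+y. h (vector [x, y]) \<partial>lborel \<partial>lborel)"
proof -
  have m: "(\<lambda>(x, y). vector [x, y] :: real^2) \<in> borel_measurable borel"
    unfolding case_prod_beta'
    by (intro measurable_vector_2 borel_measurable_continuous_onI continuous_intros)
  have "(\<integral>\<^sup>+v. h v \<partial>lborel) = (\<integral>\<^sup>+q. h (case q of (x, y) \<Rightarrow> vector [x, y]) \<partial>lborel)"
    by (subst lborel_vector_2, subst nn_integral_distr) (use m h in \<open>simp_all add: case_prod_beta'\<close>)
  also have "\<dots> = (\<integral>\<^sup>+x. \<integral>\<^sup>+y. h (case (x, y) of (x, y) \<Rightarrow> vector [x, y]) \<partial>lborel \<partial>lborel)"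
    by (rule nn_integral_lborel_prod(1)) (rule measurable_compose[OF m h])
  finally show ?thesis by simp
qed

lemma nn_integral_lborel_pair_eq_vec_2:
  fixes f :: "real \<times> real \<Rightarrow> ennreal"
  assumes f: "f \<in> borel_measurable borel"
  shows "(\<integral>\<^sup>+p. f p \<partial>lborel) = (\<integral>\<^sup>+v. f (v$1, v$2) \<partial>(lborel :: (real^2) measure))"
proof -
  have "(\<lambda>v::real^2. (v$1, v$2)) \<in> borel_measurable borel"
    by (intro borel_measurable_continuous_onI continuous_intros)
  from nn_integral_lborel_vector_2[OF measurable_compose[OF this f]] nn_integral_lborel_prod(1)[OF f]
  show ?thesis by simp
qed

lemma nn_integral_lborel_linear_pair:
  fixes f :: "real \<times> real \<Rightarrow> ennreal"
  assumes f: "f \<in> borel_measurable borel" and d: "m11 * m22 - m12 * m21 = d" "d \<noteq> 0"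
  shows "(\<integral>\<^sup>+p. f p \<partial>lborel) = (\<integral>\<^sup>+x. \<integral>\<^sup>+y. ennreal \<bar>d\<bar> * f (m11 * x + m12 * y, m21 * x + m22 * y) \<partial>lborel \<partial>lborel)"
proof -
  define A :: "real^2^2" where "A = vector [vector [m11, m12], vector [m21, m22]]"
  have det: "det A = d" using d by (simp add: A_def det_2)
  have A: "(A *v v)$1 = m11 * v$1 + m12 * v$2" "(A *v v)$2 = m21 * v$1 + m22 * v$2" for v
    by (simp_all add: A_def matrix_vector_mult_def sum_2)
  have c: "(\<lambda>v::real^2. (v$1, v$2)) \<in> borel_measurable borel"
    by (intro borel_measurable_continuous_onI continuous_intros)
  note m = measurable_compose[OF c f]
  have m2: "(\<lambda>v::real^2. f ((A *v v)$1, (A *v v)$2)) \<in> borel_measurable borel"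
    unfolding A by (rule measurable_compose[OF _ f]) (intro borel_measurable_continuous_onI continuous_intros)
  have "(\<integral>\<^sup>+p. f p \<partial>lborel) = (\<integral>\<^sup>+v. ennreal \<bar>d\<bar> * f ((A *v v)$1, (A *v v)$2) \<partial>lborel)"
    unfolding nn_integral_lborel_pair_eq_vec_2[OF f]
    using nn_integral_lborel_linear[OF _ m, of A] d det by simp
  also have "\<dots> = (\<integral>\<^sup>+x. \<integral>\<^sup>+y. ennreal \<bar>d\<bar> * f (m11 * x + m12 * y, m21 * x + m22 * y) \<partial>lborel \<partial>lborel)"
    by (subst nn_integral_lborel_vector_2) (use m2 in \<open>auto simp: A\<close>)
  finally show ?thesis .
qed

section \<open>Polar coordinates with a signed radius\<close>

lemma half_polar_unique:
  assumes "s * cos t = s' * cos t'" "s * sin t = s' * sin t'" "s \<noteq> 0"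
    "0 \<le> t" "t < pi" "0 \<le> t'" "t' < pi"
  shows "s = s' \<and> t = t'"
proof -
  have sq: "s\<^sup>2 = s'\<^sup>2"
  proof -
    have "s\<^sup>2 = (s * cos t)\<^sup>2 + (s * sin t)\<^sup>2"
      by (simp add: power_mult_distrib flip: distrib_left)
    also have "\<dots> = s'\<^sup>2" unfolding assms(1,2) by (simp add: power_mult_distrib flip: distrib_left)
    finally show ?thesis .
  qed
  have "s' = s"
  proof (rule ccontr)
    \<comment> \<open>Opposite radii would need angles differing by pi, impossible within [0, pi)
      since both sines are nonnegative.\<close>
    assume "s' \<noteq> s"
    then have s': "s' = - s" using sq by (simp add: power2_eq_iff)
    then have "s * (cos t + cos t') = 0" "s * (sin t + sin t') = 0"
      using assms(1,2) by (simp_all add: distrib_left)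
    then have neg: "cos t = - cos t'" "sin t = - sin t'" using assms(3) by auto
    have "sin t \<ge> 0" "sin t' \<ge> 0" using assms by (auto intro!: sin_ge_zero)
    then have "sin t = 0" "sin t' = 0" using neg by linarith+
    then have "t = 0" "t' = 0" using sin_gt_zero[of t] sin_gt_zero[of t'] assms by linarith+
    then show False using neg by simp
  qed
  then have "cos t = cos t'" using assms by auto
  then show ?thesis using \<open>s' = s\<close> cos_inj_pi[of t t'] assms by simp
qed

lemma half_polar_exists:
  fixes p q :: real
  obtains s t where "p = s * cos t" "q = s * sin t" "0 \<le> t" "t < pi"
proof (cases "p = 0 \<and> q = 0")
  case True
  then show thesis using that[of 0 0] by simp
next
  case False
  define n where "n = sqrt (p\<^sup>2 + q\<^sup>2)"
  have "p\<^sup>2 + q\<^sup>2 > 0" using False unfolding sum_power2_gt_zero_iff by blast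
  then have n: "n > 0" unfolding n_def by (rule real_sqrt_gt_zero)
  have "(p / n)\<^sup>2 + (q / n)\<^sup>2 = 1"
  proof -
    have "(p / n)\<^sup>2 + (q / n)\<^sup>2 = (p\<^sup>2 + q\<^sup>2) / n\<^sup>2" by (simp only: power_divide add_divide_distrib)
    also have "p\<^sup>2 + q\<^sup>2 = n\<^sup>2" by (simp add: n_def)
    finally show ?thesis using n by simp
  qed
  then obtain t where t: "0 \<le> t" "t < 2 * pi" "p / n = cos t" "q / n = sin t"
    using sincos_total_2pi by metis
  then have pq: "p = n * cos t" "q = n * sin t" using n by (auto simp: field_simps)
  show thesis
  proof (cases "t < pi")
    case True then show thesis using that[of n t] pq t by simp
  next
    case False
    then show thesis using that[of "- n" "t - pi"] pq t by (simp add: cos_diff sin_diff)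
  qed
qed

text \<open>The radius takes both signs and the angle covers half of the circle. In this form the
  radii of Gaussian vectors lead to normal densities on the whole line, like \<open>r\<close> and
  \<open>s\<close> of the theorem.\<close>

lemma nn_integral_half_polar:
  fixes f :: "real \<times> real \<Rightarrow> ennreal"
  assumes f: "f \<in> borel_measurable borel"
  shows "(\<integral>\<^sup>+p. f p \<partial>lborel)
    = (\<integral>\<^sup>+s. \<integral>\<^sup>+t. indicator {0..<pi} t * ennreal \<bar>s\<bar> * f (s * cos t, s * sin t) \<partial>lborel \<partial>lborel)"
proof -
  define F :: "real^2 \<Rightarrow> real^2" where "F x = vector [x$1 * cos (x$2), x$1 * sin (x$2)]" for x
  define J :: "real^2 \<Rightarrow> real^2^2" where
    "J x = vector [vector [cos (x$2), - x$1 * sin (x$2)], vector [sin (x$2), x$1 * cos (x$2)]]" for x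
  define S :: "(real^2) set" where "S = {x. x$2 \<in> {0..<pi}}"
  have det: "det (J x) = x$1" for x
  proof -
    have "x$1 * (cos (x$2) * cos (x$2)) + x$1 * (sin (x$2) * sin (x$2)) = x$1"
      by (simp flip: distrib_left)
    then show ?thesis by (simp add: J_def det_2 mult_ac)
  qed
  have der: "(F has_derivative (*v) (J x)) (at x)" for x
  proof (rule has_derivative_vecI)
    fix i :: 2
    note [derivative_intros] = has_derivative_vec_nth
    show "((\<lambda>x. F x $ i) has_derivative (\<lambda>h. (J x *v h) $ i)) (at x)"
      using exhaust_2[of i] unfolding F_def J_def
      by (elim disjE; simp add: matrix_vector_mult_def sum_2) (auto intro!: derivative_eq_intros simp: algebra_simps)
  qed
  have cJ: "continuous_on UNIV J"
  proof -
    have "continuous_on UNIV (\<lambda>x. J x $ i $ j)" for i j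
      using exhaust_2[of i] exhaust_2[of j]
      by (elim disjE; simp add: J_def) (intro continuous_intros)+
    then have "continuous_on UNIV (\<lambda>x. \<chi> i j. J x $ i $ j)" by (intro continuous_on_vec_lambda)
    then show ?thesis by simp
  qed
  have S: "S \<in> sets borel"
  proof -
    have "(\<lambda>x::real^2. x$2) -` {0..<pi} \<inter> space borel \<in> sets borel"
      by (rule measurable_sets[where A=borel]) (auto intro!: borel_measurable_continuous_onI continuous_intros)
    then show ?thesis by (simp add: S_def vimage_def)
  qed
  have c: "(\<lambda>v::real^2. (v$1, v$2)) \<in> borel_measurable borel"
    by (intro borel_measurable_continuous_onI continuous_intros)
  note m = measurable_compose[OF c f]
  have FS: "emeasure (count_space UNIV) (S \<inter> F -` {y}) = 1" if "y \<noteq> 0" for y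
  proof -
    obtain s t where st: "y$1 = s * cos t" "y$2 = s * sin t" "0 \<le> t" "t < pi" using half_polar_exists .
    have s: "s \<noteq> 0" using that st by (auto simp: vec_eq_iff forall_2)
    have "S \<inter> F -` {y} = {vector [s, t]}"
    proof
      show "{vector [s, t]} \<subseteq> S \<inter> F -` {y}" using st by (auto simp: S_def F_def vec_eq_iff forall_2)
      show "S \<inter> F -` {y} \<subseteq> {vector [s, t]}"
      proof
        fix x assume "x \<in> S \<inter> F -` {y}"
        then have "s * cos t = x$1 * cos (x$2)" "s * sin t = x$1 * sin (x$2)" "0 \<le> x$2" "x$2 < pi"
          using st by (auto simp: S_def F_def)
        then have "s = x$1 \<and> t = x$2" using s st by (intro half_polar_unique)
        then show "x \<in> {vector [s, t]}" by (simp add: vec_eq_iff forall_2)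
      qed
    qed
    then show ?thesis by (simp add: emeasure_count_space)
  qed
  have "(\<integral>\<^sup>+p. f p \<partial>lborel) = (\<integral>\<^sup>+y. f (y$1, y$2) \<partial>(lborel :: (real^2) measure))"
    by (rule nn_integral_lborel_pair_eq_vec_2[OF f])
  \<comment> \<open>Every point except the origin has exactly one preimage, and a single point is
    negligible.\<close>
  also have "\<dots> = (\<integral>\<^sup>+y. emeasure (count_space UNIV) (S \<inter> F -` {y}) * f (y$1, y$2) \<partial>lborel)"
    using AE_lborel_singleton[of "0::real^2"] by (intro nn_integral_cong_AE) (auto simp: FS elim!: eventually_mono)
  also have "\<dots> = (\<integral>\<^sup>+x. indicator S x * ennreal \<bar>det (J x)\<bar> * f (F x $ 1, F x $ 2) \<partial>lborel)"
    by (rule area_formula[where W=UNIV, OF _ der cJ S _ m]) auto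
  also have "\<dots> = (\<integral>\<^sup>+s. \<integral>\<^sup>+t. indicator {0..<pi} t * ennreal \<bar>s\<bar> * f (s * cos t, s * sin t) \<partial>lborel \<partial>lborel)"
  proof (subst nn_integral_lborel_vector_2)
    have "(\<lambda>x::real^2. (x$1 * cos (x$2), x$1 * sin (x$2))) \<in> borel_measurable borel"
      by (intro borel_measurable_continuous_onI continuous_intros)
    from measurable_compose[OF this f] S
    show "(\<lambda>x. indicator S x * ennreal \<bar>det (J x)\<bar> * f (F x $ 1, F x $ 2)) \<in> borel_measurable borel"
      unfolding det by (simp add: F_def)
    show "(\<integral>\<^sup>+x. \<integral>\<^sup>+y. indicator S (vector [x, y]) * ennreal \<bar>det (J (vector [x, y]))\<bar> *
         f (F (vector [x, y]) $ 1, F (vector [x, y]) $ 2) \<partial>lborel \<partial>lborel)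
      = (\<integral>\<^sup>+s. \<integral>\<^sup>+t. indicator {0..<pi} t * ennreal \<bar>s\<bar> * f (s * cos t, s * sin t) \<partial>lborel \<partial>lborel)"
      unfolding det by (simp add: F_def S_def indicator_def)
  qed
  finally show ?thesis .
qed

lemma measurable_ess_mult[measurable (raw)]:
  assumes "f \<in> borel_measurable M" "g \<in> borel_measurable M"
  shows "(\<lambda>t. ess (f t) *v g t) \<in> borel_measurable M"
proof -
  have "(\<lambda>p. ess (fst p) *v snd p) \<in> borel_measurable borel"
    by (intro borel_measurable_continuous_onI continuous_on_ess_mult continuous_intros)
  from measurable_compose[OF borel_measurable_Pair[OF assms] this] show ?thesis by simp
qed

lemma measurable_ess_grad[measurable (raw)]:
  assumes "f \<in> borel_measurable M" "g \<in> borel_measurable M" "h \<in> borel_measurable M"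
  shows "(\<lambda>t. ess_grad (f t) (g t) (h t)) \<in> borel_measurable M"
proof -
  have "(\<lambda>p. ess_grad (fst p) (fst (snd p)) (snd (snd p))) \<in> borel_measurable borel"
    by (intro borel_measurable_continuous_onI continuous_on_ess_grad continuous_intros)
  from measurable_compose[OF borel_measurable_Pair[OF assms(1) borel_measurable_Pair[OF assms(2,3)]] this]
  show ?thesis by simp
qed

lemma measurable_epipolar_solve[measurable (raw)]:
  assumes [measurable]: "x \<in> borel_measurable M" "a \<in> borel_measurable M" "b \<in> borel_measurable M" "v \<in> borel_measurable M"
  shows "(\<lambda>t. epipolar_solve (x t) (a t) (b t) (v t)) \<in> borel_measurable M"
  unfolding epipolar_solve_def by measurable

definition gauss3 :: "real^3 \<Rightarrow> real" where
  "gauss3 w = std_normal_density (w$1) * std_normal_density (w$2) * std_normal_density (w$3)"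

lemma measurable_gauss3[measurable]: "gauss3 \<in> borel_measurable borel"
  unfolding gauss3_def by measurable

lemma gauss3_nonneg: "0 \<le> gauss3 w"
  by (simp add: gauss3_def)

lemma gauss3_eq: "gauss3 w = (1 / sqrt (2 * pi)) ^ 3 * exp (- (w \<bullet> w) / 2)"
proof -
  have "std_normal_density x = 1 / sqrt (2 * pi) * exp (- (x * x) / 2)" for x
    by (simp add: std_normal_density_def power2_eq_square)
  then have "gauss3 w = (1 / sqrt (2 * pi)) ^ 3 * (exp (- (w$1 * w$1) / 2) * exp (- (w$2 * w$2) / 2) * exp (- (w$3 * w$3) / 2))"
    by (simp add: gauss3_def power3_eq_cube)
  also have "exp (- (w$1 * w$1) / 2) * exp (- (w$2 * w$2) / 2) * exp (- (w$3 * w$3) / 2) = exp (- (w \<bullet> w) / 2)"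
    by (simp add: inner_3 field_simps flip: exp_add)
  finally show ?thesis .
qed

lemma gauss3_transpose_frame: "gauss3 (transpose (frame a b) *v w) = gauss3 w"
  by (simp add: gauss3_eq inner_transpose_frame)

text \<open>Two planar normal densities give one normal density in the radius and a spare factor 1 /
  sqrt (2 pi). The spare factors of \<open>u\<close> and \<open>v\<close> multiply to the density 1
  / (2 pi) of a uniform angle.\<close>

lemma gauss3_polar: "gauss3 (vector [r * cos t, r * sin t, c])
    = std_normal_density r * std_normal_density c / sqrt (2 * pi)"
proof -
  have e: "r * cos t * (r * cos t) + r * sin t * (r * sin t) = r * r"
  proof -
    have "r * cos t * (r * cos t) + r * sin t * (r * sin t) = r * r * (cos t * cos t + sin t * sin t)"
      by (simp add: algebra_simps del: sin_cos_squared_add sin_cos_squared_add2 sin_cos_squared_add3)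
    then show ?thesis by simp
  qed
  have "gauss3 (vector [r * cos t, r * sin t, c]) = (1 / sqrt (2 * pi)) ^ 3 * exp (- (r * r + c * c) / 2)"
    unfolding gauss3_eq inner_3 vector_3 e ..
  also have "exp (- (r * r + c * c) / 2) = exp (- (r * r) / 2) * exp (- (c * c) / 2)"
    by (simp add: field_simps flip: exp_add)
  finally show ?thesis
    by (simp add: std_normal_density_def power3_eq_cube power2_eq_square)
qed

lemma borel_measurable_borel_lborel:
  "borel_measurable ((borel :: 'a::euclidean_space measure) \<Otimes>\<^sub>M (lborel :: 'b::euclidean_space measure))
    = borel_measurable borel"
  by (rule measurable_cong_sets) (simp_all add: borel_prod[symmetric] cong: sets_pair_measure_cong)

lemma measurable_nn_integral_lborel:
  fixes f :: "'a::euclidean_space \<times> 'b::euclidean_space \<Rightarrow> ennreal"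
  assumes "f \<in> borel_measurable borel"
  shows "(\<lambda>x. \<integral>\<^sup>+y. f (x, y) \<partial>lborel) \<in> borel_measurable borel"
    and "(\<lambda>y. \<integral>\<^sup>+x. f (x, y) \<partial>lborel) \<in> borel_measurable borel"
    and "(\<lambda>y. f (x, y)) \<in> borel_measurable borel"
    and "(\<lambda>x. f (x, y)) \<in> borel_measurable borel"
proof -
  have m: "f \<in> borel_measurable (borel \<Otimes>\<^sub>M lborel)"
    using assms by (simp add: borel_measurable_borel_lborel)
  then show "(\<lambda>x. \<integral>\<^sup>+y. f (x, y) \<partial>lborel) \<in> borel_measurable borel"
    by (rule lborel.borel_measurable_nn_integral_fst)
  have "(\<lambda>p::'b \<times> 'a. (snd p, fst p)) \<in> borel_measurable borel"
    by (intro borel_measurable_continuous_onI continuous_intros)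
  from measurable_compose[OF this assms]
  have "(\<lambda>p. f (snd p, fst p)) \<in> borel_measurable (borel \<Otimes>\<^sub>M lborel)"
    by (simp add: borel_measurable_borel_lborel)
  from lborel.borel_measurable_nn_integral_fst[OF this]
  show "(\<lambda>y. \<integral>\<^sup>+x. f (x, y) \<partial>lborel) \<in> borel_measurable borel" by simp
  show "(\<lambda>y. f (x, y)) \<in> borel_measurable borel"
    by (rule measurable_compose[OF _ assms]) simp
  show "(\<lambda>x. f (x, y)) \<in> borel_measurable borel"
    by (rule measurable_compose[OF _ assms]) simp
qed

lemma nn_integral_lborel_prod_cmult:
  fixes f :: "'a::euclidean_space \<times> 'b::euclidean_space \<Rightarrow> ennreal"
  assumes f: "f \<in> borel_measurable borel"
  shows "c * (\<integral>\<^sup>+x. \<integral>\<^sup>+y. f (x, y) \<partial>lborel \<partial>lborel) = (\<integral>\<^sup>+x. \<integral>\<^sup>+y. c * f (x, y) \<partial>lborel \<partial>lborel)"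
  using measurable_nn_integral_lborel[OF f]
  by (subst nn_integral_cmult[symmetric]) (simp_all add: nn_integral_cmult)

text \<open>The Gaussian density of \<open>u\<close> and \<open>v\<close> at the solution of the equation, divided by the derivative of
  the equation with respect to the third coordinate of \<open>u\<close>.\<close>

definition solved_density :: "real^5 \<Rightarrow> partial_datum \<Rightarrow> real" where
  "solved_density x p = (if (ess x *v snd p) $ 3 = 0 then 0
     else gauss3 (vector [fst (fst p), snd (fst p), epipolar_solve x (fst (fst p)) (snd (fst p)) (snd p)])
       * gauss3 (snd p) / \<bar>(ess x *v snd p) $ 3\<bar>)"

definition solved_point :: "real^5 \<Rightarrow> partial_datum \<Rightarrow> real^3" where
  "solved_point x p = vector [fst (fst p), snd (fst p), epipolar_solve x (fst (fst p)) (snd (fst p)) (snd p)]"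

lemma measurable_solved_density[measurable (raw)]:
  assumes [measurable]: "x \<in> borel_measurable M" "p \<in> borel_measurable M"
  shows "(\<lambda>t. solved_density (x t) (p t)) \<in> borel_measurable M"
proof -
  have [measurable]: "(\<lambda>t. snd (p t)) \<in> borel_measurable M" "(\<lambda>t. fst (fst (p t))) \<in> borel_measurable M"
     "(\<lambda>t. snd (fst (p t))) \<in> borel_measurable M"
    by (rule measurable_compose[OF assms(2)], intro borel_measurable_continuous_onI continuous_intros)+
  show ?thesis unfolding solved_density_def by measurable
qed

lemma measurable_solved_point[measurable (raw)]:
  assumes [measurable]: "x \<in> borel_measurable M" "p \<in> borel_measurable M"
  shows "(\<lambda>t. solved_point (x t) (p t)) \<in> borel_measurable M"
proof -
  have [measurable]: "(\<lambda>t. snd (p t)) \<in> borel_measurable M" "(\<lambda>t. fst (fst (p t))) \<in> borel_measurable M"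
     "(\<lambda>t. snd (fst (p t))) \<in> borel_measurable M"
    by (rule measurable_compose[OF assms(2)], intro borel_measurable_continuous_onI continuous_intros)+
  show ?thesis unfolding solved_point_def by measurable
qed

text \<open>\<open>v\<close> is expressed in the frame adapted to its pole and then in signed polar
  coordinates. For fixed \<open>v\<close> the solutions \<open>u\<close> form a plane, spanned by
  the first pole and the horizontal direction of its frame that is parallel to the turned
  \<open>v\<close>; (r, b) are the coordinates on it.\<close>

lemma nn_integral_solved_density:
  fixes G :: "(real^3) \<times> (real^3) \<Rightarrow> ennreal"
  assumes x: "sin (x$2) \<noteq> 0" and G: "G \<in> borel_measurable borel"
  shows "(\<integral>\<^sup>+p. ennreal (solved_density x p) * G (solved_point x p, snd p) \<partial>lborel)
    = (\<integral>\<^sup>+s. \<integral>\<^sup>+t. \<integral>\<^sup>+a. \<integral>\<^sup>+r. \<integral>\<^sup>+b. indicator {0..<pi} t *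
        ennreal (std_normal_density s * std_normal_density a * std_normal_density r * std_normal_density b / (2 * pi)) *
        G (transpose (frame (x$1) (x$2)) *v vector [r * cos (t + x$5), r * sin (t + x$5), b],
           transpose (frame (x$3) (x$4)) *v vector [s * cos t, s * sin t, a])
        \<partial>lborel \<partial>lborel \<partial>lborel \<partial>lborel \<partial>lborel)"
proof -
  define A B where "A = transpose (frame (x$1) (x$2))" and "B = transpose (frame (x$3) (x$4))"
  define \<Psi> where "\<Psi> p = ennreal (solved_density x p) * G (solved_point x p, snd p)" for p
  have id[measurable]: "(\<lambda>p::partial_datum. p) \<in> borel_measurable borel" by simp
  have snd: "(\<lambda>p::partial_datum. snd p) \<in> borel_measurable borel"
    by (intro borel_measurable_continuous_onI continuous_intros)
  have m\<Psi>: "\<Psi> \<in> borel_measurable borel"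
    unfolding \<Psi>_def
    by (intro borel_measurable_times_ennreal measurable_compose[OF _ measurable_ennreal] measurable_solved_density
        measurable_compose[OF _ G] borel_measurable_Pair measurable_solved_point snd) simp_all
  define H where "H v = (\<integral>\<^sup>+q. \<Psi> (q, v) \<partial>lborel)" for v
  have mH: "H \<in> borel_measurable borel"
    unfolding H_def by (rule measurable_nn_integral_lborel(2)[OF m\<Psi>])
  have B: "orthogonal_matrix B" unfolding B_def by (simp add: orthogonal_frame orthogonal_matrix_transpose)
  have mB: "(\<lambda>V. H (B *v V)) \<in> borel_measurable borel"
    by (rule measurable_compose[OF _ mH]) (intro borel_measurable_continuous_onI continuous_on_matrix_vector_mult continuous_intros)
  have mv: "(\<lambda>p::(real \<times> real) \<times> real. vector [fst (fst p), snd (fst p), snd p] :: real^3) \<in> borel_measurable borel"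
    by (intro measurable_vector_3 borel_measurable_continuous_onI continuous_intros)
  have mBv: "(\<lambda>p. H (B *v vector [fst (fst p), snd (fst p), snd p])) \<in> borel_measurable borel"
    using measurable_compose[OF mv mB] .
  have m3: "(\<lambda>a. H (B *v vector [p, q, a])) \<in> borel_measurable borel" for p q
    using measurable_nn_integral_lborel(3)[OF mBv, of "(p, q)"] by simp
  have "(\<integral>\<^sup>+p. \<Psi> p \<partial>lborel) = (\<integral>\<^sup>+v. H v \<partial>lborel)"
    unfolding H_def by (rule nn_integral_lborel_prod(2)[OF m\<Psi>])
  also have "\<dots> = (\<integral>\<^sup>+V. H (B *v V) \<partial>lborel)"
    by (rule nn_integral_lborel_orthogonal[OF B mH, symmetric])
  also have "\<dots> = (\<integral>\<^sup>+p. \<integral>\<^sup>+a. H (B *v vector [fst p, snd p, a]) \<partial>lborel \<partial>lborel)"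
    by (rule nn_integral_lborel_vector_3[OF mB])
  also have "\<dots> = (\<integral>\<^sup>+s. \<integral>\<^sup>+t. indicator {0..<pi} t * ennreal \<bar>s\<bar>
        * (\<integral>\<^sup>+a. H (B *v vector [s * cos t, s * sin t, a]) \<partial>lborel) \<partial>lborel \<partial>lborel)"
    by (subst nn_integral_half_polar) (use measurable_nn_integral_lborel(1)[OF mBv] in simp_all)
  also have "\<dots> = (\<integral>\<^sup>+s. \<integral>\<^sup>+t. \<integral>\<^sup>+a. indicator {0..<pi} t * ennreal \<bar>s\<bar>
        * H (B *v vector [s * cos t, s * sin t, a]) \<partial>lborel \<partial>lborel \<partial>lborel)"
    using m3 by (subst nn_integral_cmult) simp_all
  also have "\<dots> = (\<integral>\<^sup>+s. \<integral>\<^sup>+t. \<integral>\<^sup>+a. \<integral>\<^sup>+r. \<integral>\<^sup>+b. indicator {0..<pi} t *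
        ennreal (std_normal_density s * std_normal_density a * std_normal_density r * std_normal_density b / (2 * pi)) *
        G (A *v vector [r * cos (t + x$5), r * sin (t + x$5), b], B *v vector [s * cos t, s * sin t, a])
        \<partial>lborel \<partial>lborel \<partial>lborel \<partial>lborel \<partial>lborel)"
  \<comment> \<open>The radius s = 0 and the countably many angles with cos (t + x$5) = 0 are
    discarded: there the equation has no unknown to solve for.\<close>
  proof (rule nn_integral_cong_AE, use AE_lborel_singleton[of 0] in eventually_elim,
      rule nn_integral_cong_AE)
    fix s :: real assume s: "s \<noteq> 0"
    have "{t. cos (t + x$5) = 0} \<subseteq> (\<lambda>n::int. n * pi + pi/2 - x$5) ` UNIV"
      by (auto simp: cos_zero_iff_int2 image_iff) (metis add_diff_cancel_right')
    then have "countable {t. cos (t + x$5) = 0}" by (rule countable_subset) auto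
    then have "AE t in lborel. t \<notin> {t. cos (t + x$5) = 0}"
      by (intro AE_not_in countable_imp_null_set_lborel)
    then show "AE t in lborel. (\<integral>\<^sup>+a. indicator {0..<pi} t * ennreal \<bar>s\<bar>
        * H (B *v vector [s * cos t, s * sin t, a]) \<partial>lborel)
      = (\<integral>\<^sup>+a. \<integral>\<^sup>+r. \<integral>\<^sup>+b. indicator {0..<pi} t *
        ennreal (std_normal_density s * std_normal_density a * std_normal_density r * std_normal_density b / (2 * pi)) *
        G (A *v vector [r * cos (t + x$5), r * sin (t + x$5), b], B *v vector [s * cos t, s * sin t, a])
        \<partial>lborel \<partial>lborel \<partial>lborel)"
    proof (eventually_elim, intro nn_integral_cong)
      fix t a assume "t \<notin> {t. cos (t + x$5) = 0}"
      then have c: "cos (t + x$5) \<noteq> 0" by simp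
      define v where "v = B *v vector [s * cos t, s * sin t, a]"
      have V: "frame (x$3) (x$4) *v v = vector [s * cos t, s * sin t, a]"
        by (simp add: v_def B_def frame_mult_transpose)
      have n: "(ess x *v v) $ 3 = sin (x$2) * s * cos (t + x$5)" by (rule ess_mult_polar_3[OF V])
      have n0: "(ess x *v v) $ 3 \<noteq> 0" using n x s c by simp
      \<comment> \<open>The matrix that maps (r, b) to the first two coordinates of
        \<open>u\<close>, read off from \<open>transpose_frame_mult\<close>. Its determinant times
        \<open>s\<close> is the denominator of \<open>solved_density\<close> up to sign.\<close>
      let ?m11 = "cos (x$1) * cos (t + x$5) - sin (x$1) * cos (x$2) * sin (t + x$5)"
      let ?m12 = "sin (x$1) * sin (x$2)"
      let ?m21 = "sin (x$1) * cos (t + x$5) + cos (x$1) * cos (x$2) * sin (t + x$5)"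
      let ?m22 = "- cos (x$1) * sin (x$2)"
      let ?d = "- sin (x$2) * cos (t + x$5)"
      have det: "?m11 * ?m22 - ?m12 * ?m21 = ?d"
      proof -
        have "?m11 * ?m22 - ?m12 * ?m21 = ?d * (cos (x$1) * cos (x$1) + sin (x$1) * sin (x$1))"
          by (simp add: algebra_simps del: sin_cos_squared_add sin_cos_squared_add2 sin_cos_squared_add3)
        then show ?thesis by simp
      qed
      have d0: "?d \<noteq> 0" using x c by simp
      define u where "u r b = A *v vector [r * cos (t + x$5), r * sin (t + x$5), b]" for r b
      have u12: "u r b $ 1 = ?m11 * r + ?m12 * b" "u r b $ 2 = ?m21 * r + ?m22 * b" for r b
        by (simp_all add: u_def A_def transpose_frame_mult algebra_simps)
      \<comment> \<open>The planar part of \<open>u r b\<close> has the direction of that of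
        \<open>v\<close> turned by x$5, hence the third coordinate of \<open>u r b\<close> is the
        one that \<open>epipolar_solve\<close> returns.\<close>
      have uv: "u r b \<bullet> (ess x *v v) = 0" for r b
        unfolding inner_ess V by (simp add: u_def A_def frame_mult_transpose inner_3 twist_mult cos_add sin_add algebra_simps)
      have usol: "solved_point x ((u r b $ 1, u r b $ 2), v) = u r b" for r b
      proof -
        have uu: "vector [u r b $ 1, u r b $ 2, u r b $ 3] = u r b" by (simp add: vec_eq_iff forall_3)
        have "epipolar_solve x (u r b $ 1) (u r b $ 2) v = u r b $ 3"
          using epipolar_solve_iff[OF n0, of "u r b $ 1" "u r b $ 2" "u r b $ 3"] uv uu by simp
        then show ?thesis by (simp add: solved_point_def uu)
      qed
      have g: "gauss3 (u r b) = std_normal_density r * std_normal_density b / sqrt (2 * pi)" for r b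
        by (simp add: u_def A_def gauss3_transpose_frame gauss3_polar)
      have gv: "gauss3 v = std_normal_density s * std_normal_density a / sqrt (2 * pi)"
        by (simp add: v_def B_def gauss3_transpose_frame gauss3_polar)
      \<comment> \<open>The two Jacobians cancel the denominator of
        \<open>solved_density\<close>.\<close>
      have pt: "ennreal \<bar>s\<bar> * (ennreal \<bar>?d\<bar> * \<Psi> ((u r b $ 1, u r b $ 2), v))
        = ennreal (std_normal_density s * std_normal_density a * std_normal_density r * std_normal_density b / (2 * pi)) * G (u r b, v)"
        for r b
      proof -
        have "solved_density x ((u r b $ 1, u r b $ 2), v) = gauss3 (u r b) * gauss3 v / \<bar>(ess x *v v) $ 3\<bar>"
          using n0 usol[of r b] by (simp add: solved_density_def solved_point_def)
        also have "\<dots> = std_normal_density s * std_normal_density a * std_normal_density r * std_normal_density b / (2 * pi)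
            / (\<bar>s\<bar> * \<bar>?d\<bar>)"
          unfolding g gv n by (simp add: abs_mult field_simps)
        finally have "\<bar>s\<bar> * \<bar>?d\<bar> * solved_density x ((u r b $ 1, u r b $ 2), v)
          = std_normal_density s * std_normal_density a * std_normal_density r * std_normal_density b / (2 * pi)"
          using s d0 by (simp add: field_simps)
        then show ?thesis
          unfolding \<Psi>_def usol snd_conv
          by (simp only: mult.assoc[symmetric] ennreal_mult''[symmetric] abs_ge_zero ennreal_mult'[symmetric])
      qed
      have m\<Psi>v: "(\<lambda>q. \<Psi> (q, v)) \<in> borel_measurable borel" by (rule measurable_nn_integral_lborel(4)[OF m\<Psi>])
      have mL: "(\<lambda>q. ennreal \<bar>?d\<bar> * \<Psi> ((?m11 * fst q + ?m12 * snd q, ?m21 * fst q + ?m22 * snd q), v)) \<in> borel_measurable borel"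
      proof -
        have "(\<lambda>q::real \<times> real. (?m11 * fst q + ?m12 * snd q, ?m21 * fst q + ?m22 * snd q)) \<in> borel_measurable borel"
          by (intro borel_measurable_continuous_onI continuous_intros)
        from measurable_compose[OF this m\<Psi>v] show ?thesis by simp
      qed
      have "H v = (\<integral>\<^sup>+r. \<integral>\<^sup>+b. ennreal \<bar>?d\<bar> * \<Psi> ((u r b $ 1, u r b $ 2), v) \<partial>lborel \<partial>lborel)"
        unfolding H_def u12 by (rule nn_integral_lborel_linear_pair[OF m\<Psi>v det d0])
      then have "indicator {0..<pi} t * ennreal \<bar>s\<bar> * H v
        = (\<integral>\<^sup>+r. \<integral>\<^sup>+b. (indicator {0..<pi} t * ennreal \<bar>s\<bar>) * (ennreal \<bar>?d\<bar> * \<Psi> ((u r b $ 1, u r b $ 2), v)) \<partial>lborel \<partial>lborel)"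
        using nn_integral_lborel_prod_cmult[OF mL, of "indicator {0..<pi} t * ennreal \<bar>s\<bar>"] unfolding u12 by simp
      also have "\<dots> = (\<integral>\<^sup>+r. \<integral>\<^sup>+b. indicator {0..<pi} t *
        ennreal (std_normal_density s * std_normal_density a * std_normal_density r * std_normal_density b / (2 * pi)) *
        G (u r b, v) \<partial>lborel \<partial>lborel)"
        unfolding mult.assoc pt by (simp add: mult.assoc)
      finally show "indicator {0..<pi} t * ennreal \<bar>s\<bar> * H (B *v vector [s * cos t, s * sin t, a])
        = (\<integral>\<^sup>+r. \<integral>\<^sup>+b. indicator {0..<pi} t *
        ennreal (std_normal_density s * std_normal_density a * std_normal_density r * std_normal_density b / (2 * pi)) *
        G (A *v vector [r * cos (t + x$5), r * sin (t + x$5), b], B *v vector [s * cos t, s * sin t, a]) \<partial>lborel \<partial>lborel)"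
        by (simp add: v_def u_def)
    qed
  qed
  finally show ?thesis unfolding \<Psi>_def A_def B_def .
qed

section \<open>The gradient in polar coordinates and the law of \<open>z\<close>\<close>

type_synonym params = "real \<times> real \<times> real \<times> real \<times> real"

definition grad_matrix :: "real^5 \<Rightarrow> real^5^5" where
  "grad_matrix x = vector
    [vector [sin (x$2) * cos (x$5), - sin (x$5), 0, 0, 0],
     vector [sin (x$2) * sin (x$5), cos (x$5), 0, 0, 0],
     vector [0, 0, - sin (x$4), 0, 0],
     vector [0, 0, 0, -1, 0],
     vector [- cos (x$2), 0, cos (x$4), 0, -1]]"

text \<open>In the index type \<open>5\<close> the numeral \<open>5\<close> equals \<open>0\<close> and is the least element, so \<open>T\<close> below is upper triangular.\<close>

lemma det_grad_matrix:
  assumes "sin (x$2) \<noteq> 0" "sin (x$4) \<noteq> 0"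
  shows "\<bar>det (grad_matrix x)\<bar> = \<bar>sin (x$2) * sin (x$4)\<bar>"
proof -
  \<comment> \<open>The angle x$5 enters only as a rotation of the first two coordinates. Splitting
    it off leaves a triangular matrix.\<close>
  define R :: "real^5^5" where "R = vector
    [vector [cos (x$5), - sin (x$5), 0, 0, 0], vector [sin (x$5), cos (x$5), 0, 0, 0],
     vector [0, 0, 1, 0, 0], vector [0, 0, 0, 1, 0], vector [0, 0, 0, 0, 1]]"
  define T :: "real^5^5" where "T = vector
    [vector [sin (x$2), 0, 0, 0, 0], vector [0, 1, 0, 0, 0],
     vector [0, 0, - sin (x$4), 0, 0], vector [0, 0, 0, -1, 0],
     vector [- cos (x$2), 0, cos (x$4), 0, -1]]"
  have M: "grad_matrix x = R ** T"
    unfolding vec_eq_iff forall_5 by (simp add: grad_matrix_def R_def T_def matrix_matrix_mult_def sum_5 vector_5)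
  have "orthogonal_matrix R"
    unfolding orthogonal_matrix vec_eq_iff forall_5
    by (simp add: R_def matrix_matrix_mult_def transpose_def mat_def sum_5 vector_5)
  then have R: "\<bar>det R\<bar> = 1" using det_orthogonal_matrix[of R] by auto
  have "det T = (\<Prod>i\<in>UNIV. T $ i $ i)"
  proof (rule det_upperdiagonal)
    fix i j :: 5 assume "j < i"
    have "\<not> (1::5) < 5" "\<not> (3::5) < 5" by (simp_all add: less_bit1_def bit1.Rep_numeral bit1.Rep_1)
    then show "T $ i $ j = 0"
      using \<open>j < i\<close> exhaust_5[of i] exhaust_5[of j] by (auto simp: T_def vector_5)
  qed
  then have "det T = - sin (x$2) * sin (x$4)" by (simp add: prod_5 T_def vector_5)
  then show ?thesis unfolding M det_mul by (simp add: abs_mult R)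
qed

text \<open>Compared with the theorem, \<open>r\<close> and \<open>s\<close> are exchanged; they have the same law.\<close>

definition zvec :: "params \<Rightarrow> real^5" where
  "zvec = (\<lambda>(s, t, a, r, b). vector [b * s * sin t, b * s * cos t, a * r * sin t, a * r * cos t, s * r])"

lemma measurable_zvec[measurable]: "zvec \<in> borel_measurable borel"
proof (rule borel_measurable_continuous_onI)
  have eq: "zvec = (\<lambda>q. \<chi> i. case q of (s, t, a, r, b) \<Rightarrow> if i = 1 then b * s * sin t else if i = 2 then b * s * cos t
      else if i = 3 then a * r * sin t else if i = 4 then a * r * cos t else s * r)"
    by (simp add: zvec_def fun_eq_iff vec_eq_iff forall_5 vector_5)
  have c: "continuous_on UNIV (\<lambda>q::params.
      case q of (s, t, a, r, b) \<Rightarrow> if i = 1 then b * s * sin t else if i = 2 then b * s * cos t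
      else if i = 3 then a * r * sin t else if i = 4 then a * r * cos t else s * r)" for i :: 5
    unfolding case_prod_beta' using exhaust_5[of i] by (elim disjE; simp) (intro continuous_intros)+
  show "continuous_on UNIV zvec" unfolding eq by (rule continuous_on_vec_lambda) (rule c)
qed

text \<open>This is where the shape of \<open>z\<close> comes from. In polar coordinates the
  gradient consists of combinations of b s sin (t + x$5), b s cos (t + x$5), a r sin t, a r cos t
  and r s; the addition theorems extract x$5. What is random and what depends on \<open>x\<close>
  separate into a vector and a matrix.\<close>

lemma ess_grad_polar:
  "ess_grad x (transpose (frame (x$1) (x$2)) *v vector [r * cos (t + x$5), r * sin (t + x$5), b])
     (transpose (frame (x$3) (x$4)) *v vector [s * cos t, s * sin t, a])
   = zvec (s, t, a, r, b) v* grad_matrix x"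
proof -
  define g c d where "g = x$5" and "c = cos (x$2)" and "d = cos (x$4)"
  have id: "cos g * cos g = 1 - sin g * sin g" "cos t * cos t = 1 - sin t * sin t"
    using sin_cos_squared_add3[of g] sin_cos_squared_add3[of t] by linarith+
  have id': "cos g * (cos g * y) = y - sin g * (sin g * y)" "cos t * (cos t * y) = y - sin t * (sin t * y)" for y
    using id by (metis mult.assoc left_diff_distrib mult_1)+
  show ?thesis
    unfolding vec_eq_iff forall_5
    by (simp add: ess_grad_def Let_def frame_mult_transpose vector_matrix_mult_def sum_5 grad_matrix_def zvec_def vector_5
        sin_add cos_add id id' algebra_simps flip: g_def c_def d_def)
qed

definition param_density :: "params \<Rightarrow> real" where
  "param_density = (\<lambda>(s, t, a, r, b). std_normal_density s * (indicator {0..<2 * pi} t / (2 * pi))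
     * (std_normal_density a * (std_normal_density r * std_normal_density b)))"

lemma measurable_param_density[measurable]: "param_density \<in> borel_measurable borel"
proof -
  have *: "param_density = (\<lambda>q. std_normal_density (fst q) * (indicator {0..<2 * pi} (fst (snd q)) / (2 * pi))
     * (std_normal_density (fst (snd (snd q))) * (std_normal_density (fst (snd (snd (snd q)))) * std_normal_density (snd (snd (snd (snd q)))))))"
    by (simp add: param_density_def fun_eq_iff)
  have [measurable]: "(\<lambda>q::params. fst q) \<in> borel_measurable borel"
    "(\<lambda>q::params. fst (snd q)) \<in> borel_measurable borel"
    "(\<lambda>q::params. fst (snd (snd q))) \<in> borel_measurable borel"
    "(\<lambda>q::params. fst (snd (snd (snd q)))) \<in> borel_measurable borel"
    "(\<lambda>q::params. snd (snd (snd (snd q)))) \<in> borel_measurable borel"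
    by (intro borel_measurable_continuous_onI continuous_intros)+
  show ?thesis unfolding * by measurable
qed

definition z_law :: "(real^5) measure" where
  "z_law = distr (density lborel param_density) borel zvec"

lemma nn_integral_lborel_5:
  fixes F :: "params \<Rightarrow> ennreal"
  assumes F: "F \<in> borel_measurable borel"
  shows "(\<integral>\<^sup>+q. F q \<partial>lborel) = (\<integral>\<^sup>+s. \<integral>\<^sup>+t. \<integral>\<^sup>+a. \<integral>\<^sup>+r. \<integral>\<^sup>+b. F (s, t, a, r, b) \<partial>lborel \<partial>lborel \<partial>lborel \<partial>lborel \<partial>lborel)"
proof -
  note m1 = measurable_nn_integral_lborel(3)[OF F]
  note m2 = measurable_nn_integral_lborel(3)[OF m1]
  note m3 = measurable_nn_integral_lborel(3)[OF m2]
  show ?thesis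
    unfolding nn_integral_lborel_prod(1)[OF F] nn_integral_lborel_prod(1)[OF m1] nn_integral_lborel_prod(1)[OF m2]
      nn_integral_lborel_prod(1)[OF m3] ..
qed

lemma nn_integral_lborel_5_shift:
  fixes F :: "params \<Rightarrow> ennreal"
  assumes F: "F \<in> borel_measurable borel"
  shows "(\<integral>\<^sup>+q. F q \<partial>lborel) = (\<integral>\<^sup>+q. (case q of (s, t, a, r, b) \<Rightarrow> F (- s, c + t, a, - r, b)) \<partial>lborel)"
proof -
  have m: "(\<lambda>q. case q of (s, t, a, r, b) \<Rightarrow> F (- s, c + t, a, - r, b)) \<in> borel_measurable borel"
  proof -
    have "(\<lambda>q::params. (- fst q, c + fst (snd q), fst (snd (snd q)), - fst (snd (snd (snd q))), snd (snd (snd (snd q))))) \<in> borel_measurable borel"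
      by (intro borel_measurable_continuous_onI continuous_intros)
    from measurable_compose[OF this F] show ?thesis by (simp add: case_prod_beta')
  qed
  have af: "(\<integral>\<^sup>+x. f x \<partial>lborel) = (\<integral>\<^sup>+x. f (- x) \<partial>lborel)" "(\<integral>\<^sup>+x. f x \<partial>lborel) = (\<integral>\<^sup>+x. f (c + x) \<partial>lborel)"
    if "f \<in> borel_measurable borel" for f :: "real \<Rightarrow> ennreal"
    using nn_integral_real_affine[OF that, of "-1" 0] nn_integral_real_affine[OF that, of 1 c] by simp_all
  note m1 = measurable_nn_integral_lborel(3)[OF F]
  note m2 = measurable_nn_integral_lborel(3)[OF m1]
  note m3 = measurable_nn_integral_lborel(3)[OF m2]
  have "(\<integral>\<^sup>+q. F q \<partial>lborel) = (\<integral>\<^sup>+s. \<integral>\<^sup>+q. F (s, q) \<partial>lborel \<partial>lborel)"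
    by (rule nn_integral_lborel_prod(1)[OF F])
  also have "\<dots> = (\<integral>\<^sup>+s. \<integral>\<^sup>+q. F (- s, q) \<partial>lborel \<partial>lborel)"
    by (rule af(1)[OF measurable_nn_integral_lborel(1)[OF F]])
  also have "\<dots> = (\<integral>\<^sup>+s. \<integral>\<^sup>+t. \<integral>\<^sup>+q. F (- s, t, q) \<partial>lborel \<partial>lborel \<partial>lborel)"
    unfolding nn_integral_lborel_prod(1)[OF m1] ..
  also have "\<dots> = (\<integral>\<^sup>+s. \<integral>\<^sup>+t. \<integral>\<^sup>+q. F (- s, c + t, q) \<partial>lborel \<partial>lborel \<partial>lborel)"
    by (intro nn_integral_cong af(2)[OF measurable_nn_integral_lborel(1)[OF m1]])
  also have "\<dots> = (\<integral>\<^sup>+s. \<integral>\<^sup>+t. \<integral>\<^sup>+a. \<integral>\<^sup>+r. \<integral>\<^sup>+b. F (- s, c + t, a, r, b) \<partial>lborel \<partial>lborel \<partial>lborel \<partial>lborel \<partial>lborel)"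
    unfolding nn_integral_lborel_prod(1)[OF m2] nn_integral_lborel_prod(1)[OF m3] ..
  also have "\<dots> = (\<integral>\<^sup>+s. \<integral>\<^sup>+t. \<integral>\<^sup>+a. \<integral>\<^sup>+r. \<integral>\<^sup>+b. F (- s, c + t, a, - r, b) \<partial>lborel \<partial>lborel \<partial>lborel \<partial>lborel \<partial>lborel)"
    by (intro nn_integral_cong af(1)[OF measurable_nn_integral_lborel(1)[OF m3]])
  also have "\<dots> = (\<integral>\<^sup>+q. (case q of (s, t, a, r, b) \<Rightarrow> F (- s, c + t, a, - r, b)) \<partial>lborel)"
    by (subst nn_integral_lborel_5[OF m]) simp
  finally show ?thesis .
qed

lemma nn_integral_z_law:
  assumes h: "h \<in> borel_measurable borel"
  shows "(\<integral>\<^sup>+z. h z \<partial>z_law) = (\<integral>\<^sup>+q. ennreal (param_density q) * h (zvec q) \<partial>lborel)"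
  unfolding z_law_def using h
  by (subst nn_integral_distr) (auto simp: nn_integral_density)

lemma std_normal_density_minus: "std_normal_density (- x) = std_normal_density x"
  by (simp add: std_normal_density_def)

text \<open>The vector \<open>zvec (s, t, a, r, b)\<close> is invariant under \<open>(s, t, r) \<mapsto> (- s, pi + t, - r)\<close>.\<close>

lemma nn_integral_z_law_half:
  assumes h: "h \<in> borel_measurable borel"
  shows "(\<integral>\<^sup>+z. ennreal (1 / 2) * h z \<partial>z_law)
    = (\<integral>\<^sup>+s. \<integral>\<^sup>+t. \<integral>\<^sup>+a. \<integral>\<^sup>+r. \<integral>\<^sup>+b. indicator {0..<pi} t *
        ennreal (std_normal_density s * std_normal_density a * std_normal_density r * std_normal_density b / (2 * pi)) *
        h (zvec (s, t, a, r, b)) \<partial>lborel \<partial>lborel \<partial>lborel \<partial>lborel \<partial>lborel)"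
proof -
  define F where "F A = (\<lambda>(s, t, a, r, b). indicator A t *
        ennreal (std_normal_density s * std_normal_density a * std_normal_density r * std_normal_density b / (2 * pi)) *
        h (zvec (s, t, a, r, b)))" for A :: "real set"
  have Feq: "F A = (\<lambda>q. indicator A (fst (snd q)) *
        ennreal (std_normal_density (fst q) * std_normal_density (fst (snd (snd q))) * std_normal_density (fst (snd (snd (snd q)))) * std_normal_density (snd (snd (snd (snd q)))) / (2 * pi)) *
        h (zvec q))" for A
    by (simp add: F_def fun_eq_iff)
  have mh: "(\<lambda>q. h (zvec q)) \<in> borel_measurable borel" by (rule measurable_compose[OF measurable_zvec h])
  have mF: "F A \<in> borel_measurable borel" if A: "A \<in> sets borel" for A
  proof -
    have [measurable]: "(\<lambda>q::params. fst q) \<in> borel_measurable borel"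
      "(\<lambda>q::params. fst (snd q)) \<in> borel_measurable borel"
      "(\<lambda>q::params. fst (snd (snd q))) \<in> borel_measurable borel"
      "(\<lambda>q::params. fst (snd (snd (snd q)))) \<in> borel_measurable borel"
      "(\<lambda>q::params. snd (snd (snd (snd q)))) \<in> borel_measurable borel"
      by (intro borel_measurable_continuous_onI continuous_intros)+
    note [measurable] = mh A
    show ?thesis unfolding Feq by measurable
  qed
  have zs: "zvec (- s, pi + t, a, - r, b) = zvec (s, t, a, r, b)" for s t a r b
    unfolding vec_eq_iff forall_5 by (simp add: zvec_def vector_5 sin_add cos_add)
  have "(\<integral>\<^sup>+z. ennreal (1 / 2) * h z \<partial>z_law) = (\<integral>\<^sup>+q. ennreal (1 / 2) * F {0..<2 * pi} q \<partial>lborel)"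
  proof (subst nn_integral_z_law)
    show "(\<lambda>z. ennreal (1 / 2) * h z) \<in> borel_measurable borel" using h by simp
    show "(\<integral>\<^sup>+q. ennreal (param_density q) * (ennreal (1 / 2) * h (zvec q)) \<partial>lborel)
        = (\<integral>\<^sup>+q. ennreal (1 / 2) * F {0..<2 * pi} q \<partial>lborel)"
      by (intro nn_integral_cong) (auto simp: F_def param_density_def mult_ac split: split_indicator)
  qed
  also have "\<dots> = ennreal (1 / 2) * (\<integral>\<^sup>+q. F {0..<2 * pi} q \<partial>lborel)"
    by (rule nn_integral_cmult) (simp add: mF)
  also have "(\<integral>\<^sup>+q. F {0..<2 * pi} q \<partial>lborel) = (\<integral>\<^sup>+q. F {0..<pi} q + F {pi..<2 * pi} q \<partial>lborel)"
    by (intro nn_integral_cong) (auto simp: F_def split: split_indicator)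
  also have "\<dots> = (\<integral>\<^sup>+q. F {0..<pi} q \<partial>lborel) + (\<integral>\<^sup>+q. F {pi..<2 * pi} q \<partial>lborel)"
    by (rule nn_integral_add) (simp_all add: mF)
  \<comment> \<open>The symmetry stated above transports the second half of the circle to the first
    and keeps both the normal densities and \<open>zvec\<close>.\<close>
  also have "(\<integral>\<^sup>+q. F {pi..<2 * pi} q \<partial>lborel) = (\<integral>\<^sup>+q. F {0..<pi} q \<partial>lborel)"
    by (subst nn_integral_lborel_5_shift[where c=pi, OF mF])
      (auto simp: F_def zs std_normal_density_minus intro!: nn_integral_cong split: split_indicator)
  also have "ennreal (1 / 2) * ((\<integral>\<^sup>+q. F {0..<pi} q \<partial>lborel) + (\<integral>\<^sup>+q. F {0..<pi} q \<partial>lborel)) = (\<integral>\<^sup>+q. F {0..<pi} q \<partial>lborel)"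
  proof -
    have "ennreal (1 / 2) * (y + y) = y" for y
    proof -
      have "ennreal (1 / 2) * (y + y) = (ennreal (1 / 2) + ennreal (1 / 2)) * y" by (simp only: distrib_left distrib_right)
      also have "ennreal (1 / 2) + ennreal (1 / 2) = ennreal (1 / 2 + 1 / 2)" by (rule ennreal_plus[symmetric]) auto
      finally show ?thesis by simp
    qed
    then show ?thesis .
  qed
  also have "\<dots> = (\<integral>\<^sup>+s. \<integral>\<^sup>+t. \<integral>\<^sup>+a. \<integral>\<^sup>+r. \<integral>\<^sup>+b. F {0..<pi} (s, t, a, r, b) \<partial>lborel \<partial>lborel \<partial>lborel \<partial>lborel \<partial>lborel)"
    by (rule nn_integral_lborel_5[OF mF]) simp
  finally show ?thesis by (simp add: F_def)
qed

text \<open>The factor 1/2 reflects that the angle of \<open>nn_integral_solved_density\<close> runs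
  over half of the circle with the density 1 / (2 pi) of the full one.\<close>

lemma nn_integral_solved_row:
  assumes x: "sin (x$2) \<noteq> 0" and h: "h \<in> borel_measurable borel"
  shows "(\<integral>\<^sup>+p. ennreal (solved_density x p) * h (ess_grad x (solved_point x p) (snd p)) \<partial>lborel)
    = (\<integral>\<^sup>+z. ennreal (1 / 2) * h (z v* grad_matrix x) \<partial>z_law)"
proof -
  have mG: "(\<lambda>w. h (ess_grad x (fst w) (snd w))) \<in> borel_measurable borel"
    by (rule measurable_compose[OF _ h]) (intro borel_measurable_continuous_onI continuous_on_ess_grad continuous_intros)
  have mh: "(\<lambda>z. h (z v* grad_matrix x)) \<in> borel_measurable borel"
    by (rule measurable_compose[OF _ h])
      (intro borel_measurable_continuous_onI, simp add: vector_matrix_mult_def, intro continuous_intros)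
  show ?thesis
    unfolding nn_integral_z_law_half[OF mh]
    using nn_integral_solved_density[OF x mG] by (simp add: ess_grad_polar)
qed

section \<open>Gaussian vectors and uniform lines\<close>

lemma nn_integral_std_normal: "(\<integral>\<^sup>+x. ennreal (std_normal_density x) \<partial>lborel) = 1"
proof -
  interpret prob_space "density lborel (\<lambda>x. ennreal (std_normal_density x))"
    by (rule prob_space_normal_density) simp
  show ?thesis using emeasure_space_1 by (simp add: emeasure_density)
qed

definition gauss_law :: "(real^3) measure" where
  "gauss_law = density lborel (\<lambda>w. ennreal (gauss3 w))"

lemma sets_gauss_law[measurable_cong, simp]: "sets gauss_law = sets borel"
  by (simp add: gauss_law_def)

lemma space_gauss_law[simp]: "space gauss_law = UNIV"
  by (simp add: gauss_law_def)

lemma nn_integral_gauss_law: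
  "h \<in> borel_measurable borel \<Longrightarrow> (\<integral>\<^sup>+w. h w \<partial>gauss_law) = (\<integral>\<^sup>+w. ennreal (gauss3 w) * h w \<partial>lborel)"
  unfolding gauss_law_def by (rule nn_integral_density) simp_all

lemma prob_space_gauss_law: "prob_space gauss_law"
proof
  have m: "(\<lambda>p. ennreal (std_normal_density (fst p) * std_normal_density (snd p))) \<in> borel_measurable (borel :: (real \<times> real) measure)"
  proof -
    have [measurable]: "(\<lambda>p::real \<times> real. fst p) \<in> borel_measurable borel" "(\<lambda>p::real \<times> real. snd p) \<in> borel_measurable borel"
      by (intro borel_measurable_continuous_onI continuous_intros)+
    show ?thesis by measurable
  qed
  have "emeasure gauss_law (space gauss_law) = (\<integral>\<^sup>+w. ennreal (gauss3 w) \<partial>lborel)"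
    by (simp add: gauss_law_def emeasure_density)
  also have "\<dots> = (\<integral>\<^sup>+p. \<integral>\<^sup>+z. ennreal (std_normal_density (fst p) * std_normal_density (snd p)) * ennreal (std_normal_density z) \<partial>lborel \<partial>lborel)"
    by (subst nn_integral_lborel_vector_3) (simp_all add: gauss3_def ennreal_mult')
  also have "\<dots> = (\<integral>\<^sup>+p. ennreal (std_normal_density (fst p) * std_normal_density (snd p)) \<partial>lborel)"
    by (subst nn_integral_cmult) (simp_all add: nn_integral_std_normal)
  also have "\<dots> = (\<integral>\<^sup>+x. \<integral>\<^sup>+y. ennreal (std_normal_density x) * ennreal (std_normal_density y) \<partial>lborel \<partial>lborel)"
    using nn_integral_lborel_prod(1)[OF m] by (simp add: ennreal_mult')
  also have "\<dots> = 1"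
    by (subst nn_integral_cmult) (simp_all add: nn_integral_std_normal)
  finally show "emeasure gauss_law (space gauss_law) = 1" .
qed

lemma orthogonal_matrix_inner:
  assumes "orthogonal_matrix (Q :: real^'n^'n)"
  shows "(Q *v x) \<bullet> (Q *v x) = x \<bullet> x"
proof -
  have "x \<bullet> (transpose Q *v (Q *v x)) = (Q *v x) \<bullet> (Q *v x)" by (rule inner_transpose_mult)
  then show ?thesis using assms by (simp add: orthogonal_matrix_def matrix_vector_mul_assoc)
qed

lemma nn_integral_gauss_law_orthogonal:
  assumes Q: "orthogonal_matrix Q" and h: "h \<in> borel_measurable borel"
  shows "(\<integral>\<^sup>+w. h (Q *v w) \<partial>gauss_law) = (\<integral>\<^sup>+w. h w \<partial>gauss_law)"
proof -
  have c: "(\<lambda>w. Q *v w) \<in> borel_measurable borel"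
    by (intro borel_measurable_continuous_onI continuous_on_matrix_vector_mult continuous_intros)
  have "(\<integral>\<^sup>+w. h (Q *v w) \<partial>gauss_law) = (\<integral>\<^sup>+w. ennreal (gauss3 (Q *v w)) * h (Q *v w) \<partial>lborel)"
    using measurable_compose[OF c h] Q by (simp add: nn_integral_gauss_law gauss3_eq orthogonal_matrix_inner)
  also have "\<dots> = (\<integral>\<^sup>+w. ennreal (gauss3 w) * h w \<partial>lborel)"
    by (rule nn_integral_lborel_orthogonal[OF Q]) (use h in simp)
  finally show ?thesis using h by (simp add: nn_integral_gauss_law)
qed

text \<open>Averaging over the transposes of Haar distributed matrices, only left invariance of the Haar measure
  is needed: the resulting kernel \<open>k\<close> is constant, and it computes both sides.\<close>

lemma unif_RP2_eq_gauss:
  assumes H: "normalized_haar_O3 H"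
  shows "unif_RP2 H a0 = distr gauss_law borel Proj"
proof (rule measure_eqI)
  show "sets (unif_RP2 H a0) = sets (distr gauss_law borel Proj)" by (simp add: unif_RP2_def)
  fix S assume "S \<in> sets (unif_RP2 H a0)"
  then have S: "S \<in> sets borel" by (simp add: unif_RP2_def)
  interpret H: prob_space H using H by (simp add: normalized_haar_O3_def)
  interpret G: prob_space gauss_law by (rule prob_space_gauss_law)
  have sH[measurable_cong]: "sets H = sets (restrict_space borel {Q. orthogonal_matrix Q})"
    and inv: "\<And>Q. orthogonal_matrix Q \<Longrightarrow> distr H H (\<lambda>U. Q ** U) = H"
    using H by (auto simp: normalized_haar_O3_def)
  have spH: "space H = {Q. orthogonal_matrix Q}"
    using sets_eq_imp_space_eq[OF sH] by (simp add: space_restrict_space)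
  have idH[measurable]: "(\<lambda>U. U) \<in> H \<rightarrow>\<^sub>M borel"
    by (simp add: measurable_cong_sets[OF sH refl] measurable_restrict_space1)
  \<comment> \<open>The cone over \<open>S\<close> without its apex; it turns statements about lines
    into statements about vectors.\<close>
  define C where "C = {x. x \<noteq> 0 \<and> Proj x \<in> S}"
  have C[measurable]: "C \<in> sets borel" unfolding C_def by (rule borel_measurable_Proj[OF S])
  have Cs: "c *\<^sub>R x \<in> C \<longleftrightarrow> x \<in> C" if "c \<noteq> 0" for c x
    using that Proj_scaleR[of x c] by (auto simp: C_def)
  define x0 where "x0 = proj_rep a0"
  have x0: "x0 \<noteq> 0" "Proj x0 = a0" using proj_rep[of a0] by (auto simp: x0_def)
  have nz: "Q *v x \<noteq> 0" if "orthogonal_matrix Q" "x \<noteq> 0" for Q and x :: "real^3"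
    using orthogonal_matrix_inner[OF that(1), of x] that(2) by (metis inner_eq_zero_iff)
  have act: "proj_act U a0 \<in> S \<longleftrightarrow> U *v x0 \<in> C" if "orthogonal_matrix U" for U
    using proj_act_Proj[OF that x0(1)] nz[OF that x0(1)] x0(2) by (simp add: C_def)
  have mul: "(\<lambda>p. fst p *v snd p) \<in> borel_measurable (borel :: ((real^3^3) \<times> (real^3)) measure)"
    by (intro borel_measurable_continuous_onI continuous_on_matrix_vector_mult continuous_intros)
  have mulM: "(\<lambda>t. f t *v g t) \<in> borel_measurable M"
    if "f \<in> borel_measurable M" "g \<in> borel_measurable M" for f :: "'z \<Rightarrow> real^3^3" and g M
    using measurable_compose[OF borel_measurable_Pair[OF that] mul] by simp
  have trM: "(\<lambda>t. transpose (f t)) \<in> borel_measurable M" if "f \<in> borel_measurable M" for f :: "'z \<Rightarrow> real^3^3" and M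
  proof -
    have "(transpose :: real^3^3 \<Rightarrow> _) \<in> borel_measurable borel"
      by (intro borel_measurable_continuous_onI) (simp add: transpose_def[abs_def] continuous_intros)
    from measurable_compose[OF that this] show ?thesis .
  qed
  have mH: "(\<lambda>U. U *v x) \<in> H \<rightarrow>\<^sub>M borel" for x by (intro mulM idH) simp
  have mHt: "(\<lambda>U. transpose U *v x) \<in> H \<rightarrow>\<^sub>M borel" for x by (intro mulM trM idH) simp
  have left: "(\<integral>\<^sup>+U. h (Q ** U) \<partial>H) = (\<integral>\<^sup>+U. h U \<partial>H)"
    if Q: "orthogonal_matrix Q" and h: "h \<in> borel_measurable H" for Q h
  proof -
    have "(\<lambda>U. Q ** U) \<in> H \<rightarrow>\<^sub>M borel"
    proof -
      have "(\<lambda>U. Q ** U) \<in> borel_measurable borel"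
        by (intro borel_measurable_continuous_onI continuous_on_matrix_mult continuous_intros)
      from measurable_compose[OF idH this] show ?thesis .
    qed
    then have "(\<lambda>U. Q ** U) \<in> H \<rightarrow>\<^sub>M restrict_space borel {Q. orthogonal_matrix Q}"
      using Q by (intro measurable_restrict_space2) (auto simp: spH orthogonal_matrix_mul)
    then have m: "(\<lambda>U. Q ** U) \<in> H \<rightarrow>\<^sub>M H" by (simp add: measurable_cong_sets[OF refl sH])
    have "(\<integral>\<^sup>+U. h U \<partial>H) = (\<integral>\<^sup>+U. h U \<partial>distr H H (\<lambda>U. Q ** U))" by (simp add: inv[OF Q])
    also have "\<dots> = (\<integral>\<^sup>+U. h (Q ** U) \<partial>H)" by (rule nn_integral_distr[OF m]) (simp add: h)
    finally show ?thesis by simp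
  qed
  define k where "k y = (\<integral>\<^sup>+W. indicator C (transpose W *v y) \<partial>H)" for y
  have mI: "(\<lambda>W. indicator C (transpose W *v y) :: ennreal) \<in> borel_measurable H" for y
    using measurable_compose[OF mHt[of y], of "indicator C" borel] by simp
  have k_orth: "k (Q *v y) = k y" if Q: "orthogonal_matrix Q" for Q y
  proof -
    have "k (Q *v y) = (\<integral>\<^sup>+W. indicator C (transpose (transpose Q ** W) *v y) \<partial>H)"
      unfolding k_def by (simp add: matrix_transpose_mul matrix_vector_mul_assoc)
    also have "\<dots> = k y"
      unfolding k_def by (rule left) (use Q mI in \<open>simp_all add: orthogonal_matrix_transpose\<close>)
    finally show ?thesis .
  qed
  have k_scale: "k (c *\<^sub>R y) = k y" if "c \<noteq> 0" for c y
    unfolding k_def by (simp add: matrix_vector_mult_scaleR indicator_def Cs[OF that])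
  \<comment> \<open>Orthogonal maps act transitively on spheres, and rescaling connects the
    spheres.\<close>
  have k_const: "k y = k x0" if "y \<noteq> 0" for y
  proof -
    have "norm ((norm x0 / norm y) *\<^sub>R y) = norm x0" using that by simp
    then obtain f where f: "orthogonal_transformation f" "f x0 = (norm x0 / norm y) *\<^sub>R y"
      by (metis orthogonal_transformation_exists)
    then have "matrix f *v x0 = (norm x0 / norm y) *\<^sub>R y" "orthogonal_matrix (matrix f)"
      by (auto simp: orthogonal_transformation_matrix matrix_works orthogonal_transformation_linear)
    then have "k ((norm x0 / norm y) *\<^sub>R y) = k x0" using k_orth by metis
    moreover have "norm x0 / norm y \<noteq> 0" using that x0 by simp
    ultimately show ?thesis using k_scale by metis
  qed
  have H1: "(\<integral>\<^sup>+U. c \<partial>H) = c" for c by (simp add: H.emeasure_space_1)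
  have "emeasure (unif_RP2 H a0) S = emeasure H ((\<lambda>U. U *v x0) -` C \<inter> space H)"
  proof -
    have "(\<lambda>U. proj_act U a0) \<in> H \<rightarrow>\<^sub>M borel \<longleftrightarrow> (\<lambda>U. Proj (U *v x0)) \<in> H \<rightarrow>\<^sub>M borel"
      using proj_act_Proj[OF _ x0(1)] x0(2) by (intro measurable_cong) (auto simp: spH)
    then have "(\<lambda>U. proj_act U a0) \<in> H \<rightarrow>\<^sub>M borel"
      using measurable_compose[OF mH[of x0] measurable_Proj] by simp
    then show ?thesis unfolding unif_RP2_def using S
      by (subst emeasure_distr) (auto intro!: arg_cong[where f="emeasure H"] simp: spH act)
  qed
  also have "\<dots> = (\<integral>\<^sup>+U. indicator ((\<lambda>U. U *v x0) -` C \<inter> space H) U \<partial>H)"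
    by (rule nn_integral_indicator[symmetric]) (rule measurable_sets[OF mH C])
  also have "\<dots> = (\<integral>\<^sup>+U. indicator C (U *v x0) \<partial>H)"
    by (intro nn_integral_cong) (auto simp: indicator_def)
  \<comment> \<open>By left invariance the inner integral does not change with \<open>W\<close>, so
    the average over \<open>W\<close> is free.\<close>
  also have "\<dots> = (\<integral>\<^sup>+W. \<integral>\<^sup>+U. indicator C (transpose W *v (U *v x0)) \<partial>H \<partial>H)"
  proof -
    have "(\<integral>\<^sup>+U. indicator C (transpose W *v (U *v x0)) \<partial>H) = (\<integral>\<^sup>+U. indicator C (U *v x0) \<partial>H)"
      if "W \<in> space H" for W
    proof -
      have "orthogonal_matrix (transpose W)" using that by (simp add: spH orthogonal_matrix_transpose)
      moreover have "(\<lambda>U. indicator C (U *v x0) :: ennreal) \<in> borel_measurable H"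
        using measurable_compose[OF mH[of x0], of "indicator C" borel] by simp
      ultimately show ?thesis
        using left[of "transpose W" "\<lambda>U. indicator C (U *v x0)"] by (simp add: matrix_vector_mul_assoc)
    qed
    then have "(\<integral>\<^sup>+W. \<integral>\<^sup>+U. indicator C (transpose W *v (U *v x0)) \<partial>H \<partial>H) = (\<integral>\<^sup>+W. (\<integral>\<^sup>+U. indicator C (U *v x0) \<partial>H) \<partial>H)"
      by (rule nn_integral_cong)
    then show ?thesis by (simp only: H1)
  qed
  also have "\<dots> = (\<integral>\<^sup>+U. k (U *v x0) \<partial>H)"
  proof -
    interpret P: pair_sigma_finite H H ..
    have "(\<lambda>p. transpose (fst p) *v (snd p *v x0)) \<in> H \<Otimes>\<^sub>M H \<rightarrow>\<^sub>M borel"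
      by (intro mulM trM measurable_compose[OF measurable_fst idH] measurable_compose[OF measurable_snd idH]) simp
    then have "(\<lambda>p. indicator C (transpose (fst p) *v (snd p *v x0)) :: ennreal) \<in> borel_measurable (H \<Otimes>\<^sub>M H)"
      using measurable_compose[of _ "H \<Otimes>\<^sub>M H" borel "indicator C" borel] by simp
    then show ?thesis
      unfolding k_def by (intro P.Fubini'[symmetric]) (simp add: case_prod_beta')
  qed
  also have "\<dots> = k x0"
  proof -
    have "(\<integral>\<^sup>+U. k (U *v x0) \<partial>H) = (\<integral>\<^sup>+U. k x0 \<partial>H)"
      by (intro nn_integral_cong k_const nz) (use x0 in \<open>auto simp: spH\<close>)
    then show ?thesis by (simp only: H1)
  qed
  also have "k x0 = (\<integral>\<^sup>+w. k w \<partial>gauss_law)"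
  proof -
    have "AE w in lborel. (w::real^3) \<noteq> 0" by (rule AE_lborel_singleton)
    then have "AE w in gauss_law. w \<noteq> 0" unfolding gauss_law_def by (subst AE_density) auto
    then have "(\<integral>\<^sup>+w. k w \<partial>gauss_law) = (\<integral>\<^sup>+w. k x0 \<partial>gauss_law)"
      by (intro nn_integral_cong_AE) (auto intro: k_const elim!: eventually_mono)
    then show ?thesis using G.emeasure_space_1 by simp
  qed
  also have "\<dots> = (\<integral>\<^sup>+W. \<integral>\<^sup>+w. indicator C (transpose W *v w) \<partial>gauss_law \<partial>H)"
  proof -
    interpret P: pair_sigma_finite H gauss_law ..
    have sg: "(\<lambda>w. w) \<in> gauss_law \<rightarrow>\<^sub>M borel" by simp
    have "(\<lambda>p. transpose (fst p) *v snd p) \<in> H \<Otimes>\<^sub>M gauss_law \<rightarrow>\<^sub>M borel"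
      by (intro mulM trM measurable_compose[OF measurable_fst idH] measurable_compose[OF measurable_snd sg])
    then have "(\<lambda>p. indicator C (transpose (fst p) *v snd p) :: ennreal) \<in> borel_measurable (H \<Otimes>\<^sub>M gauss_law)"
      using measurable_compose[of _ "H \<Otimes>\<^sub>M gauss_law" borel "indicator C" borel] by simp
    then show ?thesis
      unfolding k_def by (intro P.Fubini') (simp add: case_prod_beta')
  qed
  \<comment> \<open>Rotation invariance of the Gaussian law removes \<open>W\<close> again, this
    time on the Gaussian side.\<close>
  also have "\<dots> = (\<integral>\<^sup>+W. \<integral>\<^sup>+w. indicator C w \<partial>gauss_law \<partial>H)"
    by (intro nn_integral_cong nn_integral_gauss_law_orthogonal) (auto simp: spH orthogonal_matrix_transpose)
  also have "\<dots> = emeasure gauss_law C" by (simp only: H1) simp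
  also have "\<dots> = emeasure gauss_law (Proj -` S)"
  proof (rule emeasure_eq_AE)
    have "AE w in lborel. (w::real^3) \<noteq> 0" by (rule AE_lborel_singleton)
    then show "AE w in gauss_law. w \<in> C \<longleftrightarrow> w \<in> Proj -` S"
      unfolding gauss_law_def by (subst AE_density) (auto simp: C_def elim!: eventually_mono)
    show "Proj -` S \<in> sets gauss_law" using measurable_sets[OF measurable_Proj S] by simp
  qed simp
  also have "\<dots> = emeasure (distr gauss_law borel Proj) S"
    using S by (subst emeasure_distr) (auto simp: measurable_cong_sets[OF sets_gauss_law refl])
  finally show "emeasure (unif_RP2 H a0) S = emeasure (distr gauss_law borel Proj) S" .
qed

section \<open>Gaussian data representing the ten lines\<close>

definition data_density :: "datum \<Rightarrow> real" where
  "data_density q = gauss3 (data_u q) * gauss3 (data_v q)"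

lemma measurable_data_u[measurable]: "data_u \<in> borel_measurable borel"
  unfolding data_u_def[abs_def]
  by (intro measurable_vector_3 borel_measurable_continuous_onI continuous_intros)

lemma measurable_data_v[measurable]: "data_v \<in> borel_measurable borel"
  unfolding data_v_def[abs_def] by (intro borel_measurable_continuous_onI continuous_intros)

lemma measurable_data_density[measurable]: "data_density \<in> borel_measurable borel"
  unfolding data_density_def[abs_def] by measurable

definition data_law :: "datum measure" where
  "data_law = density lborel (\<lambda>q. ennreal (data_density q))"

lemma sets_data_law[measurable_cong, simp]: "sets data_law = sets borel"
  by (simp add: data_law_def)

lemma space_data_law[simp]: "space data_law = UNIV"
  by (simp add: data_law_def)

text \<open>Under \<open>data_law\<close> the vectors \<open>data_u\<close> and
  \<open>data_v\<close> are independent and Gaussian, although the coordinates of the former are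
  stored in two places.\<close>

lemma emeasure_data_law:
  assumes A[measurable]: "A \<in> sets borel" and B[measurable]: "B \<in> sets borel"
  shows "emeasure data_law {q. data_u q \<in> A \<and> data_v q \<in> B} = emeasure gauss_law A * emeasure gauss_law B"
proof -
  let ?f = "\<lambda>w. ennreal (gauss3 w) * indicator A w" and ?g = "\<lambda>w. ennreal (gauss3 w) * indicator B w"
  define F where "F q = ?f (data_u q) * ?g (data_v q)" for q
  have F[measurable]: "F \<in> borel_measurable borel"
    unfolding F_def[abs_def] by measurable
  have f: "?f \<in> borel_measurable borel" and g: "?g \<in> borel_measurable borel" by measurable
  note m1 = measurable_nn_integral_lborel(2)[OF F]
  have "{q. data_u q \<in> A \<and> data_v q \<in> B} = data_u -` A \<inter> data_v -` B" by auto
  then have S: "{q. data_u q \<in> A \<and> data_v q \<in> B} \<in> sets borel"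
    using measurable_sets[OF measurable_data_u A] measurable_sets[OF measurable_data_v B] by simp
  have "emeasure data_law {q. data_u q \<in> A \<and> data_v q \<in> B} = (\<integral>\<^sup>+q. F q \<partial>lborel)"
    unfolding data_law_def using S
    by (subst emeasure_density)
      (auto simp: F_def data_density_def ennreal_mult' gauss3_nonneg intro!: nn_integral_cong split: split_indicator)
  also have "\<dots> = (\<integral>\<^sup>+v. \<integral>\<^sup>+p. \<integral>\<^sup>+c. F (c, p, v) \<partial>lborel \<partial>lborel \<partial>lborel)"
    unfolding nn_integral_lborel_prod(2)[OF F] nn_integral_lborel_prod(2)[OF m1] ..
  also have "\<dots> = (\<integral>\<^sup>+v. \<integral>\<^sup>+p. \<integral>\<^sup>+c. ?g v * ?f (vector [fst p, snd p, c]) \<partial>lborel \<partial>lborel \<partial>lborel)"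
    by (simp add: F_def data_u_def data_v_def mult_ac)
  also have "\<dots> = (\<integral>\<^sup>+v. ?g v * (\<integral>\<^sup>+p. \<integral>\<^sup>+c. ?f (vector [fst p, snd p, c]) \<partial>lborel \<partial>lborel) \<partial>lborel)"
  proof (intro nn_integral_cong)
    fix v :: "real^3"
    have "(\<lambda>q::(real \<times> real) \<times> real. vector [fst (fst q), snd (fst q), snd q] :: real^3) \<in> borel_measurable borel"
      by (intro measurable_vector_3 borel_measurable_continuous_onI continuous_intros)
    from measurable_compose[OF this f]
    have "(\<lambda>q::(real \<times> real) \<times> real. ?f (vector [fst (fst q), snd (fst q), snd q])) \<in> borel_measurable borel" .
    from nn_integral_lborel_prod_cmult[OF this, of "?g v"]
    show "(\<integral>\<^sup>+p. \<integral>\<^sup>+c. ?g v * ?f (vector [fst p, snd p, c]) \<partial>lborel \<partial>lborel)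
      = ?g v * (\<integral>\<^sup>+p. \<integral>\<^sup>+c. ?f (vector [fst p, snd p, c]) \<partial>lborel \<partial>lborel)" by simp
  qed
  also have "\<dots> = (\<integral>\<^sup>+v. ?g v \<partial>lborel) * (\<integral>\<^sup>+p. \<integral>\<^sup>+c. ?f (vector [fst p, snd p, c]) \<partial>lborel \<partial>lborel)"
    by (rule nn_integral_multc) (use g in simp)
  also have "(\<integral>\<^sup>+p. \<integral>\<^sup>+c. ?f (vector [fst p, snd p, c]) \<partial>lborel \<partial>lborel) = (\<integral>\<^sup>+u. ?f u \<partial>lborel)"
    by (rule nn_integral_lborel_vector_3[OF f, symmetric])
  also have "(\<integral>\<^sup>+u. ?f u \<partial>lborel) = emeasure gauss_law A"
    by (simp add: gauss_law_def emeasure_density)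
  also have "(\<integral>\<^sup>+u. ?g u \<partial>lborel) = emeasure gauss_law B"
    by (simp add: gauss_law_def emeasure_density)
  finally show ?thesis by (simp add: mult.commute)
qed

lemma prob_space_data_law: "prob_space data_law"
proof
  interpret G: prob_space gauss_law by (rule prob_space_gauss_law)
  show "emeasure data_law (space data_law) = 1"
    using emeasure_data_law[of UNIV UNIV] G.emeasure_space_1 by simp
qed

definition proj_data :: "(5 \<Rightarrow> datum) \<Rightarrow> 5 + 5 \<Rightarrow> (real^3) proj" where
  "proj_data f = case_sum (\<lambda>i. Proj (data_u (f i))) (\<lambda>i. Proj (data_v (f i)))"

lemma measurable_proj_data:
  assumes "\<And>i. (\<lambda>t. f t i) \<in> borel_measurable M"
  shows "(\<lambda>t. proj_data (f t)) \<in> M \<rightarrow>\<^sub>M (\<Pi>\<^sub>M i\<in>UNIV. borel)"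
proof (rule measurable_PiM_single')
  fix i :: "5 + 5"
  note [measurable] = assms
  show "(\<lambda>t. proj_data (f t) i) \<in> M \<rightarrow>\<^sub>M borel"
    by (cases i) (simp_all add: proj_data_def)
qed (auto simp: space_PiM)

text \<open>Five independent data give ten independent lines: on rectangles the index set splits
  into its left and right summands, and \<open>emeasure_data_law\<close> factors every
  datum.\<close>

lemma distr_proj_data:
  "distr (\<Pi>\<^sub>M i\<in>UNIV. data_law) (\<Pi>\<^sub>M i\<in>UNIV. borel) proj_data
    = (\<Pi>\<^sub>M i\<in>UNIV. distr gauss_law borel Proj)"
proof -
  interpret D: prob_space data_law by (rule prob_space_data_law)
  interpret G: prob_space gauss_law by (rule prob_space_gauss_law)
  have mP: "Proj \<in> gauss_law \<rightarrow>\<^sub>M borel" by (simp add: measurable_cong_sets[OF sets_gauss_law refl])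
  interpret \<mu>: prob_space "distr gauss_law borel Proj" by (rule G.prob_space_distr[OF mP])
  interpret PD: product_sigma_finite "\<lambda>_::5. data_law" ..
  interpret PM: product_sigma_finite "\<lambda>_::5+5. distr gauss_law borel Proj" ..
  have m: "proj_data \<in> (\<Pi>\<^sub>M i\<in>UNIV. data_law) \<rightarrow>\<^sub>M (\<Pi>\<^sub>M i\<in>UNIV. borel)"
    by (rule measurable_proj_data[where f="\<lambda>t. t", simplified])
      (use measurable_component_singleton[of _ UNIV "\<lambda>_. data_law"] in \<open>simp add: measurable_cong_sets[OF refl sets_data_law]\<close>)
  show ?thesis
  proof (rule PM.PiM_eqI)
    show "sets (distr (\<Pi>\<^sub>M i\<in>UNIV. data_law) (\<Pi>\<^sub>M i\<in>UNIV. borel) proj_data)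
      = sets (\<Pi>\<^sub>M i\<in>UNIV. distr gauss_law borel Proj)"
      by (simp cong: sets_PiM_cong)
    fix X :: "5 + 5 \<Rightarrow> (real^3) proj set" assume "\<And>i. i \<in> UNIV \<Longrightarrow> X i \<in> sets (distr gauss_law borel Proj)"
    then have X: "X i \<in> sets borel" for i by simp
    have PX: "Proj -` X i \<in> sets borel" for i using measurable_sets[OF measurable_Proj X] by simp
    define Y where "Y i = {q. data_u q \<in> Proj -` X (Inl i) \<and> data_v q \<in> Proj -` X (Inr i)}" for i
    have Y: "Y i \<in> sets data_law" for i
    proof -
      have "Y i = data_u -` (Proj -` X (Inl i)) \<inter> data_v -` (Proj -` X (Inr i))" by (auto simp: Y_def)
      then show ?thesis
        using measurable_sets[OF measurable_data_u PX] measurable_sets[OF measurable_data_v PX] by simp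
    qed
    have eq: "proj_data -` (Pi\<^sub>E UNIV X) \<inter> space (\<Pi>\<^sub>M i\<in>(UNIV::5 set). data_law) = Pi\<^sub>E UNIV Y"
      by (auto simp: proj_data_def Y_def space_PiM PiE_iff split_sum_all)
    have "emeasure (distr (\<Pi>\<^sub>M i\<in>UNIV. data_law) (\<Pi>\<^sub>M i\<in>UNIV. borel) proj_data) (Pi\<^sub>E UNIV X)
      = emeasure (\<Pi>\<^sub>M i\<in>UNIV. data_law) (Pi\<^sub>E UNIV Y)"
      using X by (subst emeasure_distr[OF m]) (auto simp: eq intro!: sets_PiM_I_finite)
    also have "\<dots> = (\<Prod>i\<in>UNIV. emeasure data_law (Y i))"
      by (rule PD.emeasure_PiM) (use Y in auto)
    also have "\<dots> = (\<Prod>i\<in>UNIV. emeasure gauss_law (Proj -` X (Inl i))) * (\<Prod>i\<in>UNIV. emeasure gauss_law (Proj -` X (Inr i)))"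
      unfolding Y_def emeasure_data_law[OF PX PX] by (rule prod.distrib)
    also have "\<dots> = (\<Prod>i\<in>UNIV. emeasure gauss_law (Proj -` X i))"
      unfolding UNIV_sum by (subst prod.union_disjoint) (auto simp: prod.reindex)
    also have "\<dots> = (\<Prod>i\<in>UNIV. emeasure (distr gauss_law borel Proj) (X i))"
      using X by (intro prod.cong refl) (simp add: emeasure_distr[OF mP])
    finally show "emeasure (distr (\<Pi>\<^sub>M i\<in>UNIV. data_law) (\<Pi>\<^sub>M i\<in>UNIV. borel) proj_data) (Pi\<^sub>E UNIV X)
      = (\<Prod>i\<in>UNIV. emeasure (distr gauss_law borel Proj) (X i))" .
  qed simp
qed

definition num_essential :: "(5 + 5 \<Rightarrow> (real^3) proj) \<Rightarrow> ennreal" where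
  "num_essential w = num_points (essential_variety \<inter> epipolar_space (\<lambda>i. w (Inl i)) (\<lambda>i. w (Inr i)))"

lemma measurable_num_essential[measurable]: "num_essential \<in> borel_measurable (\<Pi>\<^sub>M i\<in>UNIV. borel)"
  unfolding num_essential_def[abs_def] by (rule measurable_num_points_essential)

lemma nn_integral_num_essential_PiM:
  "(\<integral>\<^sup>+w. num_essential w \<partial>(\<Pi>\<^sub>M i\<in>UNIV. distr gauss_law borel Proj))
    = (\<integral>\<^sup>+y. ennreal (\<Prod>i\<in>UNIV. data_density (y$i)) * num_essential (proj_data (\<lambda>i. y$i)) \<partial>lborel)"
proof -
  interpret D: prob_space data_law by (rule prob_space_data_law)
  have m: "proj_data \<in> (\<Pi>\<^sub>M i\<in>UNIV. data_law) \<rightarrow>\<^sub>M (\<Pi>\<^sub>M i\<in>UNIV. borel)"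
    by (rule measurable_proj_data[where f="\<lambda>t. t", simplified])
      (use measurable_component_singleton[of _ UNIV "\<lambda>_. data_law"] in \<open>simp add: measurable_cong_sets[OF refl sets_data_law]\<close>)
  have ml: "proj_data \<in> (\<Pi>\<^sub>M i\<in>UNIV. lborel) \<rightarrow>\<^sub>M (\<Pi>\<^sub>M i\<in>UNIV. borel)"
    by (rule measurable_proj_data[where f="\<lambda>t. t", simplified])
      (use measurable_component_singleton[of _ UNIV "\<lambda>_. lborel"] in \<open>simp add: measurable_cong_sets[OF refl sets_lborel]\<close>)
  have mv: "(\<lambda>y::datum^5. proj_data (\<lambda>i. y$i)) \<in> borel \<rightarrow>\<^sub>M (\<Pi>\<^sub>M i\<in>UNIV. borel)"
    by (rule measurable_proj_data) (intro borel_measurable_continuous_onI continuous_intros)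
  have md: "(\<lambda>y::datum^5. ennreal (\<Prod>i\<in>UNIV. data_density (y$i))) \<in> borel_measurable borel"
    by measurable
  have "(\<integral>\<^sup>+w. num_essential w \<partial>(\<Pi>\<^sub>M i\<in>UNIV. distr gauss_law borel Proj))
    = (\<integral>\<^sup>+f. num_essential (proj_data f) \<partial>(\<Pi>\<^sub>M i\<in>UNIV. data_law))"
    unfolding distr_proj_data[symmetric] by (rule nn_integral_distr[OF m]) simp
  also have "(\<Pi>\<^sub>M i\<in>(UNIV::5 set). data_law) = density (\<Pi>\<^sub>M i\<in>UNIV. lborel) (\<lambda>f. \<Prod>i\<in>UNIV. ennreal (data_density (f i)))"
    unfolding data_law_def
    by (rule density_PiM_component[symmetric])
      (use D.sigma_finite_measure_axioms sigma_finite_lborel in \<open>auto simp: data_law_def\<close>)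
  also have "(\<integral>\<^sup>+f. num_essential (proj_data f) \<partial>density (\<Pi>\<^sub>M i\<in>UNIV. lborel) (\<lambda>f. \<Prod>i\<in>UNIV. ennreal (data_density (f i))))
    = (\<integral>\<^sup>+f. (\<Prod>i\<in>UNIV. ennreal (data_density (f i))) * num_essential (proj_data f) \<partial>(\<Pi>\<^sub>M i\<in>UNIV. lborel))"
    by (rule nn_integral_density) (use measurable_compose[OF ml measurable_num_essential] in auto)
  also have "\<dots> = (\<integral>\<^sup>+f. (\<lambda>y. ennreal (\<Prod>i\<in>UNIV. data_density (y$i)) * num_essential (proj_data (\<lambda>i. y$i))) (\<chi> i. f i) \<partial>(\<Pi>\<^sub>M i\<in>UNIV. lborel))"
    by (simp add: prod_ennreal data_density_def gauss3_nonneg)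
  also have "\<dots> = (\<integral>\<^sup>+y. ennreal (\<Prod>i\<in>UNIV. data_density (y$i)) * num_essential (proj_data (\<lambda>i. y$i)) \<partial>lborel)"
    by (rule nn_integral_lborel_vec[symmetric])
      (intro borel_measurable_times_ennreal md measurable_compose[OF mv measurable_num_essential])
  finally show ?thesis .
qed

section \<open>The expected number of points\<close>

lemma nn_integral_lborel_transpose:
  fixes F :: "('a::euclidean_space \<times> 'b::euclidean_space)^'n \<Rightarrow> ennreal"
  assumes F: "F \<in> borel_measurable borel"
  shows "(\<integral>\<^sup>+y. F y \<partial>lborel) = (\<integral>\<^sup>+q. F (\<chi> i. (snd q $ i, fst q $ i)) \<partial>(lborel :: (('b^'n) \<times> ('a^'n)) measure))"
proof -
  let ?T = "\<lambda>x :: ('a \<times> 'b)^'n. (\<chi> i. snd (x $ i), \<chi> i. fst (x $ i))"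
  have T: "?T \<in> borel_measurable borel"
    by (intro borel_measurable_continuous_onI continuous_intros)
  have j: "(\<lambda>q::('b^'n) \<times> ('a^'n). \<chi> i. (snd q $ i, fst q $ i)) \<in> borel_measurable borel"
    by (intro borel_measurable_continuous_onI continuous_intros)
  have "(\<integral>\<^sup>+q. F (\<chi> i. (snd q $ i, fst q $ i)) \<partial>(lborel :: (('b^'n) \<times> ('a^'n)) measure))
    = (\<integral>\<^sup>+y. F (\<chi> i. (snd (?T y) $ i, fst (?T y) $ i)) \<partial>lborel)"
    by (subst lborel_transpose, subst nn_integral_distr) (use T measurable_compose[OF j F] in auto)
  also have "\<dots> = (\<integral>\<^sup>+y. F y \<partial>lborel)"
    by (intro nn_integral_cong arg_cong[where f=F]) (simp add: vec_eq_iff)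
  finally show ?thesis by simp
qed

lemma AE_lborel_transpose:
  assumes "AE y in (lborel :: (('a::euclidean_space \<times> 'b::euclidean_space)^'n) measure). P y"
  shows "AE p in lborel. AE c in lborel. P (\<chi> i. (c $ i, p $ i))"
proof -
  obtain N where N: "{y. \<not> P y} \<subseteq> N" "emeasure lborel N = 0" "N \<in> sets lborel"
    using assms by (elim AE_E) auto
  have Nb: "N \<in> sets borel" using N(3) by simp
  have j: "(\<lambda>q::('b^'n) \<times> ('a^'n). \<chi> i. (snd q $ i, fst q $ i)) \<in> borel_measurable borel"
    by (intro borel_measurable_continuous_onI continuous_intros)
  define Q where "Q = (\<lambda>q::('b^'n) \<times> ('a^'n). \<chi> i. (snd q $ i, fst q $ i)) -` N"
  have Qm: "Q \<in> sets lborel" using measurable_sets[OF j Nb] by (simp add: Q_def)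
  have "emeasure lborel Q = (\<integral>\<^sup>+q. indicator N (\<chi> i. (snd q $ i, fst q $ i)) \<partial>(lborel :: (('b^'n) \<times> ('a^'n)) measure))"
    using nn_integral_indicator[OF Qm] by (simp add: Q_def indicator_def)
  also have "\<dots> = (\<integral>\<^sup>+y. indicator N y \<partial>lborel)"
    by (rule nn_integral_lborel_transpose[symmetric]) (use Nb in simp)
  also have "\<dots> = 0" using N(2,3) by simp
  finally have "Q \<in> null_sets lborel" using Qm by auto
  then have "AE q in lborel. q \<notin> Q" by (rule AE_not_in)
  then have "AE q in lborel. P (\<chi> i. (snd q $ i, fst q $ i))"
    by (rule eventually_mono) (use N(1) in \<open>auto simp: Q_def\<close>)
  then have "AE q in lborel \<Otimes>\<^sub>M lborel. P (\<chi> i. (snd q $ i, fst q $ i))"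
    unfolding lborel_prod .
  from lborel_pair.AE_pair[OF this] show ?thesis by simp
qed

text \<open>Off the degenerate data all solutions in \<open>chart_closed\<close> lie in
  \<open>chart\<close> and have solvable equations, so that set can play the role of
  \<open>T\<close> in \<open>num_points_essential_chart\<close>.\<close>

lemma num_essential_proj_data_AE:
  "AE y in lborel. num_essential (proj_data (\<lambda>i. y$i))
    = num_points {x\<in>{x\<in>chart. \<forall>i. (ess x *v data_v (y$i)) $ 3 \<noteq> 0}. \<forall>i. data_u (y$i) \<bullet> (ess x *v data_v (y$i)) = 0}"
proof -
  have hp: "AE y in lborel. a \<bullet> y \<noteq> 0" if "a \<noteq> 0" for a :: "datum^5"
  proof -
    have "AE y in lebesgue. y \<notin> {y. a \<bullet> y = 0}"
      by (rule AE_not_in) (use that negligible_hyperplane[of a 0] in \<open>simp add: negligible_iff_null_sets\<close>)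
    then show ?thesis by (simp add: AE_completion_iff)
  qed
  have d: "AE y in lborel. y \<notin> degenerate_data"
  proof -
    have "AE y in lebesgue. y \<notin> degenerate_data"
      by (rule AE_not_in) (use negligible_degenerate_data in \<open>simp add: negligible_iff_null_sets\<close>)
    then show ?thesis by (simp add: AE_completion_iff)
  qed
  \<comment> \<open>One nonzero coordinate of each vector is enough for its line to be meaningful:
    the third of \<open>data_u\<close> here, the first of \<open>data_v\<close> below.\<close>
  have u: "AE y in lborel. \<forall>i\<in>UNIV. axis i (1, (0, 0), 0) \<bullet> (y :: datum^5) \<noteq> 0"
    by (intro AE_finite_allI hp) (auto simp: axis_eq_0_iff zero_prod_def)
  have v: "AE y in lborel. \<forall>i\<in>UNIV. axis i (0, (0, 0), axis 1 1) \<bullet> (y :: datum^5) \<noteq> 0"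
    by (intro AE_finite_allI hp) (auto simp: axis_eq_0_iff zero_prod_def)
  show ?thesis
    using d u v
  proof eventually_elim
    fix y assume y: "y \<notin> degenerate_data"
      and u: "\<forall>i\<in>UNIV. axis i (1, (0, 0), 0) \<bullet> y \<noteq> 0" and v: "\<forall>i\<in>UNIV. axis i (0, (0, 0), axis 1 1) \<bullet> y \<noteq> 0"
    have nz: "data_u (y$i) \<noteq> 0" "data_v (y$i) \<noteq> 0" for i
      using u[rule_format, of i] v[rule_format, of i]
      by (auto simp: inner_axis' inner_prod_def data_u_def data_v_def vec_eq_iff forall_3)
    show "num_essential (proj_data (\<lambda>i. y$i))
    = num_points {x\<in>{x\<in>chart. \<forall>i. (ess x *v data_v (y$i)) $ 3 \<noteq> 0}. \<forall>i. data_u (y$i) \<bullet> (ess x *v data_v (y$i)) = 0}"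
      unfolding num_essential_def proj_data_def sum.case
      by (rule num_points_essential_chart[OF nz]) (use y in \<open>auto simp: degenerate_data_def\<close>)
  qed
qed

lemma measurable_det[measurable (raw)]:
  fixes A :: "'a \<Rightarrow> real^'n^'n"
  assumes [measurable]: "A \<in> borel_measurable M"
  shows "(\<lambda>x. det (A x)) \<in> borel_measurable M"
  unfolding det_def by measurable

definition solved_rows :: "real^5 \<Rightarrow> (5 \<Rightarrow> partial_datum) \<Rightarrow> ennreal" where
  "solved_rows x f = ennreal \<bar>det (\<chi> i. ess_grad x (solved_point x (f i)) (snd (f i)))\<bar>
     * (\<Prod>i\<in>UNIV. ennreal (solved_density x (f i)))"

lemma solved_density_nonneg: "0 \<le> solved_density x p"
  by (simp add: solved_density_def gauss3_nonneg)

lemma measurable_solved_rows: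
  assumes x[measurable]: "x \<in> borel_measurable M" and f[measurable]: "\<And>i. (\<lambda>t. f t i) \<in> borel_measurable M"
  shows "(\<lambda>t. solved_rows (x t) (f t)) \<in> borel_measurable M"
proof -
  have [measurable]: "(\<lambda>t. snd (f t i)) \<in> borel_measurable M" for i
    by (rule measurable_compose[OF f], intro borel_measurable_continuous_onI continuous_intros)
  show ?thesis unfolding solved_rows_def by measurable
qed

text \<open>The area formula integrates out the five solved coordinates. The Gaussian weights,
  evaluated at the solutions, combine with the denominators of the Jacobian to the factors
  \<open>solved_density\<close>.\<close>

lemma nn_integral_num_essential_fixed:
  fixes p :: "partial_datum^5"
  assumes AE: "AE c in lborel. num_essential (proj_data (\<lambda>i. (c$i, p$i)))
    = num_points {x\<in>{x\<in>chart. \<forall>i. (ess x *v data_v (c$i, p$i)) $ 3 \<noteq> 0}.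
        \<forall>i. data_u (c$i, p$i) \<bullet> (ess x *v data_v (c$i, p$i)) = 0}"
  shows "(\<integral>\<^sup>+c. ennreal (\<Prod>i\<in>UNIV. data_density (c$i, p$i)) * num_essential (proj_data (\<lambda>i. (c$i, p$i))) \<partial>lborel)
    = (\<integral>\<^sup>+x. indicator chart x * solved_rows x (\<lambda>i. p$i) \<partial>lborel)"
proof -
  define a b v where "a = (\<chi> i. fst (fst (p$i)))" and "b = (\<chi> i. snd (fst (p$i)))" and "v = (\<chi> i. snd (p$i))"
  define h where "h c = ennreal (\<Prod>i\<in>UNIV. data_density (c$i, p$i))" for c :: "real^5"
  have h: "h \<in> borel_measurable borel"
  proof -
    have "(\<lambda>c::real^5. (c$i, p$i)) \<in> borel_measurable borel" for i
      by (intro borel_measurable_continuous_onI continuous_intros)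
    from measurable_compose[OF this measurable_data_density]
    have [measurable]: "(\<lambda>c::real^5. data_density (c$i, p$i)) \<in> borel_measurable borel" for i .
    show ?thesis unfolding h_def[abs_def] by measurable
  qed
  have "(\<integral>\<^sup>+c. ennreal (\<Prod>i\<in>UNIV. data_density (c$i, p$i)) * num_essential (proj_data (\<lambda>i. (c$i, p$i))) \<partial>lborel)
    = (\<integral>\<^sup>+c. num_points {x\<in>{x\<in>chart. \<forall>i. (ess x *v v$i)$3 \<noteq> 0}.
            \<forall>i. vector [a$i, b$i, c$i] \<bullet> (ess x *v v$i) = 0} * h c \<partial>lborel)"
    by (rule nn_integral_cong_AE, use AE in eventually_elim)
      (simp add: h_def a_def b_def v_def data_u_def data_v_def mult.commute)
  also have "\<dots> = (\<integral>\<^sup>+x. indicator {x\<in>chart. \<forall>i. (ess x *v v$i)$3 \<noteq> 0} x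
         * ennreal (\<bar>det (\<chi> i. ess_grad x (vector [a$i, b$i, (\<chi> i. epipolar_solve x (a$i) (b$i) (v$i)) $ i]) (v$i))\<bar> / (\<Prod>i\<in>UNIV. \<bar>(ess x *v v$i)$3\<bar>))
         * h (\<chi> i. epipolar_solve x (a$i) (b$i) (v$i)) \<partial>lborel)"
    by (rule area_ess[OF h])
  also have "\<dots> = (\<integral>\<^sup>+x. indicator chart x * solved_rows x (\<lambda>i. p$i) \<partial>lborel)"
  proof (rule nn_integral_cong)
    fix x
    let ?s = "\<chi> i. epipolar_solve x (a$i) (b$i) (v$i)"
    let ?det = "\<bar>det (\<chi> i. ess_grad x (vector [a$i, b$i, ?s $ i]) (v$i))\<bar>"
    have sp: "vector [a$i, b$i, ?s $ i] = solved_point x (p$i)" for i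
      by (simp add: solved_point_def a_def b_def v_def)
    have sv: "v$i = snd (p$i)" for i by (simp add: v_def)
    show "indicator {x\<in>chart. \<forall>i. (ess x *v v$i)$3 \<noteq> 0} x
         * ennreal (?det / (\<Prod>i\<in>UNIV. \<bar>(ess x *v v$i)$3\<bar>)) * h ?s
      = indicator chart x * solved_rows x (\<lambda>i. p$i)"
    proof (cases "x \<in> chart \<and> (\<forall>i. (ess x *v v$i)$3 \<noteq> 0)")
      case True
      have dd: "data_density (?s$i, p$i) / \<bar>(ess x *v v$i)$3\<bar> = solved_density x (p$i)" for i
        using True by (simp add: data_density_def solved_density_def data_u_def data_v_def a_def b_def v_def)
      have "ennreal (?det / (\<Prod>i\<in>UNIV. \<bar>(ess x *v v$i)$3\<bar>)) * h ?s
        = ennreal (?det / (\<Prod>i\<in>UNIV. \<bar>(ess x *v v$i)$3\<bar>) * (\<Prod>i\<in>UNIV. data_density (?s$i, p$i)))"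
        unfolding h_def by (rule ennreal_mult[symmetric])
          (auto intro!: divide_nonneg_nonneg prod_nonneg simp: data_density_def gauss3_nonneg)
      also have "?det / (\<Prod>i\<in>UNIV. \<bar>(ess x *v v$i)$3\<bar>) * (\<Prod>i\<in>UNIV. data_density (?s$i, p$i))
        = ?det * (\<Prod>i\<in>UNIV. solved_density x (p$i))"
        unfolding dd[symmetric] by (simp add: prod_dividef)
      also have "ennreal \<dots> = solved_rows x (\<lambda>i. p$i)"
        unfolding sp unfolding sv solved_rows_def
        by (simp add: ennreal_mult prod_ennreal prod_nonneg solved_density_nonneg)
      finally show ?thesis using True by simp
    next
      case False
      \<comment> \<open>The value 0 that \<open>solved_density\<close> takes at unsolvable equations
        allows the whole \<open>chart\<close> as domain.\<close>
      have "solved_rows x (\<lambda>i. p$i) = 0" if "(ess x *v v$i)$3 = 0" for i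
      proof -
        have "ennreal (solved_density x (p$i)) = 0" using that by (simp add: solved_density_def v_def)
        then have "(\<Prod>i\<in>UNIV. ennreal (solved_density x (p$i))) = 0" by (intro prod_zero) auto
        then show ?thesis unfolding solved_rows_def by simp
      qed
      then show ?thesis using False by (auto simp: indicator_def)
    qed
  qed
  finally show ?thesis .
qed

text \<open>The area formula works at fixed \<open>p\<close>, but independence of the rows is
  visible only at fixed \<open>x\<close>. Tonelli exchanges the two after the solved coordinates are
  gone.\<close>

lemma nn_integral_num_essential_chart:
  "(\<integral>\<^sup>+y. ennreal (\<Prod>i\<in>UNIV. data_density (y$i)) * num_essential (proj_data (\<lambda>i. y$i)) \<partial>lborel)
    = (\<integral>\<^sup>+x. indicator chart x * (\<integral>\<^sup>+f. solved_rows x f \<partial>(\<Pi>\<^sub>M i\<in>UNIV. lborel)) \<partial>lborel)"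
proof -
  define F where "F y = ennreal (\<Prod>i\<in>UNIV. data_density (y$i)) * num_essential (proj_data (\<lambda>i. y$i))"
    for y :: "datum^5"
  have mv: "(\<lambda>y::datum^5. proj_data (\<lambda>i. y$i)) \<in> borel \<rightarrow>\<^sub>M (\<Pi>\<^sub>M i\<in>UNIV. borel)"
    by (rule measurable_proj_data) (intro borel_measurable_continuous_onI continuous_intros)
  have md: "(\<lambda>y::datum^5. ennreal (\<Prod>i\<in>UNIV. data_density (y$i))) \<in> borel_measurable borel"
    by measurable
  have mF: "F \<in> borel_measurable borel"
    unfolding F_def[abs_def]
    by (intro borel_measurable_times_ennreal md measurable_compose[OF mv measurable_num_essential])
  have j: "(\<lambda>q::(partial_datum^5) \<times> (real^5). \<chi> i. (snd q $ i, fst q $ i)) \<in> borel_measurable borel"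
    by (intro borel_measurable_continuous_onI continuous_intros)
  define L where "L q = indicator chart (snd q) * solved_rows (snd q) (\<lambda>i. fst q $ i)"
    for q :: "(partial_datum^5) \<times> (real^5)"
  have mL: "L \<in> borel_measurable borel"
  proof -
    have "(\<lambda>q::(partial_datum^5) \<times> (real^5). snd q) \<in> borel_measurable borel"
      by (intro borel_measurable_continuous_onI continuous_intros)
    moreover have "(\<lambda>q::(partial_datum^5) \<times> (real^5). fst q $ i) \<in> borel_measurable borel" for i
      by (intro borel_measurable_continuous_onI continuous_intros)
    ultimately show ?thesis unfolding L_def[abs_def]
      by (intro borel_measurable_times_ennreal measurable_solved_rows measurable_compose[OF _ borel_measurable_indicator[OF chart_borel]])
  qed
  have "(\<integral>\<^sup>+y. F y \<partial>lborel) = (\<integral>\<^sup>+p. \<integral>\<^sup>+c. F (\<chi> i. (c$i, p$i)) \<partial>lborel \<partial>lborel)"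
    unfolding nn_integral_lborel_transpose[OF mF]
    using nn_integral_lborel_prod(1)[OF measurable_compose[OF j mF]] by simp
  also have "\<dots> = (\<integral>\<^sup>+p. \<integral>\<^sup>+x. L (p, x) \<partial>lborel \<partial>lborel)"
  proof (rule nn_integral_cong_AE, use AE_lborel_transpose[OF num_essential_proj_data_AE] in eventually_elim)
    fix p :: "partial_datum^5"
    assume "AE c in lborel. num_essential (proj_data (\<lambda>i. (\<chi> i. (c$i, p$i)) $ i))
      = num_points {x\<in>{x\<in>chart. \<forall>i. (ess x *v data_v ((\<chi> i. (c$i, p$i)) $ i)) $ 3 \<noteq> 0}.
        \<forall>i. data_u ((\<chi> i. (c$i, p$i)) $ i) \<bullet> (ess x *v data_v ((\<chi> i. (c$i, p$i)) $ i)) = 0}"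
    from nn_integral_num_essential_fixed[OF this[unfolded vec_lambda_beta]]
    show "(\<integral>\<^sup>+c. F (\<chi> i. (c$i, p$i)) \<partial>lborel) = (\<integral>\<^sup>+x. L (p, x) \<partial>lborel)"
      by (simp add: F_def L_def)
  qed
  also have "\<dots> = (\<integral>\<^sup>+x. \<integral>\<^sup>+p. L (p, x) \<partial>lborel \<partial>lborel)"
    using nn_integral_lborel_prod[OF mL] by simp
  also have "\<dots> = (\<integral>\<^sup>+x. indicator chart x * (\<integral>\<^sup>+f. solved_rows x f \<partial>(\<Pi>\<^sub>M i\<in>UNIV. lborel)) \<partial>lborel)"
  proof (rule nn_integral_cong)
    fix x
    have m: "(\<lambda>p::partial_datum^5. solved_rows x (\<lambda>i. p$i)) \<in> borel_measurable borel"
      by (rule measurable_solved_rows) (simp, intro borel_measurable_continuous_onI continuous_intros)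
    have "(\<integral>\<^sup>+p. L (p, x) \<partial>lborel) = indicator chart x * (\<integral>\<^sup>+p. solved_rows x (\<lambda>i. p$i) \<partial>lborel)"
      unfolding L_def fst_conv snd_conv by (rule nn_integral_cmult) (use m in simp)
    also have "(\<integral>\<^sup>+p. solved_rows x (\<lambda>i. p$i) \<partial>(lborel :: (partial_datum^5) measure)) = (\<integral>\<^sup>+f. solved_rows x f \<partial>(\<Pi>\<^sub>M i\<in>UNIV. lborel))"
      using nn_integral_lborel_vec[OF m] by simp
    finally show "(\<integral>\<^sup>+p. L (p, x) \<partial>lborel) = indicator chart x * (\<integral>\<^sup>+f. solved_rows x f \<partial>(\<Pi>\<^sub>M i\<in>UNIV. lborel))" .
  qed
  finally show ?thesis unfolding F_def .
qed

section \<open>The law of the rows\<close>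

definition std_normal :: "real measure" where
  "std_normal = density lborel (\<lambda>x. ennreal (std_normal_density x))"

definition unif_angle :: "real measure" where
  "unif_angle = density lborel (\<lambda>t. ennreal (indicator {0..<2 * pi} t / (2 * pi)))"

lemma sets_std_normal[measurable_cong, simp]: "sets std_normal = sets borel"
  by (simp add: std_normal_def)

lemma sets_unif_angle[measurable_cong, simp]: "sets unif_angle = sets borel"
  by (simp add: unif_angle_def)

lemma space_unif_angle[simp]: "space unif_angle = UNIV"
  by (simp add: unif_angle_def)

lemma prob_space_std_normal: "prob_space std_normal"
  unfolding std_normal_def by (rule prob_space_normal_density) simp

lemma uniform_measure_eq_unif_angle: "uniform_measure lborel {0..<2 * pi} = unif_angle"
  unfolding uniform_measure_def unif_angle_def
proof (rule density_cong)
  show "AE t in lborel. indicator {0..<2 * pi} t / emeasure lborel {0..<2 * pi} = ennreal (indicator {0..<2 * pi} t / (2 * pi))"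
    by (intro AE_I2) (simp add: divide_ennreal ennreal_indicator[symmetric] del: ennreal_indicator)
qed simp_all

lemma prob_space_unif_angle: "prob_space unif_angle"
  unfolding uniform_measure_eq_unif_angle[symmetric]
  by (rule prob_space_uniform_measure) simp_all

lemma density_pair_lborel:
  fixes f :: "'a::euclidean_space \<Rightarrow> real" and g :: "'b::euclidean_space \<Rightarrow> real"
  assumes "sigma_finite_measure (density lborel (\<lambda>x. ennreal (g x)))"
    and [measurable]: "f \<in> borel_measurable borel" "g \<in> borel_measurable borel"
    and nn: "\<And>x. 0 \<le> f x" "\<And>y. 0 \<le> g y"
  shows "density lborel (\<lambda>x. ennreal (f x)) \<Otimes>\<^sub>M density lborel (\<lambda>y. ennreal (g y))
    = density lborel (\<lambda>p. ennreal (f (fst p) * g (snd p)))"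
  using assms(1) nn
  by (subst pair_measure_density) (auto simp: lborel_prod sigma_finite_lborel case_prod_beta' ennreal_mult)

text \<open>Independence of the five parameters as a factorisation of their density; the nesting
  follows \<open>params\<close>, and each stage supplies the sigma-finiteness for the next.\<close>

lemma param_measure_eq:
  "density lborel param_density = std_normal \<Otimes>\<^sub>M (unif_angle \<Otimes>\<^sub>M (std_normal \<Otimes>\<^sub>M (std_normal \<Otimes>\<^sub>M std_normal)))"
proof -
  interpret G: prob_space std_normal by (rule prob_space_std_normal)
  interpret T: prob_space unif_angle by (rule prob_space_unif_angle)
  have sG: "sigma_finite_measure (density lborel (\<lambda>x. ennreal (std_normal_density x)))"
    using G.sigma_finite_measure_axioms by (simp add: std_normal_def)
  define g2 where "g2 = (\<lambda>p::real \<times> real. std_normal_density (fst p) * std_normal_density (snd p))"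
  define g3 where "g3 = (\<lambda>p::real \<times> real \<times> real. std_normal_density (fst p) * g2 (snd p))"
  define g4 where "g4 = (\<lambda>p::real \<times> real \<times> real \<times> real. indicator {0..<2 * pi} (fst p) / (2 * pi) * g3 (snd p))"
  have m2: "g2 \<in> borel_measurable borel" unfolding g2_def
    by (intro borel_measurable_times measurable_compose[OF _ borel_measurable_normal_density] borel_measurable_continuous_onI continuous_intros)
  have m3: "g3 \<in> borel_measurable borel" unfolding g3_def
    by (intro borel_measurable_times measurable_compose[OF _ borel_measurable_normal_density] measurable_compose[OF _ m2]
        borel_measurable_continuous_onI continuous_intros)
  have mt: "(\<lambda>t::real. indicator {0..<2 * pi} t / (2 * pi)) \<in> borel_measurable borel" by measurable
  have m4: "g4 \<in> borel_measurable borel" unfolding g4_def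
    by (intro borel_measurable_times measurable_compose[OF _ mt] measurable_compose[OF _ m3]
        borel_measurable_continuous_onI continuous_intros)
  have e2: "std_normal \<Otimes>\<^sub>M std_normal = density lborel (\<lambda>p. ennreal (g2 p))"
    unfolding std_normal_def g2_def by (rule density_pair_lborel[OF sG]) auto
  interpret P2: pair_prob_space std_normal std_normal ..
  have s2: "sigma_finite_measure (density lborel (\<lambda>p. ennreal (g2 p)))"
    using P2.P.sigma_finite_measure_axioms by (simp add: e2)
  have e3: "std_normal \<Otimes>\<^sub>M (std_normal \<Otimes>\<^sub>M std_normal) = density lborel (\<lambda>p. ennreal (g3 p))"
    unfolding e2 unfolding std_normal_def g3_def
    by (rule density_pair_lborel[OF s2 _ m2]) (auto simp: g2_def)
  interpret P3: pair_prob_space std_normal "std_normal \<Otimes>\<^sub>M std_normal" ..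
  have s3: "sigma_finite_measure (density lborel (\<lambda>p. ennreal (g3 p)))"
    using P3.P.sigma_finite_measure_axioms by (simp add: e3)
  have e4: "unif_angle \<Otimes>\<^sub>M (std_normal \<Otimes>\<^sub>M (std_normal \<Otimes>\<^sub>M std_normal)) = density lborel (\<lambda>p. ennreal (g4 p))"
    unfolding e3 unfolding unif_angle_def g4_def
    by (rule density_pair_lborel[OF s3 _ m3]) (auto simp: g2_def g3_def)
  interpret P4: pair_prob_space unif_angle "std_normal \<Otimes>\<^sub>M (std_normal \<Otimes>\<^sub>M std_normal)" ..
  have s4: "sigma_finite_measure (density lborel (\<lambda>p. ennreal (g4 p)))"
    using P4.P.sigma_finite_measure_axioms by (simp add: e4)
  have "std_normal \<Otimes>\<^sub>M (unif_angle \<Otimes>\<^sub>M (std_normal \<Otimes>\<^sub>M (std_normal \<Otimes>\<^sub>M std_normal)))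
    = density lborel (\<lambda>p. ennreal (std_normal_density (fst p) * g4 (snd p)))"
    unfolding e4 unfolding std_normal_def
    by (rule density_pair_lborel[OF s4 _ m4]) (auto simp: g2_def g3_def g4_def)
  also have "(\<lambda>p. ennreal (std_normal_density (fst p) * g4 (snd p))) = (\<lambda>q. ennreal (param_density q))"
    by (auto simp: param_density_def g2_def g3_def g4_def fun_eq_iff mult_ac)
  finally show ?thesis by simp
qed

definition param_law :: "params measure" where
  "param_law = std_normal \<Otimes>\<^sub>M (unif_angle \<Otimes>\<^sub>M (std_normal \<Otimes>\<^sub>M (std_normal \<Otimes>\<^sub>M std_normal)))"

lemma z_law_eq: "z_law = distr param_law borel zvec"
  unfolding z_law_def param_law_def param_measure_eq ..

lemma prob_space_param_law: "prob_space param_law"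
proof -
  interpret G: prob_space std_normal by (rule prob_space_std_normal)
  interpret T: prob_space unif_angle by (rule prob_space_unif_angle)
  interpret P2: pair_prob_space std_normal std_normal ..
  interpret P3: pair_prob_space std_normal "std_normal \<Otimes>\<^sub>M std_normal" ..
  interpret P4: pair_prob_space unif_angle "std_normal \<Otimes>\<^sub>M (std_normal \<Otimes>\<^sub>M std_normal)" ..
  interpret P5: pair_prob_space std_normal "unif_angle \<Otimes>\<^sub>M (std_normal \<Otimes>\<^sub>M (std_normal \<Otimes>\<^sub>M std_normal))" ..
  show ?thesis unfolding param_law_def by (rule P5.prob_space_axioms)
qed

lemma sets_param_law: "sets param_law = sets borel"
  unfolding param_law_def param_measure_eq[symmetric] by simp

lemma space_param_law[simp]: "space param_law = UNIV"
  using sets_eq_imp_space_eq[OF sets_param_law] by simp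

lemma prob_space_z_law: "prob_space z_law"
  unfolding z_law_eq
  by (rule prob_space.prob_space_distr[OF prob_space_param_law])
    (simp add: measurable_cong_sets[OF sets_param_law refl])

lemma sets_z_law[measurable_cong, simp]: "sets z_law = sets borel"
  by (simp add: z_law_def)

lemma space_z_law[simp]: "space z_law = UNIV"
  by (simp add: z_law_def)

definition expected_det :: ennreal where
  "expected_det = (\<integral>\<^sup>+f. ennreal \<bar>det (\<chi> i. f i)\<bar> \<partial>(\<Pi>\<^sub>M i\<in>(UNIV::5 set). z_law))"

lemma measurable_det_rows:
  assumes M: "sets M = sets borel"
  shows "(\<lambda>f. ennreal \<bar>det (\<chi> i. f i)\<bar>) \<in> borel_measurable (\<Pi>\<^sub>M i\<in>(UNIV::5 set). (M :: (real^5) measure))"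
proof -
  have [measurable]: "(\<lambda>f. f i) \<in> borel_measurable (\<Pi>\<^sub>M i\<in>(UNIV::5 set). (M :: (real^5) measure))" for i
    using measurable_component_singleton[of i UNIV "\<lambda>_. M"] by (simp add: measurable_cong_sets[OF refl M])
  have "(\<lambda>f. det (\<chi> i. f i)) \<in> borel_measurable (\<Pi>\<^sub>M i\<in>(UNIV::5 set). (M :: (real^5) measure))"
    unfolding det_def by measurable
  then show ?thesis by measurable
qed

text \<open>As an equality of measures, both of mass 1/2, the row identity can be raised to fifth
  product powers.\<close>

lemma distr_solved_rows:
  assumes x: "sin (x$2) \<noteq> 0"
  shows "distr (density lborel (\<lambda>p. ennreal (solved_density x p))) borel (\<lambda>p. ess_grad x (solved_point x p) (snd p))
    = distr (density z_law (\<lambda>_. ennreal (1/2))) borel (\<lambda>z. z v* grad_matrix x)" (is "?A = ?B")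
proof (rule measure_eqI)
  show "sets ?A = sets ?B" by simp
  fix S assume "S \<in> sets ?A"
  then have S: "S \<in> sets borel" by simp
  then have h: "indicator S \<in> borel_measurable borel" by simp
  have sd: "(\<lambda>p. solved_density x p) \<in> borel_measurable borel"
    by (rule measurable_solved_density) simp_all
  have row: "(\<lambda>p. ess_grad x (solved_point x p) (snd p)) \<in> borel_measurable borel"
    by (intro measurable_ess_grad measurable_solved_point) (simp_all, intro borel_measurable_continuous_onI continuous_intros)
  have gm: "(\<lambda>z. z v* grad_matrix x) \<in> borel_measurable borel"
    by (intro borel_measurable_continuous_onI, simp add: vector_matrix_mult_def, intro continuous_intros)
  have "emeasure ?A S = (\<integral>\<^sup>+w. indicator S w \<partial>?A)" using S by simp
  also have "\<dots> = (\<integral>\<^sup>+p. ennreal (solved_density x p) * indicator S (ess_grad x (solved_point x p) (snd p)) \<partial>lborel)"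
    using measurable_compose[OF row h] sd row h
    by (subst nn_integral_distr) (auto simp: nn_integral_density)
  also have "\<dots> = (\<integral>\<^sup>+z. ennreal (1/2) * indicator S (z v* grad_matrix x) \<partial>z_law)"
    by (rule nn_integral_solved_row[OF x h])
  also have "\<dots> = (\<integral>\<^sup>+w. indicator S w \<partial>?B)"
    using measurable_compose[OF gm h] gm h
    by (subst nn_integral_distr) (auto simp: nn_integral_density simp del: ennreal_half cong: measurable_cong_sets)
  also have "\<dots> = emeasure ?B S" using S by simp
  finally show "emeasure ?A S = emeasure ?B S" .
qed

section \<open>Integration over the chart\<close>

text \<open>The five rows are independent, each an image of \<open>z\<close> under the same matrix
  \<open>grad_matrix x\<close>. The factor 1/32 is (1/2)^5, the sines are the determinant of that
  matrix.\<close>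

lemma nn_integral_solved_rows:
  assumes x: "x \<in> chart"
  shows "(\<integral>\<^sup>+f. solved_rows x f \<partial>(\<Pi>\<^sub>M i\<in>UNIV. lborel)) = ennreal (\<bar>sin (x$2) * sin (x$4)\<bar> / 32) * expected_det"
proof -
  have s: "sin (x$2) \<noteq> 0" "sin (x$4) \<noteq> 0" using x by (auto simp: chart_def)
  interpret Z: prob_space z_law by (rule prob_space_z_law)
  define \<mu> where "\<mu> = density lborel (\<lambda>p. ennreal (solved_density x p))"
  define row where "row p = ess_grad x (solved_point x p) (snd p)" for p
  define T where "T z = z v* grad_matrix x" for z
  define Zh where "Zh = density z_law (\<lambda>_. ennreal (1/2))"
  have sd: "(\<lambda>p. solved_density x p) \<in> borel_measurable borel"
    by (rule measurable_solved_density) simp_all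
  have row: "row \<in> borel_measurable borel"
    unfolding row_def[abs_def]
    by (intro measurable_ess_grad measurable_solved_point) (simp_all, intro borel_measurable_continuous_onI continuous_intros)
  have T: "T \<in> borel_measurable borel"
    unfolding T_def[abs_def] by (intro borel_measurable_continuous_onI, simp add: vector_matrix_mult_def, intro continuous_intros)
  have eq: "distr \<mu> borel row = distr Zh borel T"
    unfolding \<mu>_def row_def[abs_def] T_def[abs_def] Zh_def by (rule distr_solved_rows[OF s(1)])
  have row\<mu>: "row \<in> \<mu> \<rightarrow>\<^sub>M borel" using row by (simp add: \<mu>_def)
  have TZ: "T \<in> Zh \<rightarrow>\<^sub>M borel" using T by (simp add: Zh_def measurable_cong_sets[OF sets_z_law refl])
  have Zh1: "emeasure Zh (space Zh) \<noteq> \<infinity>"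
    using Z.emeasure_space_1 by (simp add: Zh_def emeasure_density del: ennreal_half)
  then have Zhf: "finite_measure Zh" by (rule finite_measureI)
  then have fT: "finite_measure (distr Zh borel T)" by (rule finite_measure.finite_measure_distr[OF _ TZ])
  \<comment> \<open>Push-forwards keep the total mass, so finiteness of the \<open>z\<close> side
    passes to \<open>\<mu>\<close>; products of \<open>\<mu>\<close> require it to be
    sigma-finite.\<close>
  have \<mu>f: "finite_measure \<mu>"
  proof (rule finite_measureI)
    have "emeasure \<mu> (space \<mu>) = emeasure (distr \<mu> borel row) UNIV"
      by (subst emeasure_distr[OF row\<mu>]) auto
    then show "emeasure \<mu> (space \<mu>) \<noteq> \<infinity>"
      unfolding eq using finite_measure.emeasure_finite[OF fT, of UNIV] by simp
  qed
  have sig: "sigma_finite_measure \<mu>" "sigma_finite_measure Zh" "sigma_finite_measure (distr Zh borel T)"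
    "sigma_finite_measure z_law" "sigma_finite_measure (lborel :: partial_datum measure)"
    using \<mu>f Zhf fT Z.sigma_finite_measure_axioms sigma_finite_lborel by (auto simp: finite_measure_def)
  define D where "D f = ennreal \<bar>det (\<chi> i. f i)\<bar>" for f :: "5 \<Rightarrow> real^5"
  have mD: "D \<in> borel_measurable (\<Pi>\<^sub>M i\<in>UNIV. borel)"
    unfolding D_def[abs_def] by (rule measurable_det_rows) simp
  have comp: "(\<lambda>f i. g (f i)) \<in> (\<Pi>\<^sub>M i\<in>(UNIV::5 set). M) \<rightarrow>\<^sub>M (\<Pi>\<^sub>M i\<in>UNIV. borel)"
    if g: "g \<in> M \<rightarrow>\<^sub>M borel" for g :: "'z \<Rightarrow> real^5" and M
    by (rule measurable_PiM_single') (auto simp: space_PiM intro!: measurable_compose[OF _ g])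
  have rowl: "row \<in> lborel \<rightarrow>\<^sub>M borel" using row by simp
  have "(\<integral>\<^sup>+f. solved_rows x f \<partial>(\<Pi>\<^sub>M i\<in>UNIV. lborel))
    = (\<integral>\<^sup>+f. (\<Prod>i\<in>UNIV. ennreal (solved_density x (f i))) * D (\<lambda>i. row (f i)) \<partial>(\<Pi>\<^sub>M i\<in>UNIV. lborel))"
    by (intro nn_integral_cong) (simp add: solved_rows_def D_def row_def mult.commute)
  also have "\<dots> = (\<integral>\<^sup>+f. D (\<lambda>i. row (f i)) \<partial>density (\<Pi>\<^sub>M i\<in>UNIV. lborel) (\<lambda>f. \<Prod>i\<in>UNIV. ennreal (solved_density x (f i))))"
  proof (rule nn_integral_density[symmetric])
    have "(\<lambda>f. ennreal (solved_density x (f i))) \<in> borel_measurable (\<Pi>\<^sub>M i\<in>(UNIV::5 set). lborel)" for i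
      using measurable_compose[OF measurable_component_singleton[of i UNIV "\<lambda>_. lborel"], of "\<lambda>p. ennreal (solved_density x p)" borel] sd
      by simp
    then show "(\<lambda>f. \<Prod>i\<in>UNIV. ennreal (solved_density x (f i))) \<in> borel_measurable (\<Pi>\<^sub>M i\<in>(UNIV::5 set). lborel)"
      by (intro borel_measurable_prod_ennreal)
    show "(\<lambda>f. D (\<lambda>i. row (f i))) \<in> borel_measurable (\<Pi>\<^sub>M i\<in>(UNIV::5 set). lborel)"
      by (rule measurable_compose[OF comp[OF rowl] mD])
  qed
  also have "density (\<Pi>\<^sub>M i\<in>(UNIV::5 set). lborel) (\<lambda>f. \<Prod>i\<in>UNIV. ennreal (solved_density x (f i))) = (\<Pi>\<^sub>M i\<in>UNIV. \<mu>)"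
    unfolding \<mu>_def by (rule density_PiM_component[OF sig(5) sig(1)[unfolded \<mu>_def]]) (use sd in simp)
  also have "(\<integral>\<^sup>+f. D (\<lambda>i. row (f i)) \<partial>(\<Pi>\<^sub>M i\<in>UNIV. \<mu>)) = (\<integral>\<^sup>+f. D f \<partial>distr (\<Pi>\<^sub>M i\<in>UNIV. \<mu>) (\<Pi>\<^sub>M i\<in>UNIV. borel) (\<lambda>f i. row (f i)))"
    by (rule nn_integral_distr[OF comp[OF row\<mu>], symmetric]) (use mD in simp)
  also have "distr (\<Pi>\<^sub>M i\<in>UNIV. \<mu>) (\<Pi>\<^sub>M i\<in>UNIV. borel) (\<lambda>f i. row (f i)) = (\<Pi>\<^sub>M i\<in>(UNIV::5 set). distr \<mu> borel row)"
    by (rule distr_PiM_component[OF sig(1) _ row\<mu>]) (use sig eq in simp)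
  also have "\<dots> = distr (\<Pi>\<^sub>M i\<in>UNIV. Zh) (\<Pi>\<^sub>M i\<in>UNIV. borel) (\<lambda>f i. T (f i))"
    unfolding eq by (rule distr_PiM_component[OF sig(2,3) TZ, symmetric])
  also have "(\<integral>\<^sup>+f. D f \<partial>\<dots>) = (\<integral>\<^sup>+f. D (\<lambda>i. T (f i)) \<partial>(\<Pi>\<^sub>M i\<in>UNIV. Zh))"
    by (rule nn_integral_distr[OF comp[OF TZ]]) (use mD in simp)
  also have "(\<Pi>\<^sub>M i\<in>(UNIV::5 set). Zh) = density (\<Pi>\<^sub>M i\<in>UNIV. z_law) (\<lambda>f. \<Prod>i\<in>(UNIV::5 set). ennreal (1/2))"
    unfolding Zh_def by (rule density_PiM_component[OF sig(4) sig(2)[unfolded Zh_def], symmetric]) simp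
  also have "(\<integral>\<^sup>+f. D (\<lambda>i. T (f i)) \<partial>\<dots>) = (\<integral>\<^sup>+f. (\<Prod>i\<in>(UNIV::5 set). ennreal (1/2)) * D (\<lambda>i. T (f i)) \<partial>(\<Pi>\<^sub>M i\<in>UNIV. z_law))"
  proof (rule nn_integral_density)
    have "T \<in> z_law \<rightarrow>\<^sub>M borel" using T by (simp add: measurable_cong_sets[OF sets_z_law refl])
    then show "(\<lambda>f. D (\<lambda>i. T (f i))) \<in> borel_measurable (\<Pi>\<^sub>M i\<in>(UNIV::5 set). z_law)"
      by (rule measurable_compose[OF comp mD])
  qed simp
  also have "\<dots> = (\<integral>\<^sup>+f. ennreal (\<bar>sin (x$2) * sin (x$4)\<bar> / 32) * ennreal \<bar>det (\<chi> i. f i)\<bar> \<partial>(\<Pi>\<^sub>M i\<in>(UNIV::5 set). z_law))"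
  proof (rule nn_integral_cong)
    fix f :: "5 \<Rightarrow> real^5"
    have "(\<chi> i. T (f i)) = (\<chi> i. f i) ** grad_matrix x"
      by (simp add: T_def vec_eq_iff matrix_matrix_mult_def vector_matrix_mult_def mult.commute)
    then have "D (\<lambda>i. T (f i)) = ennreal (\<bar>det (\<chi> i. f i)\<bar> * \<bar>sin (x$2) * sin (x$4)\<bar>)"
      using det_grad_matrix[OF s] by (simp add: D_def det_mul abs_mult)
    moreover have "(\<Prod>i\<in>(UNIV::5 set). ennreal (1/2)) = ennreal (1/32)"
      by (subst prod_ennreal) (simp_all add: power_divide del: ennreal_half)
    ultimately show "(\<Prod>i\<in>(UNIV::5 set). ennreal (1/2)) * D (\<lambda>i. T (f i))
      = ennreal (\<bar>sin (x$2) * sin (x$4)\<bar> / 32) * ennreal \<bar>det (\<chi> i. f i)\<bar>"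
      by (simp only: ennreal_mult'[symmetric] ennreal_mult''[symmetric] abs_ge_zero) (simp add: mult_ac flip: ennreal_mult')
  qed
  also have "\<dots> = ennreal (\<bar>sin (x$2) * sin (x$4)\<bar> / 32) * expected_det"
    unfolding expected_det_def by (rule nn_integral_cmult) (rule measurable_det_rows, simp)
  finally show ?thesis .
qed

lemma nn_integral_abs_sin: "(\<integral>\<^sup>+t. ennreal \<bar>sin t\<bar> * indicator {0..pi} t \<partial>lborel) = 2"
proof -
  have "(\<integral>\<^sup>+t. ennreal \<bar>sin t\<bar> * indicator {0..pi} t \<partial>lborel) = (\<integral>\<^sup>+t. ennreal (sin t) * indicator {0..pi} t \<partial>lborel)"
    by (intro nn_integral_cong) (auto simp: sin_ge_zero split: split_indicator)
  also have "\<dots> = ennreal ((- cos pi) - (- cos 0))"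
    by (rule nn_integral_FTC_Icc) (auto intro!: derivative_eq_intros sin_ge_zero)
  finally show ?thesis by simp
qed

lemma nn_integral_chart:
  "(\<integral>\<^sup>+x. indicator chart x * ennreal (\<bar>sin (x$2) * sin (x$4)\<bar> / 32) \<partial>lborel) = ennreal (pi ^ 3 / 4)"
proof -
  interpret product_sigma_finite "\<lambda>_::5. (lborel :: real measure)" ..
  \<comment> \<open>Separation of variables, with 1/32 assigned to the first coordinate. Closed
    intervals may be used for the polar angles: the points that \<open>chart\<close> omits have a
    vanishing sine. The factors integrate to 2 pi / 32, 2, pi, 2 and pi.\<close>
  define g :: "5 \<Rightarrow> real \<Rightarrow> ennreal" where "g i t = (if i = 1 then ennreal (1/32) * indicator {0..<2 * pi} t
      else if i = 2 \<or> i = 4 then ennreal \<bar>sin t\<bar> * indicator {0..pi} t else indicator {0..<pi} t)" for i t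
  have mg: "g i \<in> borel_measurable lborel" for i
    unfolding g_def[abs_def] by (auto simp del: ennreal_half)
  have m: "(\<lambda>x::real^5. indicator chart x * ennreal (\<bar>sin (x$2) * sin (x$4)\<bar> / 32)) \<in> borel_measurable borel"
    by measurable
  have "(\<integral>\<^sup>+x. indicator chart x * ennreal (\<bar>sin (x$2) * sin (x$4)\<bar> / 32) \<partial>lborel)
    = (\<integral>\<^sup>+f. (\<Prod>i\<in>UNIV. g i (f i)) \<partial>(\<Pi>\<^sub>M i\<in>(UNIV::5 set). lborel))"
  proof (subst nn_integral_lborel_vec[OF m], rule nn_integral_cong)
    fix f :: "5 \<Rightarrow> real"
    show "indicator chart (\<chi> i. f i) * ennreal (\<bar>sin ((\<chi> i. f i)$2) * sin ((\<chi> i. f i)$4)\<bar> / 32) = (\<Prod>i\<in>UNIV. g i (f i))"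
    proof (cases "(\<chi> i. f i) \<in> chart")
      case True
      then have "(\<Prod>i\<in>UNIV. g i (f i)) = ennreal (1/32) * ennreal \<bar>sin (f 2)\<bar> * ennreal \<bar>sin (f 4)\<bar>"
        by (simp add: prod_5 g_def chart_def chart_closed_def)
      also have "\<dots> = ennreal (1/32 * \<bar>sin (f 2)\<bar> * \<bar>sin (f 4)\<bar>)"
        by (simp only: ennreal_mult''[symmetric] abs_ge_zero)
      finally show ?thesis using True by (simp add: abs_mult)
    next
      case False
      then have "(\<Prod>i\<in>UNIV. g i (f i)) = 0"
        by (auto simp: prod_5 g_def chart_def chart_closed_def indicator_def)
      then show ?thesis using False by simp
    qed
  qed
  also have "\<dots> = (\<Prod>i\<in>UNIV. integral\<^sup>N lborel (g i))"
    by (rule product_nn_integral_prod) (use mg in auto)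
  also have "\<dots> = ennreal (1/32) * ennreal (2 * pi) * 2 * ennreal pi * 2 * ennreal pi"
    by (simp add: prod_5 g_def[abs_def] nn_integral_abs_sin nn_integral_cmult)
  also have "\<dots> = ennreal (1/32 * (2 * pi) * 2 * pi * 2 * pi)"
    by (simp only: ennreal_numeral[symmetric] ennreal_mult''[symmetric] pi_ge_zero zero_le_numeral mult_nonneg_nonneg)
  also have "1/32 * (2 * pi) * 2 * pi * 2 * pi = pi ^ 3 / 4" by (simp add: power3_eq_cube)
  finally show ?thesis .
qed

lemma nn_integral_num_essential:
  "(\<integral>\<^sup>+w. num_essential w \<partial>(\<Pi>\<^sub>M i\<in>UNIV. distr gauss_law borel Proj)) = ennreal (pi ^ 3 / 4) * expected_det"
proof -
  have m: "(\<lambda>x::real^5. indicator chart x * ennreal (\<bar>sin (x$2) * sin (x$4)\<bar> / 32)) \<in> borel_measurable borel"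
    by measurable
  have "(\<integral>\<^sup>+w. num_essential w \<partial>(\<Pi>\<^sub>M i\<in>UNIV. distr gauss_law borel Proj))
    = (\<integral>\<^sup>+x. indicator chart x * (\<integral>\<^sup>+f. solved_rows x f \<partial>(\<Pi>\<^sub>M i\<in>UNIV. lborel)) \<partial>lborel)"
    unfolding nn_integral_num_essential_PiM nn_integral_num_essential_chart ..
  also have "\<dots> = (\<integral>\<^sup>+x. indicator chart x * ennreal (\<bar>sin (x$2) * sin (x$4)\<bar> / 32) * expected_det \<partial>lborel)"
    by (intro nn_integral_cong) (auto simp: nn_integral_solved_rows mult.assoc split: split_indicator)
  also have "\<dots> = ennreal (pi ^ 3 / 4) * expected_det"
    using m by (simp add: nn_integral_multc nn_integral_chart)
  finally show ?thesis .
qed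

section \<open>The expected determinant\<close>

lemma nn_integral_pair_mult:
  assumes "sigma_finite_measure M2" and f: "f \<in> borel_measurable M1" and g: "g \<in> borel_measurable M2"
  shows "(\<integral>\<^sup>+p. f (fst p) * g (snd p) \<partial>(M1 \<Otimes>\<^sub>M M2)) = (\<integral>\<^sup>+x. f x \<partial>M1) * (\<integral>\<^sup>+y. g y \<partial>M2)"
proof -
  interpret sigma_finite_measure M2 by fact
  note [measurable] = f g
  have "(\<integral>\<^sup>+p. f (fst p) * g (snd p) \<partial>(M1 \<Otimes>\<^sub>M M2)) = (\<integral>\<^sup>+x. \<integral>\<^sup>+y. f x * g y \<partial>M2 \<partial>M1)"
    by (subst nn_integral_fst[symmetric]) auto
  also have "\<dots> = (\<integral>\<^sup>+x. f x \<partial>M1) * (\<integral>\<^sup>+y. g y \<partial>M2)"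
    by (simp add: nn_integral_cmult nn_integral_multc)
  finally show ?thesis .
qed

lemma nn_integral_std_normal_abs_finite: "(\<integral>\<^sup>+x. ennreal (1 + \<bar>x\<bar>) \<partial>std_normal) < \<infinity>"
proof -
  have i: "integrable lborel (\<lambda>x. std_normal_density x * \<bar>x\<bar> ^ k)" for k
    by (rule integrable_std_normal_moment_abs)
  have "integrable lborel (\<lambda>x. std_normal_density x * (1 + \<bar>x\<bar>))"
    using Bochner_Integration.integrable_add[OF i[of 0] i[of 1]] by (simp add: distrib_left)
  then have "(\<integral>\<^sup>+x. ennreal (std_normal_density x * (1 + \<bar>x\<bar>)) \<partial>lborel) < \<infinity>"
    by (simp add: integrable_iff_bounded)
  also have "(\<integral>\<^sup>+x. ennreal (std_normal_density x * (1 + \<bar>x\<bar>)) \<partial>lborel) = (\<integral>\<^sup>+x. ennreal (1 + \<bar>x\<bar>) \<partial>std_normal)"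
    unfolding std_normal_def by (subst nn_integral_density) (auto simp: ennreal_mult)
  finally show ?thesis .
qed

definition row_sum :: "real^5 \<Rightarrow> real" where
  "row_sum z = (\<Sum>j\<in>UNIV. \<bar>z$j\<bar>)"

lemma measurable_row_sum: "row_sum \<in> borel_measurable borel"
  unfolding row_sum_def[abs_def] by measurable

text \<open>Each entry is a product of two of the four normal variables times a number of modulus at
  most 1. A bound by a full product of four factors lets the integral split by independence.\<close>

lemma row_sum_zvec: "row_sum (zvec (s, t, a, r, b)) \<le> 5 * ((1 + \<bar>s\<bar>) * ((1 + \<bar>a\<bar>) * ((1 + \<bar>r\<bar>) * (1 + \<bar>b\<bar>))))"
proof -
  have le: "\<bar>p\<bar> * \<bar>q\<bar> \<le> (1 + \<bar>p\<bar>) * ((1 + \<bar>q\<bar>) * ((1 + \<bar>u\<bar>) * (1 + \<bar>w\<bar>)))" for p q u w :: real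
  proof -
    have "\<bar>p\<bar> * (\<bar>q\<bar> * (1 * 1)) \<le> (1 + \<bar>p\<bar>) * ((1 + \<bar>q\<bar>) * ((1 + \<bar>u\<bar>) * (1 + \<bar>w\<bar>)))"
      by (intro mult_mono) auto
    then show ?thesis by simp
  qed
  have trig: "\<bar>p * q * sin t\<bar> \<le> \<bar>p\<bar> * \<bar>q\<bar>" "\<bar>p * q * cos t\<bar> \<le> \<bar>p\<bar> * \<bar>q\<bar>" for p q
    by (simp_all add: abs_mult mult_left_le)
  have "row_sum (zvec (s, t, a, r, b)) \<le> 2 * (\<bar>b\<bar> * \<bar>s\<bar>) + 2 * (\<bar>a\<bar> * \<bar>r\<bar>) + \<bar>s\<bar> * \<bar>r\<bar>"
    using trig[of b s] trig[of a r] by (simp add: row_sum_def zvec_def sum_5 vector_5) (simp add: abs_mult)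
  moreover have "\<bar>b\<bar> * \<bar>s\<bar> \<le> (1 + \<bar>s\<bar>) * ((1 + \<bar>a\<bar>) * ((1 + \<bar>r\<bar>) * (1 + \<bar>b\<bar>)))"
    using le[of b s a r] by (simp add: mult_ac)
  moreover have "\<bar>a\<bar> * \<bar>r\<bar> \<le> (1 + \<bar>s\<bar>) * ((1 + \<bar>a\<bar>) * ((1 + \<bar>r\<bar>) * (1 + \<bar>b\<bar>)))"
    using le[of a r s b] by (simp add: mult_ac)
  moreover have "\<bar>s\<bar> * \<bar>r\<bar> \<le> (1 + \<bar>s\<bar>) * ((1 + \<bar>a\<bar>) * ((1 + \<bar>r\<bar>) * (1 + \<bar>b\<bar>)))"
    using le[of s r a b] by (simp add: mult_ac)
  ultimately show ?thesis by linarith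
qed

lemma nn_integral_row_sum_finite: "(\<integral>\<^sup>+z. ennreal (row_sum z) \<partial>z_law) < \<infinity>"
proof -
  interpret G: prob_space std_normal by (rule prob_space_std_normal)
  interpret T: prob_space unif_angle by (rule prob_space_unif_angle)
  interpret P2: pair_prob_space std_normal std_normal ..
  interpret P3: pair_prob_space std_normal "std_normal \<Otimes>\<^sub>M std_normal" ..
  interpret P4: pair_prob_space unif_angle "std_normal \<Otimes>\<^sub>M (std_normal \<Otimes>\<^sub>M std_normal)" ..
  define e where "e x = ennreal (1 + \<bar>x\<bar>)" for x :: real
  have e: "e \<in> borel_measurable std_normal" unfolding e_def[abs_def] by measurable
  define e2 where "e2 p = e (fst p) * e (snd p)" for p
  define e3 where "e3 p = e (fst p) * e2 (snd p)" for p
  define e4 where "e4 p = 1 * e3 (snd p)" for p :: "real \<times> real \<times> real \<times> real"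
  have m2: "e2 \<in> borel_measurable (std_normal \<Otimes>\<^sub>M std_normal)" unfolding e2_def[abs_def] using e by measurable
  have m3: "e3 \<in> borel_measurable (std_normal \<Otimes>\<^sub>M (std_normal \<Otimes>\<^sub>M std_normal))"
    unfolding e3_def[abs_def] using e m2 by measurable
  have m4: "e4 \<in> borel_measurable (unif_angle \<Otimes>\<^sub>M (std_normal \<Otimes>\<^sub>M (std_normal \<Otimes>\<^sub>M std_normal)))"
    unfolding e4_def[abs_def] using m3 by measurable
  have mz: "zvec \<in> param_law \<rightarrow>\<^sub>M borel" by (simp add: measurable_cong_sets[OF sets_param_law refl])
  have m5: "(\<lambda>q. e (fst q) * e4 (snd q)) \<in> borel_measurable param_law"
    unfolding param_law_def using e m4 by measurable
  have "(\<integral>\<^sup>+z. ennreal (row_sum z) \<partial>z_law) = (\<integral>\<^sup>+q. ennreal (row_sum (zvec q)) \<partial>param_law)"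
    unfolding z_law_eq by (rule nn_integral_distr[OF mz]) (use measurable_row_sum in measurable)
  also have "\<dots> \<le> (\<integral>\<^sup>+q. 5 * (e (fst q) * e4 (snd q)) \<partial>param_law)"
  proof (rule nn_integral_mono)
    fix q :: "params"
    obtain s t a r b where q: "q = (s, t, a, r, b)" by (cases q) auto
    have "ennreal (row_sum (zvec q)) \<le> ennreal (5 * ((1 + \<bar>s\<bar>) * ((1 + \<bar>a\<bar>) * ((1 + \<bar>r\<bar>) * (1 + \<bar>b\<bar>)))))"
      unfolding q by (rule ennreal_leI) (rule row_sum_zvec)
    also have "\<dots> = 5 * (e (fst q) * e4 (snd q))"
      by (simp add: q e_def e2_def e3_def e4_def ennreal_mult)
    finally show "ennreal (row_sum (zvec q)) \<le> 5 * (e (fst q) * e4 (snd q))" .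
  qed
  also have "\<dots> = 5 * (\<integral>\<^sup>+q. e (fst q) * e4 (snd q) \<partial>param_law)"
    by (rule nn_integral_cmult[OF m5])
  also have "(\<integral>\<^sup>+q. e (fst q) * e4 (snd q) \<partial>param_law)
    = (\<integral>\<^sup>+x. e x \<partial>std_normal) * (\<integral>\<^sup>+p. e4 p \<partial>(unif_angle \<Otimes>\<^sub>M (std_normal \<Otimes>\<^sub>M (std_normal \<Otimes>\<^sub>M std_normal))))"
    unfolding param_law_def by (rule nn_integral_pair_mult[OF _ e m4]) (rule P4.P.sigma_finite_measure_axioms)
  also have "(\<integral>\<^sup>+p. e4 p \<partial>(unif_angle \<Otimes>\<^sub>M (std_normal \<Otimes>\<^sub>M (std_normal \<Otimes>\<^sub>M std_normal))))
    = (\<integral>\<^sup>+t. 1 \<partial>unif_angle) * (\<integral>\<^sup>+p. e3 p \<partial>(std_normal \<Otimes>\<^sub>M (std_normal \<Otimes>\<^sub>M std_normal)))"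
    unfolding e4_def by (rule nn_integral_pair_mult[OF _ _ m3]) (use P3.P.sigma_finite_measure_axioms in auto)
  also have "(\<integral>\<^sup>+p. e3 p \<partial>(std_normal \<Otimes>\<^sub>M (std_normal \<Otimes>\<^sub>M std_normal)))
    = (\<integral>\<^sup>+x. e x \<partial>std_normal) * (\<integral>\<^sup>+p. e2 p \<partial>(std_normal \<Otimes>\<^sub>M std_normal))"
    unfolding e3_def by (rule nn_integral_pair_mult[OF _ e m2]) (rule P2.P.sigma_finite_measure_axioms)
  also have "(\<integral>\<^sup>+p. e2 p \<partial>(std_normal \<Otimes>\<^sub>M std_normal)) = (\<integral>\<^sup>+x. e x \<partial>std_normal) * (\<integral>\<^sup>+x. e x \<partial>std_normal)"
    unfolding e2_def by (rule nn_integral_pair_mult[OF _ e e]) (rule G.sigma_finite_measure_axioms)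
  also have "(\<integral>\<^sup>+t. 1 \<partial>unif_angle) = 1" using T.emeasure_space_1 by simp
  finally have *: "(\<integral>\<^sup>+z. ennreal (row_sum z) \<partial>z_law) \<le> 5 * ((\<integral>\<^sup>+x. e x \<partial>std_normal) * (1 * ((\<integral>\<^sup>+x. e x \<partial>std_normal)
    * ((\<integral>\<^sup>+x. e x \<partial>std_normal) * (\<integral>\<^sup>+x. e x \<partial>std_normal)))))" .
  have I: "(\<integral>\<^sup>+x. e x \<partial>std_normal) < \<infinity>"
    unfolding e_def by (rule nn_integral_std_normal_abs_finite)
  show ?thesis
    by (rule le_less_trans[OF *]) (use I in \<open>simp add: ennreal_mult_less_top\<close>)
qed

text \<open>A crude Leibniz bound. It is a product over the rows, so its mean is a product of five
  finite means.\<close>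

lemma abs_det_le_prod_row_sum: "\<bar>det (A :: real^5^5)\<bar> \<le> real (card {p. p permutes (UNIV::5 set)}) * (\<Prod>i\<in>UNIV. row_sum (A$i))"
proof -
  have "\<bar>det A\<bar> \<le> (\<Sum>p | p permutes (UNIV::5 set). \<bar>of_int (sign p) * (\<Prod>i\<in>UNIV. A$i$p i)\<bar>)"
    unfolding det_def by (rule sum_abs)
  also have "\<dots> \<le> (\<Sum>p | p permutes (UNIV::5 set). (\<Prod>i\<in>UNIV. row_sum (A$i)))"
  proof (rule sum_mono)
    fix p :: "5 \<Rightarrow> 5"
    have "\<bar>of_int (sign p) * (\<Prod>i\<in>UNIV. A$i$p i)\<bar> = (\<Prod>i\<in>UNIV. \<bar>A$i$p i\<bar>)"
      by (simp add: abs_mult abs_prod sign_def)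
    also have "\<dots> \<le> (\<Prod>i\<in>UNIV. row_sum (A$i))"
      by (rule prod_mono) (auto simp: row_sum_def intro!: member_le_sum)
    finally show "\<bar>of_int (sign p) * (\<Prod>i\<in>UNIV. A$i$p i)\<bar> \<le> (\<Prod>i\<in>UNIV. row_sum (A$i))" .
  qed
  also have "\<dots> = real (card {p. p permutes (UNIV::5 set)}) * (\<Prod>i\<in>UNIV. row_sum (A$i))" by simp
  finally show ?thesis .
qed

lemma expected_det_finite: "expected_det < \<infinity>"
proof -
  interpret Z: prob_space z_law by (rule prob_space_z_law)
  interpret product_sigma_finite "\<lambda>_::5. z_law" ..
  let ?c = "real (card {p. p permutes (UNIV::5 set)})"
  have mr: "(\<lambda>z. ennreal (row_sum z)) \<in> borel_measurable z_law"
    using measurable_row_sum by (simp add: measurable_cong_sets[OF sets_z_law refl])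
  have mrf: "(\<lambda>f. ennreal (row_sum (f i))) \<in> borel_measurable (\<Pi>\<^sub>M i\<in>(UNIV::5 set). z_law)" for i
    by (rule measurable_compose[OF measurable_component_singleton[of i UNIV "\<lambda>_. z_law"] mr]) simp
  have "expected_det \<le> (\<integral>\<^sup>+f. ennreal ?c * (\<Prod>i\<in>UNIV. ennreal (row_sum (f i))) \<partial>(\<Pi>\<^sub>M i\<in>(UNIV::5 set). z_law))"
    unfolding expected_det_def
  proof (rule nn_integral_mono)
    fix f :: "5 \<Rightarrow> real^5"
    have "ennreal \<bar>det (\<chi> i. f i)\<bar> \<le> ennreal (?c * (\<Prod>i\<in>UNIV. row_sum (f i)))"
      by (rule ennreal_leI) (use abs_det_le_prod_row_sum[of "\<chi> i. f i"] in simp)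
    also have "\<dots> = ennreal ?c * (\<Prod>i\<in>UNIV. ennreal (row_sum (f i)))"
      by (subst prod_ennreal) (auto simp: row_sum_def sum_nonneg ennreal_mult')
    finally show "ennreal \<bar>det (\<chi> i. f i)\<bar> \<le> ennreal ?c * (\<Prod>i\<in>UNIV. ennreal (row_sum (f i)))" .
  qed
  also have "\<dots> = ennreal ?c * (\<Prod>i\<in>(UNIV::5 set). (\<integral>\<^sup>+z. ennreal (row_sum z) \<partial>z_law))"
  proof -
    have "(\<integral>\<^sup>+f. (\<Prod>i\<in>UNIV. ennreal (row_sum (f i))) \<partial>(\<Pi>\<^sub>M i\<in>(UNIV::5 set). z_law))
      = (\<Prod>i\<in>(UNIV::5 set). (\<integral>\<^sup>+z. ennreal (row_sum z) \<partial>z_law))"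
      by (rule product_nn_integral_prod) (use mr in auto)
    then show ?thesis
      using mrf by (subst nn_integral_cmult) (auto intro: borel_measurable_prod_ennreal)
  qed
  also have "\<dots> < \<infinity>"
    using nn_integral_row_sum_finite by (simp add: prod_5 ennreal_mult_less_top del: prod_constant)
  finally show ?thesis .
qed

text \<open>Both families are compared through their joint law on the index set {..<5}: for the
  given variables it is a product by independence, for the components of \<open>param_law\<close>
  this is checked on rectangles.\<close>

lemma distr_z_eq_z_law:
  assumes N: "prob_space N"
    and ind: "prob_space.indep_vars N (\<lambda>_. borel) (\<lambda>i. [a, b, r, s, \<theta>] ! i) {..<5}"
    and d: "distributed N lborel a (normal_density 0 1)" "distributed N lborel b (normal_density 0 1)"
      "distributed N lborel r (normal_density 0 1)" "distributed N lborel s (normal_density 0 1)"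
    and \<theta>: "distr N borel \<theta> = uniform_measure lborel {0..<2 * pi}"
    and z: "\<And>\<omega>. z \<omega> = vector [b \<omega> * r \<omega> * sin (\<theta> \<omega>), b \<omega> * r \<omega> * cos (\<theta> \<omega>),
                          a \<omega> * s \<omega> * sin (\<theta> \<omega>), a \<omega> * s \<omega> * cos (\<theta> \<omega>), r \<omega> * s \<omega>]"
  shows "distr N borel z = z_law" and "z \<in> borel_measurable N"
proof -
  interpret N: prob_space N by fact
  interpret G: prob_space std_normal by (rule prob_space_std_normal)
  interpret T: prob_space unif_angle by (rule prob_space_unif_angle)
  interpret P2: pair_prob_space std_normal std_normal ..
  interpret P3: pair_prob_space std_normal "std_normal \<Otimes>\<^sub>M std_normal" ..
  interpret P4: pair_prob_space unif_angle "std_normal \<Otimes>\<^sub>M (std_normal \<Otimes>\<^sub>M std_normal)" ..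
  define X where "X i = [a, b, r, s, \<theta>] ! i" for i :: nat
  have five: "{..<5::nat} = {0, 1, 2, 3, 4}" by auto
  then have ne: "{..<5::nat} \<noteq> {}" by simp
  have Xi: "X 0 = a" "X 1 = b" "X 2 = r" "X 3 = s" "X 4 = \<theta>" by (simp_all add: X_def numeral_eq_Suc)
  have rv: "X i \<in> borel_measurable N" if "i \<in> {..<5}" for i
    using ind that unfolding N.indep_vars_def X_def by auto
  have law: "distr N borel Y = std_normal" if "distributed N lborel Y (normal_density 0 1)" for Y
  proof -
    have "distr N borel Y = distr N lborel Y" by (rule distr_cong) simp_all
    also have "\<dots> = std_normal" unfolding std_normal_def by (rule distributed_distr_eq_density[OF that])
    finally show ?thesis .
  qed
  define m where "m i = (if i = 4 then unif_angle else std_normal)" for i :: nat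
  have lawX: "distr N borel (X i) = m i" if "i \<in> {..<5}" for i
    using that law[OF d(1)] law[OF d(2)] law[OF d(3)] law[OF d(4)] \<theta> Xi
    unfolding five by (auto simp: m_def uniform_measure_eq_unif_angle)
  have PX: "distr N (\<Pi>\<^sub>M i\<in>{..<5}. borel) (\<lambda>\<omega>. \<lambda>i\<in>{..<5}. X i \<omega>) = (\<Pi>\<^sub>M i\<in>{..<5}. m i)"
  proof -
    have "distr N (\<Pi>\<^sub>M i\<in>{..<5}. borel) (\<lambda>\<omega>. \<lambda>i\<in>{..<5}. X i \<omega>) = (\<Pi>\<^sub>M i\<in>{..<5}. distr N borel (X i))"
      using N.indep_vars_iff_distr_eq_PiM'[OF ne, of X "\<lambda>_. borel"] ind rv by (simp add: X_def[abs_def])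
    also have "\<dots> = (\<Pi>\<^sub>M i\<in>{..<5}. m i)" by (intro PiM_cong refl lawX)
    finally show ?thesis .
  qed
  have pm: "prob_space (m i)" for i by (simp add: m_def prob_space_std_normal prob_space_unif_angle)
  interpret PM: product_sigma_finite m
    by (simp add: product_sigma_finite_def prob_space_imp_sigma_finite pm)
  \<comment> \<open>Positions 2 and 3 belong to \<open>r\<close> and \<open>s\<close> of the theorem
    and receive \<open>s\<close> and \<open>r\<close> of \<open>params\<close>; this is the exchange
    built into \<open>zvec\<close>.\<close>
  define K where "K = (\<lambda>(s::real, t::real, a::real, r::real, b::real). (\<lambda>i\<in>{..<5::nat}. [a, b, s, r, t] ! i))"
  have Kv: "K (s, t, a, r, b) 0 = a" "K (s, t, a, r, b) 1 = b" "K (s, t, a, r, b) (Suc 0) = b"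
    "K (s, t, a, r, b) 2 = s" "K (s, t, a, r, b) 3 = r" "K (s, t, a, r, b) 4 = t" for s t a r b
    by (simp_all add: K_def numeral_eq_Suc)
  have sm: "sets (m i) = sets borel" for i by (simp add: m_def)
  have K: "K \<in> param_law \<rightarrow>\<^sub>M (\<Pi>\<^sub>M i\<in>{..<5}. borel)"
  proof -
    have "(\<lambda>q. [fst (snd (snd q)), snd (snd (snd (snd q))), fst q, fst (snd (snd (snd q))), fst (snd q)] ! i)
      \<in> borel_measurable param_law" if "i \<in> {..<5}" for i
      using that unfolding five measurable_cong_sets[OF sets_param_law refl]
      by (elim insertE emptyE; simp add: numeral_eq_Suc) (intro borel_measurable_continuous_onI continuous_intros)+
    then show ?thesis
      unfolding K_def case_prod_beta' by (intro measurable_restrict) auto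
  qed
  have PK: "distr param_law (\<Pi>\<^sub>M i\<in>{..<5}. borel) K = (\<Pi>\<^sub>M i\<in>{..<5}. m i)"
  proof (rule PM.PiM_eqI)
    show "sets (distr param_law (\<Pi>\<^sub>M i\<in>{..<5}. borel) K) = sets (\<Pi>\<^sub>M i\<in>{..<5}. m i)"
      by (simp add: sm cong: sets_PiM_cong)
    fix A assume "\<And>i. i \<in> {..<5::nat} \<Longrightarrow> A i \<in> sets (m i)"
    then have A: "\<And>i. i \<in> {..<5::nat} \<Longrightarrow> A i \<in> sets borel" by (simp add: sm)
    have A': "A 0 \<in> sets borel" "A 1 \<in> sets borel" "A 2 \<in> sets borel" "A 3 \<in> sets borel" "A 4 \<in> sets borel"
      using A by auto
    have "K (s, t, a, r, b) \<in> Pi\<^sub>E {..<5} A \<longleftrightarrow> (\<forall>i\<in>{..<5}. K (s, t, a, r, b) i \<in> A i)" for s t a r b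
      by (simp only: PiE_iff) (simp add: K_def)
    then have "K (s, t, a, r, b) \<in> Pi\<^sub>E {..<5} A \<longleftrightarrow> s \<in> A 2 \<and> t \<in> A 4 \<and> a \<in> A 0 \<and> r \<in> A 3 \<and> b \<in> A 1" for s t a r b
      unfolding five by (simp add: Kv conj_ac)
    then have "K -` Pi\<^sub>E {..<5} A \<inter> space param_law = A 2 \<times> (A 4 \<times> (A 0 \<times> (A 3 \<times> A 1)))"
      by auto
    then have "emeasure (distr param_law (\<Pi>\<^sub>M i\<in>{..<5}. borel) K) (Pi\<^sub>E {..<5} A)
      = emeasure param_law (A 2 \<times> (A 4 \<times> (A 0 \<times> (A 3 \<times> A 1))))"
      using A by (subst emeasure_distr[OF K]) (auto intro!: sets_PiM_I_finite)
    also have "\<dots> = emeasure std_normal (A 2) * (emeasure unif_angle (A 4) * (emeasure std_normal (A 0)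
        * (emeasure std_normal (A 3) * emeasure std_normal (A 1))))"
    proof -
      have s2: "A 3 \<times> A 1 \<in> sets (std_normal \<Otimes>\<^sub>M std_normal)" using A' by (intro pair_measureI) auto
      have s3: "A 0 \<times> (A 3 \<times> A 1) \<in> sets (std_normal \<Otimes>\<^sub>M (std_normal \<Otimes>\<^sub>M std_normal))" using A' s2 by (intro pair_measureI) auto
      have s4: "A 4 \<times> (A 0 \<times> (A 3 \<times> A 1)) \<in> sets (unif_angle \<Otimes>\<^sub>M (std_normal \<Otimes>\<^sub>M (std_normal \<Otimes>\<^sub>M std_normal)))"
        using A' s3 by (intro pair_measureI) auto
      show ?thesis unfolding param_law_def
        using A' s2 s3 s4
        by (simp add: P4.P.emeasure_pair_measure_Times P3.P.emeasure_pair_measure_Times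
            P2.P.emeasure_pair_measure_Times G.emeasure_pair_measure_Times)
    qed
    also have "\<dots> = (\<Prod>i\<in>{..<5}. emeasure (m i) (A i))"
      unfolding five by (simp add: m_def mult_ac)
    finally show "emeasure (distr param_law (\<Pi>\<^sub>M i\<in>{..<5}. borel) K) (Pi\<^sub>E {..<5} A) = (\<Prod>i\<in>{..<5}. emeasure (m i) (A i))" .
  qed simp
  define Zf where "Zf g = zvec (g 2, g 4, g 0, g 3, g 1)" for g :: "nat \<Rightarrow> real"
  have Zf: "Zf \<in> (\<Pi>\<^sub>M i\<in>{..<5}. borel) \<rightarrow>\<^sub>M borel"
  proof -
    have c: "(\<lambda>g. g i) \<in> borel_measurable (\<Pi>\<^sub>M i\<in>{..<5}. borel)" if "i < 5" for i :: nat
      by (rule measurable_component_singleton) (use that in simp)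
    show ?thesis unfolding Zf_def[abs_def]
      by (rule measurable_compose[OF _ measurable_zvec]) (intro borel_measurable_Pair c; simp)
  qed
  have Xm: "(\<lambda>\<omega>. \<lambda>i\<in>{..<5}. X i \<omega>) \<in> N \<rightarrow>\<^sub>M (\<Pi>\<^sub>M i\<in>{..<5}. borel)"
    by (intro measurable_restrict rv)
  have zX: "z = (\<lambda>\<omega>. Zf (\<lambda>i\<in>{..<5}. X i \<omega>))"
    by (rule ext) (simp add: z Zf_def zvec_def Xi[unfolded One_nat_def] Xi)
  have "distr N borel z = distr (distr N (\<Pi>\<^sub>M i\<in>{..<5}. borel) (\<lambda>\<omega>. \<lambda>i\<in>{..<5}. X i \<omega>)) borel Zf"
    unfolding zX by (subst distr_distr[OF Zf Xm]) (simp add: comp_def)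
  also have "\<dots> = distr param_law borel (Zf \<circ> K)"
    unfolding PX PK[symmetric] by (rule distr_distr[OF Zf K])
  also have "Zf \<circ> K = zvec" by (simp add: fun_eq_iff Zf_def Kv)
  finally show "distr N borel z = z_law" by (simp add: z_law_eq)
  show "z \<in> borel_measurable N" unfolding zX by (rule measurable_compose[OF Xm Zf])
qed

theorem theorem1p3:
  fixes H :: "(real^3^3) measure" and a0 :: "(real^3) proj"
    and M :: "'m measure" and u v :: "5 \<Rightarrow> 'm \<Rightarrow> (real^3) proj"
    and N :: "'n measure" and a b r s \<theta> :: "'n \<Rightarrow> real" and z :: "'n \<Rightarrow> real^5"
    and K :: "'k measure" and Z :: "5 \<Rightarrow> 'k \<Rightarrow> real^5"
  assumes "normalized_haar_O3 H"
    and "prob_space M"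
    and "prob_space.indep_vars M (\<lambda>_. borel) (case_sum u v) (UNIV :: (5 + 5) set)"
    and "\<And>i. distr M borel (u i) = unif_RP2 H a0"
    and "\<And>i. distr M borel (v i) = unif_RP2 H a0"
    and "prob_space N"
    and "prob_space.indep_vars N (\<lambda>_. borel) (\<lambda>i. [a, b, r, s, \<theta>] ! i) {..<5}"
    and "distributed N lborel a (normal_density 0 1)"
    and "distributed N lborel b (normal_density 0 1)"
    and "distributed N lborel r (normal_density 0 1)"
    and "distributed N lborel s (normal_density 0 1)"
    and "distr N borel \<theta> = uniform_measure lborel {0..<2 * pi}"
    and "\<And>\<omega>. z \<omega> = vector [b \<omega> * r \<omega> * sin (\<theta> \<omega>), b \<omega> * r \<omega> * cos (\<theta> \<omega>),
                          a \<omega> * s \<omega> * sin (\<theta> \<omega>), a \<omega> * s \<omega> * cos (\<theta> \<omega>), r \<omega> * s \<omega>]"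
    and "prob_space K"
    and "prob_space.indep_vars K (\<lambda>_. borel) Z UNIV"
    and "\<And>i. distr K borel (Z i) = distr N borel z"
  shows "(\<lambda>\<omega>. num_points (essential_variety \<inter> epipolar_space (\<lambda>i. u i \<omega>) (\<lambda>i. v i \<omega>)))
           \<in> borel_measurable M \<and>
         (\<integral>\<^sup>+\<omega>. num_points (essential_variety \<inter> epipolar_space (\<lambda>i. u i \<omega>) (\<lambda>i. v i \<omega>)) \<partial>M) =
           ennreal (pi ^ 3 / 4 * (\<integral>\<omega>. \<bar>det (\<chi> i j. Z j \<omega> $ i)\<bar> \<partial>K))"
proof -
  interpret M: prob_space M by fact
  interpret K: prob_space K by fact
  define W where "W \<omega> = (\<lambda>i. case_sum u v i \<omega>)" for \<omega>
  have rv: "case_sum u v i \<in> borel_measurable M" for i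
    using assms(3) by (simp add: M.indep_vars_def)
  have W: "W \<in> M \<rightarrow>\<^sub>M (\<Pi>\<^sub>M i\<in>UNIV. borel)"
    unfolding W_def by (rule measurable_PiM_single') (use rv in \<open>auto simp: space_PiM\<close>)
  have num: "num_points (essential_variety \<inter> epipolar_space (\<lambda>i. u i \<omega>) (\<lambda>i. v i \<omega>)) = num_essential (W \<omega>)" for \<omega>
    by (simp add: num_essential_def W_def)
  have lawW: "distr M (\<Pi>\<^sub>M i\<in>UNIV. borel) W = (\<Pi>\<^sub>M i\<in>UNIV. distr gauss_law borel Proj)"
  proof -
    have "distr M (\<Pi>\<^sub>M i\<in>UNIV. borel) (\<lambda>\<omega>. \<lambda>i\<in>UNIV. case_sum u v i \<omega>) = (\<Pi>\<^sub>M i\<in>UNIV. distr M borel (case_sum u v i))"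
      using M.indep_vars_iff_distr_eq_PiM[of UNIV "case_sum u v" "\<lambda>_. borel"] assms(3) rv by auto
    also have "\<dots> = (\<Pi>\<^sub>M i\<in>UNIV. distr gauss_law borel Proj)"
      by (rule PiM_cong) (use assms(4,5) unif_RP2_eq_gauss[OF assms(1)] in \<open>auto split: sum.split\<close>)
    finally show ?thesis by (simp add: W_def[abs_def] restrict_def)
  qed
  have zN: "distr N borel z = z_law"
    by (rule distr_z_eq_z_law(1)[OF assms(6-13)])
  have rvZ: "Z i \<in> borel_measurable K" for i
    using assms(15) by (simp add: K.indep_vars_def)
  define Q where "Q \<omega> = (\<lambda>i. Z i \<omega>)" for \<omega>
  have Q: "Q \<in> K \<rightarrow>\<^sub>M (\<Pi>\<^sub>M i\<in>UNIV. borel)"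
    unfolding Q_def by (rule measurable_PiM_single') (use rvZ in \<open>auto simp: space_PiM\<close>)
  have lawQ: "distr K (\<Pi>\<^sub>M i\<in>UNIV. borel) Q = (\<Pi>\<^sub>M i\<in>UNIV. z_law)"
  proof -
    have "distr K (\<Pi>\<^sub>M i\<in>UNIV. borel) (\<lambda>\<omega>. \<lambda>i\<in>UNIV. Z i \<omega>) = (\<Pi>\<^sub>M i\<in>UNIV. distr K borel (Z i))"
      using K.indep_vars_iff_distr_eq_PiM[of UNIV Z "\<lambda>_. borel"] assms(15) rvZ by auto
    then show ?thesis by (simp add: Q_def[abs_def] restrict_def assms(16) zN)
  qed
  \<comment> \<open>The theorem uses the vectors as columns, \<open>expected_det\<close> as
    rows.\<close>
  have detT: "det (\<chi> i j. Z j \<omega> $ i) = det (\<chi> i. Q \<omega> i)" for \<omega>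
    using det_transpose[of "\<chi> i. Q \<omega> i"] by (simp add: transpose_def Q_def)
  have D: "expected_det = (\<integral>\<^sup>+\<omega>. ennreal \<bar>det (\<chi> i j. Z j \<omega> $ i)\<bar> \<partial>K)"
    unfolding expected_det_def lawQ[symmetric] detT
    by (rule nn_integral_distr[OF Q]) (simp add: measurable_det_rows)
  have "(\<lambda>\<omega>. det (\<chi> i j. Z j \<omega> $ i)) \<in> borel_measurable K"
  proof -
    note [measurable] = rvZ
    show ?thesis unfolding det_def by measurable
  qed
  \<comment> \<open>Finiteness of \<open>expected_det\<close> is what permits the passage from the
    nonnegative integral to the Bochner integral of the statement.\<close>
  then have int: "ennreal (\<integral>\<omega>. \<bar>det (\<chi> i j. Z j \<omega> $ i)\<bar> \<partial>K) = expected_det"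
    using expected_det_finite unfolding D
    by (intro nn_integral_eq_integral[symmetric] integrableI_bounded) auto
  have "(\<integral>\<^sup>+\<omega>. num_essential (W \<omega>) \<partial>M) = (\<integral>\<^sup>+w. num_essential w \<partial>distr M (\<Pi>\<^sub>M i\<in>UNIV. borel) W)"
    by (rule nn_integral_distr[OF W, symmetric]) simp
  also have "\<dots> = ennreal (pi ^ 3 / 4) * expected_det"
    unfolding lawW by (rule nn_integral_num_essential)
  also have "\<dots> = ennreal (pi ^ 3 / 4 * (\<integral>\<omega>. \<bar>det (\<chi> i j. Z j \<omega> $ i)\<bar> \<partial>K))"
    unfolding int[symmetric] by (rule ennreal_mult[symmetric]) auto
  finally show ?thesis
    unfolding num using measurable_compose[OF W measurable_num_essential] by simp
qed

end
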